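(* Consider the following potentials in $\mathbb{C}[x_1,x_2]$: $$W^{(\mathrm{A}_{d-1})}=x_1^d+x_2^2\ (d\ge 2),\quad W^{(\mathrm{D}_{d+1})}=x_1^d+x_1x_2^2\ (d\ge 3),$$ $$W^{(\mathrm{E}_6)}=x_1^3+x_2^4,\quad W^{(\mathrm{E}_7)}=x_1^3+x_1x_2^3,\quad W^{(\mathrm{E}_8)}=x_1^3+x_2^5 .$$ The equivalence classes of these potentials under orbifold equivalence (restricted to this list) are precisely: - $\{W^{(\mathrm{A}_{d-1})}\}$ for $d$ odd; - $\{W^{(\mathrm{A}_{d-1})},W^{(\mathrm{D}_{d/2+1})}\}$ for $d$ even, $d\notin\{12,18,30\}$ (where $W^{(\mathrm{D}_{d/2+1})}$ is present only if $d/2\ge 3$); - $\{W^{(\mathrm{A}_{11})},W^{(\mathrm{D}_{7})},W^{(\mathrm{E}_6)}\}$, $\{W^{(\mathrm{A}_{17})},W^{(\mathrm{D}_{10})},W^{(\mathrm{E}_7)}\}$, $\{W^{(\mathrm{A}_{29})},W^{(\mathrm{D}_{16})},W^{(\mathrm{E}_8)}\}$.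
   Context: Each polynomial ring is $\mathbb{Q}$-graded with positive variable degrees such that the potential is homogeneous of degree $2$ (for the listed potentials these degrees are uniquely determined). For homogeneous potentials $V\in\mathbb{C}[x_1,\dots,x_m]$, $W\in\mathbb{C}[y_1,\dots,y_n]$ (polynomials with a critical point at $0$ and finite-dimensional Jacobi ring), a finite-rank graded matrix factorization of $W-V$ is a pair $(X,d_X)$, where $X=X^0\oplus X^1$ is a $\mathbb{Z}_2$-graded, $\mathbb{Q}$-graded free $\mathbb{C}[x,y]$-module of finite rank, and $d_X$ is a $\mathbb{Z}_2$-odd $\mathbb{C}[x,y]$-linear endomorphism of $\mathbb{Q}$-degree $1$ with $d_X\circ d_X=(W-V)\,\mathrm{id}_X$. Choosing a basis (so that $d_X$ is a matrix), its left and right quantum dimensions are $$\mathrm{qdim}_l(X)=(-1)^{\binom{m+1}{2}}\mathrm{Res}\left[\frac{\mathrm{str}(\partial_{x_1}d_X\cdots\partial_{x_m}d_X\,\partial_{y_1}d_X\cdots\partial_{y_n}d_X)\,dy}{\partial_{y_1}W,\dots,\partial_{y_n}W}\right],$$ $$\mathrm{qdim}_r(X)=(-1)^{\binom{n+1}{2}}\mathrm{Res}\left[\frac{\mathrm{str}(\partial_{x_1}d_X\cdots\partial_{x_m}d_X\,\partial_{y_1}d_X\cdots\partial_{y_n}d_X)\,dx}{\partial_{x_1}V,\dots,\partial_{x_m}V}\right],$$ where $\mathrm{str}$ is the supertrace and $\mathrm{Res}$ the (Grothendieck) residue in the indicated variables; $\mathrm{qdim}_l$ is regarded as an element of the Jacobi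 ring of $V$ and $\mathrm{qdim}_r$ as an element of the Jacobi ring of $W$. The potentials $V$ and $W$ are orbifold equivalent, $V\sim W$, if there exists a finite-rank graded matrix factorization of $W-V$ whose left and right quantum dimensions are both non-zero. (This is an equivalence relation.) *)

theory Defs
  imports
    "HOL-Library.Poly_Mapping"
    "Jordan_Normal_Form.Determinant"
begin

section \<open>Polynomials with complex coefficients\<close>

text \<open>Monomials are finitely supported exponent functions, multiplication is the convolution
  product of finitely supported functions. The set of variables is a type that may be infinite;
  the ring $\mathbf{C}[S]$ is singled out by \<open>polys_in S\<close>.\<close>

type_synonym 'v mpol = "('v \<Rightarrow>\<^sub>0 nat) \<Rightarrow>\<^sub>0 complex"

definition Cst :: "complex \<Rightarrow> 'v mpol" where
  "Cst c = Poly_Mapping.single 0 c"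

definition Vr :: "'v \<Rightarrow> 'v mpol" where
  "Vr v = Poly_Mapping.single (Poly_Mapping.single v 1) 1"

definition polys_in :: "'v set \<Rightarrow> 'v mpol set" where
  "polys_in S = {p. \<forall>m \<in> Poly_Mapping.keys p. Poly_Mapping.keys m \<subseteq> S}"

definition homogeneous :: "('v \<Rightarrow> rat) \<Rightarrow> rat \<Rightarrow> 'v mpol \<Rightarrow> bool" where
  "homogeneous w q p \<longleftrightarrow>
     (\<forall>m \<in> Poly_Mapping.keys p.
        (\<Sum>v \<in> Poly_Mapping.keys m. of_nat (Poly_Mapping.lookup m v) * w v) = q)"

definition pdiff :: "'v \<Rightarrow> 'v mpol \<Rightarrow> 'v mpol" where
  "pdiff v p =
     (\<Sum>m \<in> Poly_Mapping.keys p.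
        Poly_Mapping.single (m - Poly_Mapping.single v 1)
          (of_nat (Poly_Mapping.lookup m v) * Poly_Mapping.lookup p m))"

definition msubst :: "('v \<Rightarrow> 'u mpol) \<Rightarrow> 'v mpol \<Rightarrow> 'u mpol" where
  "msubst \<phi> p =
     (\<Sum>m \<in> Poly_Mapping.keys p.
        Cst (Poly_Mapping.lookup p m) *
        (\<Prod>v \<in> Poly_Mapping.keys m. \<phi> v ^ Poly_Mapping.lookup m v))"

definition rename :: "('v \<Rightarrow> 'u) \<Rightarrow> 'v mpol \<Rightarrow> 'u mpol" where
  "rename f = msubst (\<lambda>v. Vr (f v))"

text \<open>The ideal of $\mathbf{C}[S]$ generated by the partial derivatives of \<open>F\<close>; the Jacobi ring
  is the quotient of \<open>polys_in S\<close> by it (for finite \<open>S\<close>).\<close>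

definition jacobi_ideal :: "'v set \<Rightarrow> 'v mpol \<Rightarrow> 'v mpol set" where
  "jacobi_ideal S F =
     {(\<Sum>v\<in>S. h v * pdiff v F) | h. \<forall>v\<in>S. h v \<in> polys_in S}"

definition jacobi_finite_dim :: "'v set \<Rightarrow> 'v mpol \<Rightarrow> bool" where
  "jacobi_finite_dim S F \<longleftrightarrow>
     (\<exists>B. finite B \<and> B \<subseteq> polys_in S \<and>
        (\<forall>f \<in> polys_in S. \<exists>c. f - (\<Sum>b\<in>B. Cst (c b) * b) \<in> jacobi_ideal S F))"


section \<open>Grothendieck residues\<close>

text \<open>For an exponent \<open>\<mu>\<close> supported in \<open>Y\<close>: the coefficient of the monomial \<open>\<mu>\<close>, where \<open>p\<close> is
  viewed as a polynomial in the variables \<open>Y\<close> whose coefficients are polynomials in the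
  remaining variables.\<close>

definition coeff_in :: "'v set \<Rightarrow> ('v \<Rightarrow>\<^sub>0 nat) \<Rightarrow> 'v mpol \<Rightarrow> 'v mpol" where
  "coeff_in Y \<mu> p =
     (\<Sum>m \<in> {m \<in> Poly_Mapping.keys p.
               \<forall>v\<in>Y. Poly_Mapping.lookup m v = Poly_Mapping.lookup \<mu> v}.
        Poly_Mapping.single (m - \<mu>) (Poly_Mapping.lookup p m))"

text \<open>The residue of $g\,dy_1\cdots dy_n$ over $f_1,\dots,f_n$, relative to the polynomial ring in
  all other variables, is given by two rules. The transformation law: if
  $y_j^{a_j} = \sum_k C_{jk} f_k$ for all $j$, then the residue equals that of
  $\det(C)\,g\,dy$ over $y_1^{a_1},\dots,y_n^{a_n}$. The normalisation: the residue of $h\,dy$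
  over $y_1^{a_1},\dots,y_n^{a_n}$ is the coefficient of $y_1^{a_1-1}\cdots y_n^{a_n-1}$ in $h$.
  The exponents are written $a_j + 1$ below. The value does not depend on the choice of the
  exponents and of \<open>C\<close>; such a choice exists whenever some power of each $y_j$ lies in the ideal
  $(f_1,\dots,f_n)$, as for the partial derivatives of a potential.\<close>

definition groth_residue ::
    "nat \<Rightarrow> (nat \<Rightarrow> 'v) \<Rightarrow> (nat \<Rightarrow> 'v mpol) \<Rightarrow> 'v mpol \<Rightarrow> 'v mpol" where
  "groth_residue n y f g =
     (THE r. \<exists>a C. C \<in> carrier_mat n n \<and>
        (\<forall>j<n. Vr (y j) ^ Suc (a j) = (\<Sum>k<n. C $$ (j, k) * f k)) \<and>
        r = coeff_in (y ` {..<n}) (\<Sum>j<n. Poly_Mapping.single (y j) (a j)) (det C * g))"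


section \<open>Potentials and matrix factorizations\<close>

text \<open>A polynomial in the variables \<open>0, \<dots>, nvars - 1\<close> together with the rational degrees of
  these variables.\<close>

record graded_poly =
  nvars :: nat
  vdeg :: "nat \<Rightarrow> rat"
  pot :: "nat mpol"

definition potential :: "graded_poly \<Rightarrow> bool" where
  "potential W \<longleftrightarrow>
     pot W \<in> polys_in {..<nvars W} \<and>
     (\<forall>i<nvars W. vdeg W i > 0) \<and>
     homogeneous (vdeg W) 2 (pot W) \<and>
     (\<forall>i<nvars W. Poly_Mapping.lookup (pdiff i (pot W)) 0 = 0) \<and>
     jacobi_finite_dim {..<nvars W} (pot W)"

text \<open>In $\mathbf{C}[x_1,\dots,x_m,y_1,\dots,y_n]$ the variable $x_{i+1}$ is \<open>Inl i\<close> and $y_{j+1}$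
  is \<open>Inr j\<close>.\<close>

definition x_vars :: "graded_poly \<Rightarrow> (nat + nat) list" where
  "x_vars V = map Inl [0..<nvars V]"

definition y_vars :: "graded_poly \<Rightarrow> (nat + nat) list" where
  "y_vars W = map Inr [0..<nvars W]"

definition in_x :: "graded_poly \<Rightarrow> (nat + nat) mpol" where
  "in_x V = rename Inl (pot V)"

definition in_y :: "graded_poly \<Rightarrow> (nat + nat) mpol" where
  "in_y W = rename Inr (pot W)"

text \<open>A finite-rank graded matrix factorization of \<open>W(y) - V(x)\<close>, in a homogeneous basis whose
  first \<open>p\<close> elements are even and whose last \<open>q\<close> elements are odd; \<open>\<delta> i\<close> is the rational degree
  of the \<open>i\<close>-th basis element \<open>e\<^sub>i\<close>. Since \<open>d e\<^sub>j = (\<Sum>i. d\<^sub>i\<^sub>j e\<^sub>i)\<close> has degree \<open>\<delta> j + 1\<close>, the entry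
  \<open>d\<^sub>i\<^sub>j\<close> has degree \<open>\<delta> j + 1 - \<delta> i\<close>.\<close>

definition graded_mf ::
    "graded_poly \<Rightarrow> graded_poly \<Rightarrow> nat \<Rightarrow> nat \<Rightarrow> (nat \<Rightarrow> rat) \<Rightarrow> (nat + nat) mpol mat \<Rightarrow> bool" where
  "graded_mf V W p q \<delta> d \<longleftrightarrow>
     d \<in> carrier_mat (p + q) (p + q) \<and>
     (\<forall>i < p + q. \<forall>j < p + q.
        d $$ (i, j) \<in> polys_in (set (x_vars V) \<union> set (y_vars W)) \<and>
        homogeneous (case_sum (vdeg V) (vdeg W)) (\<delta> j + 1 - \<delta> i) (d $$ (i, j)) \<and>
        ((i < p \<longleftrightarrow> j < p) \<longrightarrow> d $$ (i, j) = 0)) \<and>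
     d * d = (in_y W - in_x V) \<cdot>\<^sub>m 1\<^sub>m (p + q)"

definition supertrace :: "nat \<Rightarrow> nat \<Rightarrow> 'a :: comm_ring_1 mat \<Rightarrow> 'a" where
  "supertrace p q M = (\<Sum>i<p. M $$ (i, i)) - (\<Sum>i\<in>{p..<p + q}. M $$ (i, i))"

text \<open>The supertrace of
  $\partial_{x_1} d \cdots \partial_{x_m} d\, \partial_{y_1} d \cdots \partial_{y_n} d$.\<close>

definition str_derivs ::
    "graded_poly \<Rightarrow> graded_poly \<Rightarrow> nat \<Rightarrow> nat \<Rightarrow> (nat + nat) mpol mat \<Rightarrow> (nat + nat) mpol" where
  "str_derivs V W p q d =
     supertrace p q (foldr (\<lambda>v M. map_mat (pdiff v) d * M) (x_vars V @ y_vars W) (1\<^sub>m (p + q)))"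

definition qdim_l ::
    "graded_poly \<Rightarrow> graded_poly \<Rightarrow> nat \<Rightarrow> nat \<Rightarrow> (nat + nat) mpol mat \<Rightarrow> (nat + nat) mpol" where
  "qdim_l V W p q d =
     (- 1) ^ (Suc (nvars V) choose 2) *
     groth_residue (nvars W) Inr (\<lambda>j. pdiff (Inr j) (in_y W)) (str_derivs V W p q d)"

definition qdim_r ::
    "graded_poly \<Rightarrow> graded_poly \<Rightarrow> nat \<Rightarrow> nat \<Rightarrow> (nat + nat) mpol mat \<Rightarrow> (nat + nat) mpol" where
  "qdim_r V W p q d =
     (- 1) ^ (Suc (nvars W) choose 2) *
     groth_residue (nvars V) Inl (\<lambda>i. pdiff (Inl i) (in_x V)) (str_derivs V W p q d)"

text \<open>The quantum dimensions are representatives of elements of Jacobi rings, so being non-zero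
  means not lying in the Jacobi ideal.\<close>

definition orbifold_equivalent :: "graded_poly \<Rightarrow> graded_poly \<Rightarrow> bool" where
  "orbifold_equivalent V W \<longleftrightarrow>
     potential V \<and> potential W \<and>
     (\<exists>p q \<delta> d. graded_mf V W p q \<delta> d \<and>
        qdim_l V W p q d \<notin> jacobi_ideal (set (x_vars V)) (in_x V) \<and>
        qdim_r V W p q d \<notin> jacobi_ideal (set (y_vars W)) (in_y W))"


section \<open>Simple singularities in two variables\<close>

definition two_vars :: "rat \<Rightarrow> rat \<Rightarrow> nat mpol \<Rightarrow> graded_poly" where
  "two_vars a b F = \<lparr>nvars = 2, vdeg = (\<lambda>i. if i = 0 then a else b), pot = F\<rparr>"

text \<open>The index is the Milnor number, that is, the rank of the root system.\<close>

definition W_A :: "nat \<Rightarrow> graded_poly" where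
  "W_A k = two_vars (2 / of_nat (k + 1)) 1 (Vr 0 ^ (k + 1) + Vr 1 ^ 2)"

definition W_D :: "nat \<Rightarrow> graded_poly" where
  "W_D k = two_vars (2 / of_nat (k - 1)) (1 - 1 / of_nat (k - 1)) (Vr 0 ^ (k - 1) + Vr 0 * Vr 1 ^ 2)"

definition W_E6 :: graded_poly where
  "W_E6 = two_vars (2 / 3) (1 / 2) (Vr 0 ^ 3 + Vr 1 ^ 4)"

definition W_E7 :: graded_poly where
  "W_E7 = two_vars (2 / 3) (4 / 9) (Vr 0 ^ 3 + Vr 0 * Vr 1 ^ 3)"

definition W_E8 :: graded_poly where
  "W_E8 = two_vars (2 / 3) (2 / 5) (Vr 0 ^ 3 + Vr 1 ^ 5)"

definition ADE :: "graded_poly set" where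
  "ADE = {W_A (d - 1) | d. d \<ge> 2} \<union> {W_D (d + 1) | d. d \<ge> 3} \<union> {W_E6, W_E7, W_E8}"

text \<open>The degrees in \<open>two_vars\<close> are the only ones for which the polynomials are homogeneous of
  degree 2.\<close>

lemma Vr_power: "Vr v ^ n = Poly_Mapping.single (Poly_Mapping.single v n) 1"
  by (induction n) (simp_all add: Vr_def mult_single single_add[symmetric] flip: single_one)

lemma Vr_power_mult:
  "Vr u ^ a * Vr v ^ b =
   Poly_Mapping.single (Poly_Mapping.single u a + Poly_Mapping.single v b) 1"
  by (simp add: Vr_power mult_single)

definition mono2 :: "nat \<Rightarrow> nat \<Rightarrow> nat \<Rightarrow>\<^sub>0 nat" where
  "mono2 a b = Poly_Mapping.single 0 a + Poly_Mapping.single 1 b"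

lemma mono2_eq_iff: "mono2 a b = mono2 c e \<longleftrightarrow> a = c \<and> b = e"
proof
  assume *: "mono2 a b = mono2 c e"
  have "Poly_Mapping.lookup (mono2 a b) i = Poly_Mapping.lookup (mono2 c e) i" for i
    using * by simp
  from this[of 0] this[of 1] show "a = c \<and> b = e"
    by (simp_all add: mono2_def lookup_add lookup_single)
qed simp

lemma mono2_degree:
  "(\<Sum>v \<in> Poly_Mapping.keys (mono2 a b). of_nat (Poly_Mapping.lookup (mono2 a b) v) * w v) =
   of_nat a * w 0 + of_nat b * (w 1 :: rat)"
proof -
  let ?m = "mono2 a b"
  have "Poly_Mapping.keys ?m \<subseteq> {0, 1}"
    by (auto simp: mono2_def in_keys_iff lookup_add lookup_single when_def split: if_splits)
  then have "(\<Sum>v \<in> Poly_Mapping.keys ?m. of_nat (Poly_Mapping.lookup ?m v) * w v) =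
      (\<Sum>v \<in> {0, 1}. of_nat (Poly_Mapping.lookup ?m v) * w v)"
    by (intro sum.mono_neutral_left) (auto simp: in_keys_iff)
  then show ?thesis
    by (simp add: mono2_def lookup_add lookup_single)
qed

lemma homogeneous_two_terms:
  assumes "(a, b) \<noteq> (c, e)"
  shows "homogeneous w s (Vr 0 ^ a * Vr 1 ^ b + Vr 0 ^ c * Vr 1 ^ e) \<longleftrightarrow>
    of_nat a * w 0 + of_nat b * w 1 = s \<and> of_nat c * w 0 + of_nat e * w (1 :: nat) = s"
proof -
  have "mono2 a b \<noteq> mono2 c e"
    using assms by (simp add: mono2_eq_iff)
  then have "Poly_Mapping.keys (Poly_Mapping.single (mono2 a b) 1 +
      Poly_Mapping.single (mono2 c e) (1 :: complex)) = {mono2 a b, mono2 c e}"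
    by (auto simp: in_keys_iff lookup_add lookup_single when_def split: if_splits)
  then show ?thesis
    by (simp add: homogeneous_def Vr_power_mult mono2_degree del: One_nat_def flip: mono2_def)
qed

lemma ADE_degrees_unique:
  assumes "W \<in> ADE"
  shows "homogeneous w 2 (pot W) \<longleftrightarrow> w 0 = vdeg W 0 \<and> w 1 = vdeg W 1"
proof -
  consider d where "d \<ge> 2" "W = W_A (d - 1)" | d where "d \<ge> 3" "W = W_D (d + 1)"
    | "W = W_E6" | "W = W_E7" | "W = W_E8"
    using assms unfolding ADE_def by blast
  then show ?thesis
  proof cases
    case 1
    have "homogeneous w 2 (Vr 0 ^ d * Vr 1 ^ 0 + Vr 0 ^ 0 * Vr 1 ^ 2) \<longleftrightarrow>
        of_nat d * w 0 = 2 \<and> 2 * w 1 = 2"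
      using \<open>d \<ge> 2\<close> by (subst homogeneous_two_terms) auto
    then show ?thesis
      using 1 by (auto simp: W_A_def two_vars_def field_simps)
  next
    case 2
    have "homogeneous w 2 (Vr 0 ^ d * Vr 1 ^ 0 + Vr 0 ^ 1 * Vr 1 ^ 2) \<longleftrightarrow>
        of_nat d * w 0 = 2 \<and> w 0 + 2 * w 1 = 2"
      using \<open>d \<ge> 3\<close> by (subst homogeneous_two_terms) auto
    moreover have "of_nat d * w 0 = 2 \<longleftrightarrow> w 0 = 2 / of_nat d"
      using \<open>d \<ge> 3\<close> by (auto simp: field_simps)
    ultimately show ?thesis
      using 2 by (auto simp: W_D_def two_vars_def)
  next
    case 3
    have "homogeneous w 2 (Vr 0 ^ 3 * Vr 1 ^ 0 + Vr 0 ^ 0 * Vr 1 ^ 4) \<longleftrightarrow>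
        3 * w 0 = 2 \<and> 4 * w 1 = 2"
      by (subst homogeneous_two_terms) auto
    then show ?thesis
      using 3 by (auto simp: W_E6_def two_vars_def)
  next
    case 4
    have "homogeneous w 2 (Vr 0 ^ 3 * Vr 1 ^ 0 + Vr 0 ^ 1 * Vr 1 ^ 3) \<longleftrightarrow>
        3 * w 0 = 2 \<and> w 0 + 3 * w 1 = 2"
      by (subst homogeneous_two_terms) auto
    then show ?thesis
      using 4 by (auto simp: W_E7_def two_vars_def)
  next
    case 5
    have "homogeneous w 2 (Vr 0 ^ 3 * Vr 1 ^ 0 + Vr 0 ^ 0 * Vr 1 ^ 5) \<longleftrightarrow>
        3 * w 0 = 2 \<and> 5 * w 1 = 2"
      by (subst homogeneous_two_terms) auto
    then show ?thesis
      using 5 by (auto simp: W_E8_def two_vars_def)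
  qed
qed

definition orbifold_rel :: "(graded_poly \<times> graded_poly) set" where
  "orbifold_rel = {(V, W). V \<in> ADE \<and> W \<in> ADE \<and> orbifold_equivalent V W}"

end

theory Submission
  imports Defs "HOL-Computational_Algebra.Fundamental_Theorem_Algebra"
begin

text \<open>Both quantum dimensions are homogeneous, of the opposite degrees \<open>\<plusminus>(\<Sigma> deg x - \<Sigma> deg y)\<close>.
  As non-zero polynomials have non-negative degree, equivalent potentials have the same sum of variable
  degrees, which is \<open>1 + 2/h\<close> for the Coxeter number \<open>h\<close>; and the quantum dimensions of an equivalence
  are constants, so that it suffices to find one non-vanishing coefficient of each.

  For the converse, Koszul factorizations give reflexivity. All other equivalences of a potential \<open>W\<close>
  with \<open>u\<^bsup>2k\<^esup> + v\<^sup>2\<close> come from a square matrix \<open>M(u)\<close> with \<open>M\<^sup>2 = W - u\<^bsup>2k\<^esup>\<close>,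
  factorizing \<open>W - u\<^bsup>2k\<^esup> - v\<^sup>2\<close> as \<open>(M - v)(M + v)\<close>. Writing \<open>M = E(u\<^sup>2) + u F(u\<^sup>2)\<close>, substituting
  \<open>v = u q\<close> and restricting scalars from \<open>u\<close> to \<open>p = u\<^sup>2\<close> yields an equivalence of \<open>W\<close> with
  \<open>p\<^sup>k + p q\<^sup>2\<close>. For D, E6 and E7 the matrix has size two and corresponds to a section of the surface
  \<open>W = v\<^sup>2\<close> over the \<open>u\<close>-line that is polynomial in \<open>u\<close>; E8 needs size four.\<close>

text \<open>Matrix factorizations are never composed. Transitivity is read off from the final answer
  instead, so every pair inside a class needs a factorization of its own; hence one matrix M has to
  yield the pairs A-W and D-W at once. The second comes from the involution (u, v) -> (-u, -v): p =
  u^2 and q = v/u are invariant under it, and u^(2k) + v^2 = p^k + p q^2. The residue is a definite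
  description, so no quantum dimension can be computed before its value is known to be independent
  of the chosen exponents and matrix. The constructions for E6, E7 and E8 involve a root of a
  polynomial of degree 2, 3 and 4. No root is written down: a coefficient that must not vanish is
  shown to be a unit modulo that polynomial, by an identity whose right-hand side is a non-zero
  constant plus a multiple of the polynomial. The coefficients themselves are isolated by setting
  all other variables to zero.\<close>

abbreviation lookup where "lookup \<equiv> Poly_Mapping.lookup"
abbreviation keys where "keys \<equiv> Poly_Mapping.keys"
abbreviation single where "single \<equiv> Poly_Mapping.single"

section \<open>Substitution, derivatives, coefficients and weighted degrees of finitely supported
  polynomials\<close>

section \<open>Multivariate polynomials\<close>

lemma poly_mapping_eq_sum_single: "p = (\<Sum>m\<in>keys p. single m (lookup p m))"
proof (rule poly_mapping_eqI)
  fix k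
  show "lookup p k = lookup (\<Sum>m\<in>keys p. single m (lookup p m)) k"
    by (simp add: lookup_sum lookup_single when_def in_keys_iff)
qed

text \<open>Operations defined as sums over \<open>keys\<close> are additive, so their laws need
  checking only on single terms.\<close>

lemma single_induct [case_names single add]:
  fixes p :: "'a \<Rightarrow>\<^sub>0 'b::comm_monoid_add"
  assumes single: "\<And>m c. P (single m c)" and add: "\<And>p q. P p \<Longrightarrow> P q \<Longrightarrow> P (p + q)"
  shows "P p"
proof -
  have "P (\<Sum>m\<in>A. single m (lookup p m))" if "finite A" for A
    using that
  proof induction
    case empty
    then show ?case using single[of undefined 0] by simp
  qed (simp add: single add)
  then show ?thesis
    using poly_mapping_eq_sum_single[of p] by (metis finite_keys)
qed

lemma sum_keys_superset:
  assumes "finite A" "keys p \<subseteq> A" "\<And>m. g m 0 = 0"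
  shows "(\<Sum>m\<in>keys p. g m (lookup p m)) = (\<Sum>m\<in>A. g m (lookup p m))"
  using assms by (intro sum.mono_neutral_left) (auto simp: in_keys_iff)

text \<open>Cancellation can make \<open>keys (p + q)\<close> smaller than the union of the
  supports. Since \<open>g m 0 = 0\<close>, all three sums may be taken over that union.\<close>

lemma sum_keys_add:
  assumes "\<And>m. g m 0 = 0" "\<And>m a b. g m (a + b) = g m a + g m b"
  shows "(\<Sum>m\<in>keys (p + q). g m (lookup (p + q) m)) =
    (\<Sum>m\<in>keys p. g m (lookup p m)) + (\<Sum>m\<in>keys q. g m (lookup q m))"
  using sum_keys_superset[of "keys p \<union> keys q" p g] sum_keys_superset[of "keys p \<union> keys q" q g]
    sum_keys_superset[of "keys p \<union> keys q" "p + q" g] keys_add[of p q]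
  by (simp add: assms lookup_add sum.distrib)

lemma Cst_0 [simp]: "Cst 0 = 0" and Cst_1 [simp]: "Cst 1 = 1"
  by (simp_all add: Cst_def)

lemma Cst_add: "Cst (a + b) = Cst a + Cst b"
  by (simp add: Cst_def single_add)

lemma Cst_diff: "Cst (a - b) = Cst a - Cst b"
  by (simp add: Cst_def single_diff)

lemma Cst_uminus: "Cst (- a) = - Cst a"
  by (simp add: Cst_def single_uminus)

lemma Cst_mult: "Cst (a * b) = Cst a * Cst b"
  by (simp add: Cst_def mult_single)

lemma Cst_power: "Cst (a ^ n) = Cst a ^ n"
  by (induction n) (simp_all add: Cst_mult)

lemma Cst_numeral [simp]: "Cst (numeral n) = numeral n"
  by (simp add: Cst_def)

lemma Cst_of_nat [simp]: "Cst (of_nat n) = of_nat n"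
  by (simp add: Cst_def)

lemma single_eq_Cst_mult: "single m c = Cst c * single m 1"
  by (simp add: Cst_def mult_single)

lemma single_1_eq_prod: "single m (1::complex) = (\<Prod>v\<in>keys m. Vr v ^ lookup m v)"
proof -
  have "single (\<Sum>v\<in>A. single v (lookup m v)) (1::complex) = (\<Prod>v\<in>A. Vr v ^ lookup m v)"
    if "finite A" for A
    using that
  proof induction
    case (insert a A)
    have "single (\<Sum>v\<in>insert a A. single v (lookup m v)) (1::complex) =
        single (single a (lookup m a)) 1 * single (\<Sum>v\<in>A. single v (lookup m v)) 1"
      using insert.hyps by (simp add: mult_single)
    then show ?case
      using insert by (simp add: Vr_power)
  qed simp
  then show ?thesis
    using poly_mapping_eq_sum_single[of m] by (metis finite_keys)
qed

text \<open>Suited to ring homomorphisms and derivations, for which constants and variables suffice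
  as generators.\<close>

lemma mpol_induct [case_names Cst Vr add mult]:
  fixes p :: "'v mpol"
  assumes Cst: "\<And>c. P (Cst c)" and Vr: "\<And>v. P (Vr v)"
    and add: "\<And>p q. P p \<Longrightarrow> P q \<Longrightarrow> P (p + q)" and mult: "\<And>p q. P p \<Longrightarrow> P q \<Longrightarrow> P (p * q)"
  shows "P p"
proof (induction p rule: single_induct)
  case (single m c)
  have pow: "P (Vr v ^ n)" for v n
    by (induction n) (use Cst[of 1] Vr mult in auto)
  have "P (\<Prod>v\<in>A. Vr v ^ lookup m v)" if "finite A" for A
    using that by induction (use Cst[of 1] pow mult in auto)
  then show ?case
    by (metis single_eq_Cst_mult single_1_eq_prod finite_keys Cst mult)
qed (rule add)

subsection \<open>Substitution\<close>

definition mon_eval :: "('v \<Rightarrow> 'a::comm_monoid_mult) \<Rightarrow> ('v \<Rightarrow>\<^sub>0 nat) \<Rightarrow> 'a" where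
  "mon_eval \<phi> m = (\<Prod>v\<in>keys m. \<phi> v ^ lookup m v)"

lemma mon_eval_superset:
  assumes "finite A" "keys m \<subseteq> A"
  shows "mon_eval \<phi> m = (\<Prod>v\<in>A. \<phi> v ^ lookup m v)"
  unfolding mon_eval_def using assms by (intro prod.mono_neutral_left) (auto simp: in_keys_iff)

lemma mon_eval_add: "mon_eval \<phi> (m + n) = mon_eval \<phi> m * mon_eval \<phi> n"
  using mon_eval_superset[of "keys m \<union> keys n" "m + n" \<phi>] keys_add[of m n]
    mon_eval_superset[of "keys m \<union> keys n" m \<phi>] mon_eval_superset[of "keys m \<union> keys n" n \<phi>]
  by (simp add: lookup_add power_add prod.distrib)

lemma msubst_eq: "msubst \<phi> p = (\<Sum>m\<in>keys p. Cst (lookup p m) * mon_eval \<phi> m)"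
  by (simp add: msubst_def mon_eval_def)

lemma msubst_single: "msubst \<phi> (single m c) = Cst c * mon_eval \<phi> m"
  by (simp add: msubst_eq)

lemma msubst_add [simp]: "msubst \<phi> (p + q) = msubst \<phi> p + msubst \<phi> q"
  unfolding msubst_eq by (rule sum_keys_add) (simp_all add: Cst_add ring_distribs)

lemma msubst_mult [simp]: "msubst \<phi> (p * q) = msubst \<phi> p * msubst \<phi> q"
proof (induction p rule: single_induct)
  case (single m c)
  show ?case
    by (induction q rule: single_induct)
      (simp_all add: mult_single msubst_single mon_eval_add Cst_mult ring_distribs)
qed (simp add: ring_distribs)

lemma msubst_Cst [simp]: "msubst \<phi> (Cst c) = Cst c"
proof -
  have "msubst \<phi> (single 0 c) = Cst c * mon_eval \<phi> 0"
    by (rule msubst_single)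
  then show ?thesis
    unfolding Cst_def by (simp add: mon_eval_def)
qed

lemma msubst_Vr [simp]: "msubst \<phi> (Vr v) = \<phi> v"
  by (simp add: Vr_def msubst_single) (simp add: mon_eval_def)

lemma msubst_0 [simp]: "msubst \<phi> 0 = 0" and msubst_1 [simp]: "msubst \<phi> 1 = 1"
  by (metis Cst_0 msubst_Cst, metis Cst_1 msubst_Cst)

lemma msubst_uminus [simp]: "msubst \<phi> (- p) = - msubst \<phi> p"
  by (rule minus_unique[symmetric]) (simp flip: msubst_add)

lemma msubst_diff [simp]: "msubst \<phi> (p - q) = msubst \<phi> p - msubst \<phi> q"
  by (simp only: diff_conv_add_uminus msubst_add msubst_uminus)

lemma msubst_power [simp]: "msubst \<phi> (p ^ n) = msubst \<phi> p ^ n"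
  by (induction n) simp_all

lemma msubst_sum: "msubst \<phi> (sum f A) = (\<Sum>i\<in>A. msubst \<phi> (f i))"
  by (induction A rule: infinite_finite_induct) simp_all

lemma msubst_numeral [simp]: "msubst \<phi> (numeral n) = numeral n"
  by (metis Cst_numeral msubst_Cst)

lemma msubst_of_nat [simp]: "msubst \<phi> (of_nat n) = of_nat n"
  by (induction n) simp_all

lemma msubst_msubst: "msubst \<psi> (msubst \<phi> p) = msubst (\<lambda>v. msubst \<psi> (\<phi> v)) p"
  by (induction p rule: mpol_induct) simp_all

subsection \<open>Polynomials in a set of variables\<close>

lemma polys_in_Cst [simp]: "Cst c \<in> polys_in S"
  by (auto simp: polys_in_def Cst_def split: if_splits)

lemma polys_in_0 [simp]: "0 \<in> polys_in S"
  by (simp add: polys_in_def)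

lemma polys_in_1 [simp]: "1 \<in> polys_in S"
  by (simp add: polys_in_def)

lemma polys_in_numeral [simp]: "numeral n \<in> polys_in S"
  using polys_in_Cst[of "numeral n"] by simp

lemma polys_in_of_nat [simp]: "of_nat n \<in> polys_in S"
  using polys_in_Cst[of "of_nat n"] by simp

lemma polys_in_Vr: "Vr v \<in> polys_in S \<longleftrightarrow> v \<in> S"
  by (auto simp: polys_in_def Vr_def)

lemma polys_in_add: "p \<in> polys_in S \<Longrightarrow> q \<in> polys_in S \<Longrightarrow> p + q \<in> polys_in S"
  unfolding polys_in_def using keys_add[of p q] by blast

lemma polys_in_mult: "p \<in> polys_in S \<Longrightarrow> q \<in> polys_in S \<Longrightarrow> p * q \<in> polys_in S"
proof -
  assume *: "p \<in> polys_in S" "q \<in> polys_in S"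
  have "keys m \<subseteq> S" if "m \<in> keys (p * q)" for m
  proof -
    obtain a b where "m = a + b" "a \<in> keys p" "b \<in> keys q"
      using keys_mult[of p q] \<open>m \<in> keys (p * q)\<close> by blast
    then show ?thesis
      using * keys_add[of a b] by (fastforce simp: polys_in_def)
  qed
  then show ?thesis by (simp add: polys_in_def)
qed

lemma polys_in_uminus: "p \<in> polys_in S \<Longrightarrow> - p \<in> polys_in S"
  by (simp add: polys_in_def in_keys_iff)

lemma polys_in_diff: "p \<in> polys_in S \<Longrightarrow> q \<in> polys_in S \<Longrightarrow> p - q \<in> polys_in S"
  using polys_in_add[of p S "- q"] polys_in_uminus[of q S] by simp

lemma polys_in_power: "p \<in> polys_in S \<Longrightarrow> p ^ n \<in> polys_in S"
  by (induction n) (simp_all add: polys_in_mult)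

lemma polys_in_sum: "(\<And>i. i \<in> A \<Longrightarrow> f i \<in> polys_in S) \<Longrightarrow> sum f A \<in> polys_in S"
  by (induction A rule: infinite_finite_induct) (auto intro: polys_in_add)

lemma polys_in_mono: "S \<subseteq> T \<Longrightarrow> p \<in> polys_in S \<Longrightarrow> p \<in> polys_in T"
  by (auto simp: polys_in_def)

lemmas polys_in_intros = polys_in_add polys_in_mult polys_in_uminus polys_in_diff polys_in_power
  polys_in_sum

lemma polys_in_prod: "(\<And>i. i \<in> A \<Longrightarrow> f i \<in> polys_in S) \<Longrightarrow> prod f A \<in> polys_in S"
  by (induction A rule: infinite_finite_induct) (auto intro: polys_in_mult)

lemma msubst_polys_in:
  assumes "p \<in> polys_in S" "\<And>v. v \<in> S \<Longrightarrow> \<phi> v \<in> polys_in T"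
  shows "msubst \<phi> p \<in> polys_in T"
  unfolding msubst_def using assms
  by (intro polys_in_sum polys_in_mult polys_in_prod polys_in_power) (auto simp: polys_in_def[of S])

subsection \<open>Derivatives\<close>

lemma pdiff_single: "pdiff v (single m c) = single (m - single v 1) (of_nat (lookup m v) * c)"
  by (simp add: pdiff_def)

lemma pdiff_add [simp]: "pdiff v (p + q) = pdiff v p + pdiff v q"
  unfolding pdiff_def by (rule sum_keys_add) (simp_all add: single_add ring_distribs)

lemma pdiff_mult [simp]: "pdiff v (p * q) = pdiff v p * q + p * pdiff v q"
proof (induction p rule: single_induct)
  case (single m c)
  show ?case
  proof (induction q rule: single_induct)
    case (single n d)
    have *: "single (m - single v 1 + n) (of_nat (lookup m v) * c * d)
        = single (m + n - single v 1) (of_nat (lookup m v) * c * d)" for m n :: "'a \<Rightarrow>\<^sub>0 nat" and c d :: complex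
    proof (cases "lookup m v = 0")
      case False
      then have "m - single v 1 + n = m + n - single v 1"
        by (intro poly_mapping_eqI) (auto simp: lookup_add lookup_minus lookup_single when_def)
      then show ?thesis by simp
    qed simp
    show ?case
      using *[of m n c d] *[of n m d c]
      by (simp add: mult_single pdiff_single single_add[symmetric] lookup_add algebra_simps)
  qed (simp add: ring_distribs)
qed (simp add: ring_distribs)

lemma pdiff_Cst [simp]: "pdiff v (Cst c) = 0"
  by (simp add: Cst_def pdiff_single)

lemma pdiff_Vr: "pdiff v (Vr u) = (if u = v then 1 else 0)"
  by (simp add: Vr_def pdiff_single lookup_single when_def)

lemma pdiff_0 [simp]: "pdiff v 0 = 0" and pdiff_1 [simp]: "pdiff v 1 = 0"
  by (metis Cst_0 pdiff_Cst, metis Cst_1 pdiff_Cst)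

lemma pdiff_uminus [simp]: "pdiff v (- p) = - pdiff v p"
  by (rule minus_unique[symmetric]) (simp flip: pdiff_add)

lemma pdiff_diff [simp]: "pdiff v (p - q) = pdiff v p - pdiff v q"
  by (simp only: diff_conv_add_uminus pdiff_add pdiff_uminus)

lemma pdiff_numeral [simp]: "pdiff v (numeral n) = 0"
  by (metis Cst_numeral pdiff_Cst)

lemma pdiff_of_nat [simp]: "pdiff v (of_nat n) = 0"
  by (metis Cst_of_nat pdiff_Cst)

lemma pdiff_power: "pdiff v (p ^ n) = of_nat n * p ^ (n - 1) * pdiff v p"
proof (induction n)
  case (Suc n)
  then show ?case by (cases n) (simp_all add: algebra_simps)
qed simp

lemma pdiff_polys_in_notin: "p \<in> polys_in S \<Longrightarrow> v \<notin> S \<Longrightarrow> pdiff v p = 0"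
  unfolding pdiff_def
proof (intro sum.neutral ballI)
  fix m assume "p \<in> polys_in S" "v \<notin> S" "m \<in> keys p"
  then have "lookup m v = 0"
    by (force simp: polys_in_def in_keys_iff)
  then show "single (m - single v 1) (of_nat (lookup m v) * lookup p m) = 0"
    by simp
qed

lemma pdiff_polys_in: "p \<in> polys_in S \<Longrightarrow> pdiff v p \<in> polys_in S"
  unfolding pdiff_def
proof (rule polys_in_sum)
  fix m assume *: "p \<in> polys_in S" "m \<in> keys p"
  then have "keys (m - single v 1) \<subseteq> S"
    by (auto simp: polys_in_def in_keys_iff lookup_minus subset_iff)
  then show "single (m - single v 1) (of_nat (lookup m v) * lookup p m) \<in> polys_in S"
    by (simp add: polys_in_def)
qed

text \<open>The chain rule when only \<open>\<phi> w\<close> depends on \<open>u\<close>, so that a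
  single term survives.\<close>

lemma pdiff_msubst:
  assumes "\<And>v. v \<noteq> w \<Longrightarrow> pdiff u (\<phi> v) = 0"
  shows "pdiff u (msubst \<phi> p) = msubst \<phi> (pdiff w p) * pdiff u (\<phi> w)"
  by (induction p rule: mpol_induct) (auto simp: pdiff_Vr assms algebra_simps)

subsection \<open>Coefficients\<close>

lemma lookup_single_mult: "lookup (single m c * p) (m + n) = c * lookup p n"
  for n :: "'a \<Rightarrow>\<^sub>0 nat" and c :: complex
proof (induction p rule: single_induct)
  case (single k d)
  then show ?case by (simp add: mult_single lookup_single when_def)
qed (simp_all add: lookup_add ring_distribs)

lemma lookup_Cst_mult [simp]: "lookup (Cst c * p) n = c * lookup p n"
  using lookup_single_mult[of 0 c p n] by (simp add: Cst_def)

text \<open>Exponents are natural numbers and cannot cancel, so a constant term arises only from two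
  constant terms.\<close>

lemma lookup_mult_0: "lookup (p * q) 0 = lookup p 0 * lookup q 0"
  for p q :: "'v mpol"
proof (induction p rule: single_induct)
  case (single m c)
  show ?case
  proof (induction q rule: single_induct)
    case (single n d)
    have "m + n = 0 \<longleftrightarrow> m = 0 \<and> n = 0"
      by (auto simp: poly_mapping_eq_iff lookup_add fun_eq_iff)
    then show ?case
      by (auto simp: mult_single lookup_single when_def)
  qed (simp_all add: lookup_add ring_distribs)
qed (simp_all add: lookup_add ring_distribs)

lemma lookup_Cst: "lookup (Cst c) m = (c when m = 0)"
  by (auto simp: Cst_def lookup_single when_def)

lemma mon_eval_Vr: "mon_eval Vr m = single m 1"
  by (simp add: mon_eval_def single_1_eq_prod)

text \<open>Sets every variable outside \<open>S\<close> to zero. Large traces are evaluated only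
  after this specialisation, which keeps the coefficients of all monomials in
  \<open>S\<close>.\<close>

definition restr :: "'v set \<Rightarrow> 'v mpol \<Rightarrow> 'v mpol" where
  "restr S = msubst (\<lambda>v. if v \<in> S then Vr v else 0)"

lemma lookup_restr:
  assumes "keys \<mu> \<subseteq> S"
  shows "lookup (restr S p) \<mu> = lookup p \<mu>"
proof (induction p rule: single_induct)
  case (single m c)
  let ?\<phi> = "\<lambda>v. if v \<in> S then Vr v else 0 :: 'a mpol"
  show ?case
  proof (cases "keys m \<subseteq> S")
    case True
    then have "mon_eval ?\<phi> m = mon_eval Vr m"
      unfolding mon_eval_def by (intro prod.cong) auto
    then show ?thesis
      by (simp add: restr_def msubst_single mon_eval_Vr flip: single_eq_Cst_mult)
  next
    case False
    then obtain v where "v \<in> keys m" "v \<notin> S" by auto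
    then have "mon_eval ?\<phi> m = 0"
      unfolding mon_eval_def
      by (intro prod_zero bexI[of _ v]) (auto simp: in_keys_iff zero_power)
    then show ?thesis
      using False assms by (auto simp: restr_def msubst_single lookup_single when_def)
  qed
qed (simp_all add: lookup_add restr_def)

lemma lookup_polys_in: "p \<in> polys_in S \<Longrightarrow> \<not> keys \<mu> \<subseteq> S \<Longrightarrow> lookup p \<mu> = 0"
  by (auto simp: polys_in_def in_keys_iff)

subsection \<open>Homogeneity\<close>

definition wdeg :: "('v \<Rightarrow> rat) \<Rightarrow> ('v \<Rightarrow>\<^sub>0 nat) \<Rightarrow> rat" where
  "wdeg w m = (\<Sum>v\<in>keys m. of_nat (lookup m v) * w v)"

lemma wdeg_superset:
  "finite A \<Longrightarrow> keys m \<subseteq> A \<Longrightarrow> wdeg w m = (\<Sum>v\<in>A. of_nat (lookup m v) * w v)"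
  unfolding wdeg_def by (intro sum.mono_neutral_left) (auto simp: in_keys_iff)

lemma wdeg_add: "wdeg w (m + n) = wdeg w m + wdeg w n"
  using wdeg_superset[of "keys m \<union> keys n" "m + n" w] keys_add[of m n]
    wdeg_superset[of "keys m \<union> keys n" m w] wdeg_superset[of "keys m \<union> keys n" n w]
  by (simp add: lookup_add ring_distribs sum.distrib)

lemma wdeg_single [simp]: "wdeg w (single v n) = of_nat n * w v"
  by (simp add: wdeg_def)

lemma homogeneous_iff: "homogeneous w q p \<longleftrightarrow> (\<forall>m\<in>keys p. wdeg w m = q)"
  by (simp add: homogeneous_def wdeg_def)

lemma homogeneous_0 [simp]: "homogeneous w q 0"
  by (simp add: homogeneous_def)

lemma homogeneous_add:
  "homogeneous w q f \<Longrightarrow> homogeneous w q g \<Longrightarrow> homogeneous w q (f + g)"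
  unfolding homogeneous_iff using keys_add[of f g] by blast

lemma homogeneous_uminus: "homogeneous w q f \<Longrightarrow> homogeneous w q (- f)"
  by (simp add: homogeneous_iff in_keys_iff)

lemma homogeneous_diff:
  "homogeneous w q f \<Longrightarrow> homogeneous w q g \<Longrightarrow> homogeneous w q (f - g)"
  using homogeneous_add[of w q f "- g"] homogeneous_uminus[of w q g] by simp

lemma homogeneous_mult:
  assumes "homogeneous w a f" "homogeneous w b g" "c = a + b"
  shows "homogeneous w c (f * g)"
  unfolding homogeneous_iff
proof
  fix m assume "m \<in> keys (f * g)"
  then obtain k l where "m = k + l" "k \<in> keys f" "l \<in> keys g"
    using keys_mult[of f g] by blast
  then show "wdeg w m = c"
    using assms by (simp add: homogeneous_iff wdeg_add)
qed

lemma homogeneous_Cst: "homogeneous w 0 (Cst c)"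
  by (simp add: homogeneous_iff Cst_def wdeg_def)

lemma homogeneous_1: "homogeneous w 0 1"
  using homogeneous_Cst[of w 1] by simp

lemma homogeneous_Vr: "homogeneous w (w v) (Vr v)"
  by (simp add: homogeneous_iff Vr_def)

lemma homogeneous_power: "homogeneous w a f \<Longrightarrow> b = of_nat n * a \<Longrightarrow> homogeneous w b (f ^ n)"
proof (induction n arbitrary: b)
  case (Suc n)
  then show ?case
    using homogeneous_mult[of w a f "of_nat n * a" "f ^ n"] by (simp add: algebra_simps)
qed (simp add: homogeneous_1)

lemma homogeneous_sum:
  "(\<And>i. i \<in> A \<Longrightarrow> homogeneous w q (f i)) \<Longrightarrow> homogeneous w q (sum f A)"
  by (induction A rule: infinite_finite_induct) (auto intro: homogeneous_add)

lemma homogeneous_pdiff: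
  assumes "homogeneous w a f" "b = a - w v"
  shows "homogeneous w b (pdiff v f)"
  unfolding pdiff_def
proof (rule homogeneous_sum)
  fix m assume m: "m \<in> keys f"
  show "homogeneous w b (single (m - single v 1) (of_nat (lookup m v) * lookup f m))"
  proof (cases "lookup m v = 0")
    case False
    then have "m = (m - single v 1) + single v 1"
      by (intro poly_mapping_eqI) (auto simp: lookup_add lookup_minus lookup_single when_def)
    then have "wdeg w m = wdeg w (m - single v 1) + w v"
      by (metis wdeg_add wdeg_single of_nat_1 mult_1)
    then show ?thesis
      using m assms by (auto simp: homogeneous_iff)
  qed simp
qed

lemma homogeneous_msubst:
  assumes "homogeneous w q p" "\<And>v. homogeneous w' (w v) (\<phi> v)"
  shows "homogeneous w' q (msubst \<phi> p)"
  unfolding msubst_eq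
proof (rule homogeneous_sum)
  fix m assume m: "m \<in> keys p"
  have "homogeneous w' (\<Sum>v\<in>A. of_nat (lookup m v) * w v) (\<Prod>v\<in>A. \<phi> v ^ lookup m v)"
    if "finite A" for A
    using that
    by induction (auto intro!: homogeneous_mult homogeneous_1 homogeneous_power[OF assms(2)])
  then have "homogeneous w' (wdeg w m) (mon_eval \<phi> m)"
    by (simp add: mon_eval_def wdeg_def)
  then show "homogeneous w' q (Cst (lookup p m) * mon_eval \<phi> m)"
    using m assms(1) by (intro homogeneous_mult[OF homogeneous_Cst]) (auto simp: homogeneous_iff)
qed

lemma homogeneous_neg_eq_0:
  assumes "homogeneous w q p" "q < 0" "\<And>m v. m \<in> keys p \<Longrightarrow> v \<in> keys m \<Longrightarrow> w v \<ge> 0"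
  shows "p = 0"
proof -
  have False if "m \<in> keys p" for m
  proof -
    have "wdeg w m \<ge> 0"
      unfolding wdeg_def using assms(3) that by (intro sum_nonneg) auto
    then show False
      using assms(1,2) that by (auto simp: homogeneous_iff)
  qed
  then show ?thesis
    by (metis all_not_in_conv keys_eq_empty)
qed

section \<open>Independence of the two-variable residue from the data that compute it\<close>

section \<open>Grothendieck residues in two variables\<close>

lemma det_two:
  assumes "A \<in> carrier_mat 2 2"
  shows "det A = A $$ (0, 0) * A $$ (1, 1) - A $$ (0, 1) * A $$ (1, 0)"
proof -
  have d: "det (mat_delete A i 0) = mat_delete A i 0 $$ (0, 0)" for i
    using assms by (intro det_single) (simp add: mat_delete_def)
  have "det A = (\<Sum>i<2. A $$ (i, 0) * cofactor A i 0)"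
    using laplace_expansion_column[OF assms, of 0] by simp
  then show ?thesis
    using assms by (simp add: numeral_2_eq_2 cofactor_def d) (simp add: mat_delete_def)
qed

lemma coeff_in_eq: "coeff_in Y \<mu> p = (\<Sum>m\<in>keys p.
    if \<forall>v\<in>Y. lookup m v = lookup \<mu> v then single (m - \<mu>) (lookup p m) else 0)"
  by (simp add: coeff_in_def sum.inter_filter)

lemma coeff_in_add: "coeff_in Y \<mu> (p + q) = coeff_in Y \<mu> p + coeff_in Y \<mu> q"
  unfolding coeff_in_eq by (rule sum_keys_add) (simp_all add: single_add)

lemma coeff_in_single: "coeff_in Y \<mu> (single m c) =
    (if \<forall>v\<in>Y. lookup m v = lookup \<mu> v then single (m - \<mu>) c else 0)"
  unfolding coeff_in_eq keys_single by auto

text \<open>Lets residues with different exponents be compared after both are raised to a common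
  one.\<close>

lemma coeff_in_shift: "coeff_in Y (n + \<mu>) (single n 1 * p) = coeff_in Y \<mu> p"
proof (induction p rule: single_induct)
  case (single m c)
  have "n + m - (n + \<mu>) = m - \<mu>"
    by (intro poly_mapping_eqI) (simp add: lookup_add lookup_minus)
  then show ?case by (simp add: mult_single coeff_in_single lookup_add)
qed (simp add: coeff_in_add ring_distribs)

lemma homogeneous_coeff_in:
  assumes "homogeneous w q p" "b = q - wdeg w \<mu>" "keys \<mu> \<subseteq> Y"
  shows "homogeneous w b (coeff_in Y \<mu> p)"
  unfolding coeff_in_def
proof (rule homogeneous_sum)
  fix m assume m: "m \<in> {m \<in> keys p. \<forall>v\<in>Y. lookup m v = lookup \<mu> v}"
  have "m = (m - \<mu>) + \<mu>"
  proof (rule poly_mapping_eqI)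
    fix v show "lookup m v = lookup (m - \<mu> + \<mu>) v"
      using m not_in_keys_iff_lookup_eq_zero[of v \<mu>] assms(3)
      by (cases "v \<in> Y") (auto simp: lookup_add lookup_minus)
  qed
  then have "wdeg w m = wdeg w (m - \<mu>) + wdeg w \<mu>"
    by (metis wdeg_add)
  then show "homogeneous w b (single (m - \<mu>) (lookup p m))"
    using m assms(1,2) by (auto simp: homogeneous_iff)
qed

text \<open>Turns the constant term of a residue into one coefficient of the full polynomial, the
  quantity tested in all non-vanishing proofs below.\<close>

lemma lookup_coeff_in_0:
  assumes "keys \<mu> \<subseteq> Y"
  shows "lookup (coeff_in Y \<mu> p) 0 = lookup p \<mu>"
proof (induction p rule: single_induct)
  case (single m c)
  show ?case
  proof (cases "m = \<mu>")
    case True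
    then show ?thesis by (simp add: coeff_in_single)
  next
    case False
    have "m - \<mu> \<noteq> 0" if "\<forall>v\<in>Y. lookup m v = lookup \<mu> v"
    proof
      assume "m - \<mu> = 0"
      have "lookup m v = lookup \<mu> v" for v
      proof (cases "v \<in> Y")
        case False
        then have "lookup \<mu> v = 0" using assms by (auto simp: in_keys_iff)
        moreover have "lookup m v - lookup \<mu> v = 0"
          using \<open>m - \<mu> = 0\<close> by (metis lookup_minus lookup_zero)
        ultimately show ?thesis by simp
      qed (use that in simp)
      then show False using False by (auto intro: poly_mapping_eqI)
    qed
    then show ?thesis
      using False by (simp add: coeff_in_single lookup_single when_def)
  qed
qed (simp_all add: coeff_in_add lookup_add)

definition vord_ge :: "'v \<Rightarrow> nat \<Rightarrow> 'v mpol \<Rightarrow> bool" where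
  "vord_ge y N p \<longleftrightarrow> (\<forall>m\<in>keys p. N \<le> lookup m y)"

lemma vord_ge_mult: "vord_ge y N p \<Longrightarrow> vord_ge y N (p * q)"
  unfolding vord_ge_def using keys_mult[of p q] by (force simp: lookup_add)

lemma vord_ge_Vr_power: "vord_ge y N (Vr y ^ N)"
  by (simp add: vord_ge_def Vr_power)

text \<open>Powers of distinct variables are coprime: multiplication by a power of \<open>z\<close>
  leaves the \<open>y\<close>-exponents of \<open>p\<close> unchanged.\<close>

lemma vord_ge_cancel:
  assumes "y \<noteq> z" "Vr z ^ M * p = Vr y ^ N * q"
  shows "vord_ge y N p"
  unfolding vord_ge_def
proof
  fix m assume "m \<in> keys p"
  then have "lookup (Vr z ^ M * p) (single z M + m) \<noteq> 0"
    by (simp add: Vr_power lookup_single_mult in_keys_iff)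
  then have "single z M + m \<in> keys (Vr y ^ N * q)"
    using assms by (simp add: in_keys_iff)
  then have "N \<le> lookup (single z M + m) y"
    using vord_ge_mult[OF vord_ge_Vr_power, of y N q] by (simp add: vord_ge_def)
  then show "N \<le> lookup m y"
    using assms by (simp add: lookup_add lookup_single)
qed

lemma coeff_in_eq_0: "vord_ge y N p \<Longrightarrow> y \<in> Y \<Longrightarrow> lookup \<mu> y < N \<Longrightarrow> coeff_in Y \<mu> p = 0"
  unfolding coeff_in_def vord_ge_def by (intro sum.neutral) force

text \<open>The determinants of two coefficient matrices for the same powers of the variables are compared
  by exchanging one row at a time.\<close>

lemma det_row_exchange:
  fixes f1 f2 :: "'v mpol"
  assumes "y \<noteq> z"
    and "c * f1 + d * f2 = Vr y ^ M" "c' * f1 + d' * f2 = Vr y ^ M" "e * f1 + f * f2 = Vr z ^ N"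
  shows "vord_ge z N ((c - c') * f - (d - d') * e)"
proof -
  let ?u = "c - c'" and ?v = "d - d'"
  have 0: "?u * f1 + ?v * f2 = 0"
    using assms by (simp add: algebra_simps)
  \<comment> \<open>Cramer's rule: (\<open>?u\<close>, \<open>?v\<close>) is a relation between
    \<open>f1\<close> and \<open>f2\<close>, so the determinant times either of them is a multiple
    of z^N. The combination c f1 + d f2 = y^M carries this over to y^M times the determinant, and
    y^M cancels.\<close>
  have 1: "(?u * f - ?v * e) * f1 = f * (?u * f1 + ?v * f2) - ?v * (e * f1 + f * f2)"
    by (simp add: algebra_simps)
  have 2: "(?u * f - ?v * e) * f2 = ?u * (e * f1 + f * f2) - e * (?u * f1 + ?v * f2)"
    by (simp add: algebra_simps)
  have "Vr y ^ M * (?u * f - ?v * e) = c * ((?u * f - ?v * e) * f1) + d * ((?u * f - ?v * e) * f2)"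
    unfolding assms(2)[symmetric] by (simp add: algebra_simps)
  also have "\<dots> = Vr z ^ N * (d * ?u - c * ?v)"
    unfolding 1 2 0 assms(4) by (simp add: algebra_simps)
  finally show ?thesis
    by (rule vord_ge_cancel[OF assms(1)[symmetric]])
qed

text \<open>Multiplying row j by a power of its variable brings both systems to the common exponent
  \<open>N j\<close>. The two determinants then differ by \<open>D1 + D2\<close>, one row exchange
  each, where \<open>D1\<close> is divisible by the power \<open>N 1\<close> of \<open>y 1\<close>
  and \<open>D2\<close> by the power \<open>N 0\<close> of \<open>y 0\<close>. The exponents of
  \<open>\<alpha> + \<beta>\<close> lie just below \<open>N j\<close>, so neither contributes. This
  justifies the definite description in \<open>groth_residue\<close>.\<close>

lemma residue_well_defined:
  fixes y :: "nat \<Rightarrow> 'v" and C C' :: "'v mpol mat"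
  assumes C: "C \<in> carrier_mat 2 2" "\<forall>j<2. Vr (y j) ^ Suc (a j) = (\<Sum>k<2. C $$ (j, k) * f k)"
    and C': "C' \<in> carrier_mat 2 2" "\<forall>j<2. Vr (y j) ^ Suc (b j) = (\<Sum>k<2. C' $$ (j, k) * f k)"
    and "y 0 \<noteq> y 1"
  shows "coeff_in (y ` {..<2}) (\<Sum>j<2. single (y j) (a j)) (det C * g) =
    coeff_in (y ` {..<2}) (\<Sum>j<2. single (y j) (b j)) (det C' * g)"
proof -
  let ?Y = "y ` {..<2}"
  define \<alpha> where "\<alpha> = (\<Sum>j<2. single (y j) (a j))"
  define \<beta> where "\<beta> = (\<Sum>j<2. single (y j) (b j))"
  define N where "N j = Suc (a j + b j)" for j
  have lk: "lookup (\<alpha> + \<beta>) (y j) < N j" if "j < 2" for j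
    using that \<open>y 0 \<noteq> y 1\<close> unfolding \<alpha>_def \<beta>_def N_def
    by (auto simp: numeral_2_eq_2 lookup_add lookup_single when_def less_Suc_eq)
  define c d e h where "c = Vr (y 0) ^ b 0 * C $$ (0, 0)" and "d = Vr (y 0) ^ b 0 * C $$ (0, 1)"
    and "e = Vr (y 1) ^ b 1 * C $$ (1, 0)" and "h = Vr (y 1) ^ b 1 * C $$ (1, 1)"
  define c' d' e' h' where "c' = Vr (y 0) ^ a 0 * C' $$ (0, 0)" and "d' = Vr (y 0) ^ a 0 * C' $$ (0, 1)"
    and "e' = Vr (y 1) ^ a 1 * C' $$ (1, 0)" and "h' = Vr (y 1) ^ a 1 * C' $$ (1, 1)"
  have rel: "Vr (y j) ^ Suc (a j) = C $$ (j, 0) * f 0 + C $$ (j, 1) * f 1"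
    "Vr (y j) ^ Suc (b j) = C' $$ (j, 0) * f 0 + C' $$ (j, 1) * f 1" if "j < 2" for j
    using C(2) C'(2) that by (simp_all add: numeral_2_eq_2)
  have pw: "Vr (y j) ^ b j * Vr (y j) ^ Suc (a j) = Vr (y j) ^ N j"
    "Vr (y j) ^ a j * Vr (y j) ^ Suc (b j) = Vr (y j) ^ N j" for j
    unfolding N_def power_add[symmetric] by (simp_all add: add.commute)
  have rel': "Vr (y j) ^ N j = Vr (y j) ^ b j * (C $$ (j, 0) * f 0 + C $$ (j, 1) * f 1)"
    "Vr (y j) ^ b j * (C $$ (j, 0) * f 0 + C $$ (j, 1) * f 1) =
      Vr (y j) ^ a j * (C' $$ (j, 0) * f 0 + C' $$ (j, 1) * f 1)" if "j < 2" for j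
    using pw[of j] rel[OF that] by simp_all
  have row: "c * f 0 + d * f 1 = Vr (y 0) ^ N 0" "c' * f 0 + d' * f 1 = Vr (y 0) ^ N 0"
    "e * f 0 + h * f 1 = Vr (y 1) ^ N 1" "e' * f 0 + h' * f 1 = Vr (y 1) ^ N 1"
    unfolding c_def d_def e_def h_def c'_def d'_def e'_def h'_def 
    using rel'(2)[of 0] rel'(2)[of 1] by (simp_all add: rel'(1) algebra_simps)
  define D1 where "D1 = (c - c') * h - (d - d') * e"
  define D2 where "D2 = (h - h') * c' - (e - e') * d'"
  have D1: "vord_ge (y 1) (N 1) D1"
    unfolding D1_def by (rule det_row_exchange[OF \<open>y 0 \<noteq> y 1\<close> row(1,2,3)])
  have D2: "vord_ge (y 0) (N 0) D2"
    unfolding D2_def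
    by (rule det_row_exchange[of "y 1" "y 0" h "f 1" e "f 0" "N 1"])
      (use \<open>y 0 \<noteq> y 1\<close> row in \<open>simp_all add: add.commute\<close>)
  have sg: "single \<beta> 1 = Vr (y 0) ^ b 0 * Vr (y 1) ^ b 1" "single \<alpha> 1 = Vr (y 0) ^ a 0 * Vr (y 1) ^ a 1"
    unfolding \<alpha>_def \<beta>_def by (simp_all add: Vr_power_mult numeral_2_eq_2)
  have "single \<beta> 1 * (det C * g) = single \<alpha> 1 * (det C' * g) + D1 * g + D2 * g"
    unfolding sg det_two[OF C(1)] det_two[OF C'(1)] D1_def D2_def c_def d_def e_def h_def
      c'_def d'_def e'_def h'_def
    by (simp add: algebra_simps)
  moreover have "coeff_in ?Y (\<alpha> + \<beta>) (D1 * g) = 0" "coeff_in ?Y (\<alpha> + \<beta>) (D2 * g) = 0"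
    using coeff_in_eq_0[OF vord_ge_mult[OF D1] _ lk] coeff_in_eq_0[OF vord_ge_mult[OF D2] _ lk] by auto
  ultimately have "coeff_in ?Y (\<alpha> + \<beta>) (single \<beta> 1 * (det C * g)) =
      coeff_in ?Y (\<alpha> + \<beta>) (single \<alpha> 1 * (det C' * g))"
    by (simp add: coeff_in_add)
  then show ?thesis
    unfolding \<alpha>_def[symmetric] \<beta>_def[symmetric]
    using coeff_in_shift[of ?Y \<beta> \<alpha> "det C * g"] coeff_in_shift[of ?Y \<alpha> \<beta> "det C' * g"]
    by (simp add: add.commute)
qed

lemma groth_residue_eq:
  assumes "C \<in> carrier_mat 2 2" "\<forall>j<2. Vr (y j) ^ Suc (a j) = (\<Sum>k<2. C $$ (j, k) * f k)"
    and "y 0 \<noteq> y 1"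
  shows "groth_residue 2 y f g =
    coeff_in (y ` {..<2}) (\<Sum>j<2. single (y j) (a j)) (det C * g)"
  unfolding groth_residue_def
proof (rule the_equality)
  fix r
  assume "\<exists>a C. C \<in> carrier_mat 2 2 \<and> (\<forall>j<2. Vr (y j) ^ Suc (a j) = (\<Sum>k<2. C $$ (j, k) * f k)) \<and>
    r = coeff_in (y ` {..<2}) (\<Sum>j<2. single (y j) (a j)) (det C * g)"
  then obtain b C' where "C' \<in> carrier_mat 2 2"
    "\<forall>j<2. Vr (y j) ^ Suc (b j) = (\<Sum>k<2. C' $$ (j, k) * f k)"
    "r = coeff_in (y ` {..<2}) (\<Sum>j<2. single (y j) (b j)) (det C' * g)"
    by blast
  then show "r = coeff_in (y ` {..<2}) (\<Sum>j<2. single (y j) (a j)) (det C * g)"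
    using residue_well_defined[OF _ _ assms] by simp
qed (use assms in blast)

section \<open>Certificates for residues and for finite-dimensional Jacobi rings\<close>

section \<open>Jacobi ideals of two-variable potentials\<close>

lemma lookup_power_0: "lookup (p ^ n) 0 = lookup p 0 ^ n" for p :: "'v mpol"
  by (induction n) (simp_all add: lookup_mult_0)

lemma lookup_Vr_0 [simp]: "lookup (Vr v) 0 = 0"
proof -
  have "single v (1::nat) \<noteq> 0"
    by (metis lookup_single_eq lookup_zero one_neq_zero)
  then show ?thesis
    by (simp add: Vr_def lookup_single when_def)
qed

lemma jacobi_ideal_add:
  assumes "f \<in> jacobi_ideal S F" "g \<in> jacobi_ideal S F"
  shows "f + g \<in> jacobi_ideal S F"
proof -
  obtain h k where "\<forall>v\<in>S. h v \<in> polys_in S" "f = (\<Sum>v\<in>S. h v * pdiff v F)"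
    "\<forall>v\<in>S. k v \<in> polys_in S" "g = (\<Sum>v\<in>S. k v * pdiff v F)"
    using assms by (auto simp: jacobi_ideal_def)
  then show ?thesis
    unfolding jacobi_ideal_def
    by (intro CollectI exI[of _ "\<lambda>v. h v + k v"])
      (auto simp: ring_distribs sum.distrib intro: polys_in_add)
qed

lemma jacobi_ideal_mult:
  assumes "f \<in> jacobi_ideal S F" "r \<in> polys_in S"
  shows "r * f \<in> jacobi_ideal S F"
proof -
  obtain h where "\<forall>v\<in>S. h v \<in> polys_in S" "f = (\<Sum>v\<in>S. h v * pdiff v F)"
    using assms by (auto simp: jacobi_ideal_def)
  then show ?thesis
    unfolding jacobi_ideal_def using assms
    by (intro CollectI exI[of _ "\<lambda>v. r * h v"])
      (auto simp: sum_distrib_left mult.assoc intro: polys_in_mult)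
qed

lemma jacobi_ideal_0: "0 \<in> jacobi_ideal S F"
  unfolding jacobi_ideal_def by (intro CollectI exI[of _ "\<lambda>v. 0"]) simp

lemma lookup_jacobi_ideal:
  assumes "f \<in> jacobi_ideal S F" "\<And>v. v \<in> S \<Longrightarrow> lookup (pdiff v F) 0 = 0"
  shows "lookup f 0 = 0"
  using assms by (auto simp: jacobi_ideal_def lookup_sum lookup_mult_0)

text \<open>\<open>\<Delta>\<close> is the determinant of a matrix expressing x^(a+1) and y^(b+1)
  through the partial derivatives. With variable degrees w0 and w1 its degree is (a+1) w0 + (b+1) w1
  minus the degrees 2 - w0 and 2 - w1 of these derivatives, which is the formula in the last
  line.\<close>

definition residue_data :: "graded_poly \<Rightarrow> nat \<Rightarrow> nat \<Rightarrow> nat mpol \<Rightarrow> bool" where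
  "residue_data W a b \<Delta> \<longleftrightarrow> (\<exists>c d e h. {c, d, e, h} \<subseteq> polys_in {..<2} \<and> \<Delta> = c * h - d * e \<and>
     Vr 0 ^ Suc a = c * pdiff 0 (pot W) + d * pdiff 1 (pot W) \<and>
     Vr 1 ^ Suc b = e * pdiff 0 (pot W) + h * pdiff 1 (pot W)) \<and>
     homogeneous (vdeg W)
       ((of_nat a + 2) * vdeg W 0 + (of_nat b + 2) * vdeg W 1 - 4) \<Delta>"

lemma residue_dataE:
  assumes "residue_data W a b \<Delta>"
  obtains c d e h where "c \<in> polys_in {..<2}" "d \<in> polys_in {..<2}" "e \<in> polys_in {..<2}"
    "h \<in> polys_in {..<2}" "\<Delta> = c * h - d * e"
    "Vr 0 ^ Suc a = c * pdiff 0 (pot W) + d * pdiff 1 (pot W)"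
    "Vr 1 ^ Suc b = e * pdiff 0 (pot W) + h * pdiff 1 (pot W)"
  using assms unfolding residue_data_def by auto

lemma jacobi_ideal_two:
  "c \<in> polys_in {..<2} \<Longrightarrow> d \<in> polys_in {..<2} \<Longrightarrow>
    c * pdiff 0 F + d * pdiff 1 F \<in> jacobi_ideal {..<2} F" for F :: "nat mpol"
  unfolding jacobi_ideal_def
  by (intro CollectI exI[of _ "\<lambda>v. if v = 0 then c else d"]) (auto simp: numeral_2_eq_2)

text \<open>Since x^(a+1) and y^(b+1) lie in the Jacobi ideal, the monomials with exponents at most
  a and b span the quotient.\<close>

lemma residue_data_jacobi_finite_dim:
  assumes "residue_data W a b \<Delta>"
  shows "jacobi_finite_dim {..<2} (pot W)"
proof -
  let ?J = "jacobi_ideal {..<2} (pot W)"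
  have J: "Vr 0 ^ Suc a \<in> ?J" "Vr 1 ^ Suc b \<in> ?J"
    using assms by (auto elim!: residue_dataE simp del: power_Suc One_nat_def intro: jacobi_ideal_two)
  define B where "B = (\<lambda>(i, j). Vr 0 ^ i * Vr 1 ^ j :: nat mpol) ` ({..a} \<times> {..b})"
  define Q where "Q f \<longleftrightarrow> (\<exists>c. f - (\<Sum>b\<in>B. Cst (c b) * b) \<in> ?J)" for f
  have "finite B" by (simp add: B_def)
  have Q_add: "Q (f + g)" if Q: "Q f" "Q g" for f g
  proof -
    obtain c where c: "f - (\<Sum>b\<in>B. Cst (c b) * b) \<in> ?J"
      using Q(1) unfolding Q_def by (rule exE)
    obtain d where d: "g - (\<Sum>b\<in>B. Cst (d b) * b) \<in> ?J"
      using Q(2) unfolding Q_def by (rule exE)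
    have "(f - (\<Sum>b\<in>B. Cst (c b) * b)) + (g - (\<Sum>b\<in>B. Cst (d b) * b)) \<in> ?J"
      using c d by (rule jacobi_ideal_add)
    moreover have "(f - (\<Sum>b\<in>B. Cst (c b) * b)) + (g - (\<Sum>b\<in>B. Cst (d b) * b)) =
        f + g - (\<Sum>b\<in>B. Cst (c b + d b) * b)"
      by (simp add: Cst_add ring_distribs sum.distrib)
    ultimately have "f + g - (\<Sum>b\<in>B. Cst (c b + d b) * b) \<in> ?J" by simp
    then show ?thesis
      unfolding Q_def by (intro exI[of _ "\<lambda>b. c b + d b"])
  qed
  have Q_single: "Q (single m t)" if "keys m \<subseteq> {..<2}" for m t
  proof -
    let ?i = "lookup m 0" and ?j = "lookup m 1"
    have "m = mono2 ?i ?j"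
    proof (rule poly_mapping_eqI)
      fix v :: nat
      consider "v = 0" | "v = 1" | "v \<ge> 2" by linarith
      then show "lookup m v = lookup (mono2 ?i ?j) v"
        using that by cases
          (auto simp: mono2_def lookup_add lookup_single when_def in_keys_iff subset_iff)
    qed
    then have m: "single m t = Cst t * (Vr 0 ^ ?i * Vr 1 ^ ?j)"
      by (metis mono2_def Vr_power_mult single_eq_Cst_mult)
    consider "?i \<le> a" "?j \<le> b" | "?i > a" | "?j > b" by linarith
    then show ?thesis
    proof cases
      case 1
      then have "Vr 0 ^ ?i * Vr 1 ^ ?j \<in> B" by (auto simp: B_def)
      then have "(\<Sum>b\<in>B. Cst (if b = Vr 0 ^ ?i * Vr 1 ^ ?j then t else 0) * b) = single m t"
        using \<open>finite B\<close> by (simp add: m if_distrib[of Cst] if_distrib[of "\<lambda>x. x * _"] cong: if_cong)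
      then show ?thesis
        unfolding Q_def
        by (intro exI[of _ "\<lambda>b. if b = Vr 0 ^ ?i * Vr 1 ^ ?j then t else 0"]) (simp add: jacobi_ideal_0)
    next
      case 2
      then have "single m t = Cst t * Vr 0 ^ (?i - Suc a) * Vr 1 ^ ?j * Vr 0 ^ Suc a"
        using power_add[of "Vr 0 :: nat mpol" "?i - Suc a" "Suc a"]
        by (simp add: m algebra_simps del: power_Suc)
      also have "\<dots> \<in> ?J"
        by (intro jacobi_ideal_mult J) (auto intro!: polys_in_intros simp: polys_in_Vr)
      finally show ?thesis
        unfolding Q_def by (intro exI[of _ "\<lambda>b. 0"]) simp
    next
      case 3
      then have "single m t = Cst t * Vr 0 ^ ?i * Vr 1 ^ (?j - Suc b) * Vr 1 ^ Suc b"
        using power_add[of "Vr 1 :: nat mpol" "?j - Suc b" "Suc b"]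
        by (simp add: m algebra_simps del: power_Suc)
      also have "\<dots> \<in> ?J"
        by (intro jacobi_ideal_mult J) (auto intro!: polys_in_intros simp: polys_in_Vr)
      finally show ?thesis
        unfolding Q_def by (intro exI[of _ "\<lambda>b. 0"]) simp
    qed
  qed
  have "Q f" if "f \<in> polys_in {..<2}" for f
  proof -
    have "Q (\<Sum>m\<in>A. single m (lookup f m))" if "finite A" "A \<subseteq> keys f" for A
      using that
    proof induction
      case empty
      then show ?case using Q_single[of 0 0] by simp
    next
      case (insert m A)
      then show ?case
        using \<open>f \<in> polys_in {..<2}\<close> by (auto simp: polys_in_def intro!: Q_add Q_single)
    qed
    then show ?thesis
      using poly_mapping_eq_sum_single[of f] by (metis finite_keys order_refl)
  qed
  moreover have "B \<subseteq> polys_in {..<2}"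
    by (auto simp: B_def polys_in_Vr intro!: polys_in_intros)
  ultimately show ?thesis
    unfolding jacobi_finite_dim_def Q_def using \<open>finite B\<close> by blast
qed

section \<open>The simple singularities\<close>

definition two_var_potential :: "graded_poly \<Rightarrow> bool" where
  "two_var_potential W \<longleftrightarrow> nvars W = 2 \<and> potential W \<and> (\<exists>a b \<Delta>. residue_data W a b \<Delta>)"

lemma two_varsI:
  assumes "F \<in> polys_in {..<2}" "s > 0" "t > 0" "homogeneous (\<lambda>i. if i = 0 then s else t) 2 F"
    "lookup (pdiff 0 F) 0 = 0" "lookup (pdiff 1 F) 0 = 0" "residue_data (two_vars s t F) a b \<Delta>"
  shows "two_var_potential (two_vars s t F)"
  unfolding two_var_potential_def potential_def
  using assms residue_data_jacobi_finite_dim[OF assms(7)]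
  by (auto simp: two_vars_def less_2_cases_iff)

lemma Cst_inverse_mult: "c \<noteq> 0 \<Longrightarrow> Cst (1 / c) * Cst c = 1"
  by (metis Cst_1 Cst_mult nonzero_eq_divide_eq)

text \<open>The Brieskorn-Pham form covers all of type A as well as E6 and E8; only D and E7 need
  separate treatment.\<close>

definition W_Fermat :: "nat \<Rightarrow> nat \<Rightarrow> graded_poly" where
  "W_Fermat a b = two_vars (2 / of_nat a) (2 / of_nat b) (Vr 0 ^ a + Vr 1 ^ b)"

text \<open>Each partial derivative is a multiple of a pure power, so the matrix is diagonal. The
  parameters a - 2 and b - 2 stand for the powers a - 1 and b - 1.\<close>

lemma residue_data_Fermat:
  assumes "a \<ge> 2" "b \<ge> 2"
  shows "residue_data (W_Fermat a b) (a - 2) (b - 2) (Cst (1 / (of_nat a * of_nat b)))"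
proof -
  have inv: "Cst (1 / of_nat n) * of_nat n = 1" if "n \<ge> 2" for n
    using Cst_inverse_mult[of "of_nat n"] that by simp
  have [simp]: "Suc (n - 2) = n - Suc 0" if "n \<ge> 2" for n
    using that by simp
  have "(of_nat (a - 2) + 2) * (2 / of_nat a) + (of_nat (b - 2) + 2) * (2 / of_nat b) - 4 = (0 :: rat)"
    using assms by (simp add: of_nat_diff)
  moreover have "Cst (1 / (of_nat a * of_nat b)) = Cst (1 / of_nat a) * Cst (1 / of_nat b) - 0 * 0"
    by (simp flip: Cst_mult)
  ultimately show ?thesis
    using assms inv
    unfolding residue_data_def
    by (intro conjI exI[of _ "Cst (1 / of_nat a)"] exI[of _ "Cst (1 / of_nat b)"] exI[of _ 0])
      (auto simp: W_Fermat_def two_vars_def pdiff_power pdiff_Vr homogeneous_Cst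
        simp flip: mult.assoc)
qed

lemma two_var_potential_Fermat:
  assumes "a \<ge> 2" "b \<ge> 2"
  shows "two_var_potential (W_Fermat a b)"
  unfolding W_Fermat_def
proof (rule two_varsI)
  show "homogeneous (\<lambda>i. if i = 0 then 2 / of_nat a else 2 / of_nat b) 2
      (Vr 0 ^ a + Vr 1 ^ b :: nat mpol)"
    using assms by (intro homogeneous_add homogeneous_power[OF homogeneous_Vr]) auto
  show "residue_data (two_vars (2 / of_nat a) (2 / of_nat b) (Vr 0 ^ a + Vr 1 ^ b))
      (a - 2) (b - 2) (Cst (1 / (of_nat a * of_nat b)))"
    using residue_data_Fermat[OF assms] by (simp add: W_Fermat_def)
qed (use assms in \<open>auto simp: pdiff_power pdiff_Vr lookup_mult_0 lookup_power_0 polys_in_Vr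
    intro!: polys_in_intros\<close>)

text \<open>With f0 = k x^(k-1) + y^2 and f1 = 2 x y one has x^k = x f0 / k - y f1 / (2 k) and y^3 =
  y f0 - (k/2) x^(k-2) f1; each time f1 removes the mixed term.\<close>

lemma residue_data_D:
  assumes "k \<ge> 3"
  shows "residue_data (W_D (k + 1)) (k - 1) 2
    (Cst (- 1 / 2) * Vr 0 ^ (k - 1) + Cst (1 / (2 * of_nat k)) * Vr 1 ^ 2)"
proof -
  let ?x = "Vr 0 :: nat mpol" and ?y = "Vr 1 :: nat mpol"
  let ?k = "Cst (of_nat k) :: nat mpol"
  have inv: "Cst (1 / of_nat k) * of_nat k = 1"
    using Cst_inverse_mult[of "of_nat k"] assms by simp
  have inv2: "Cst (- 1 / 2) * 2 = - 1"
    by (simp flip: Cst_mult Cst_numeral Cst_uminus Cst_1)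
  have k: "k = Suc (Suc (k - 2))" "k - 1 = Suc (k - 2)" "k - 2 + 1 = k - 1" using assms by auto
  have f: "pdiff 0 (pot (W_D (k + 1))) = of_nat k * ?x ^ (k - 1) + ?y ^ 2"
    "pdiff 1 (pot (W_D (k + 1))) = 2 * ?x * ?y"
    by (simp_all add: W_D_def two_vars_def pdiff_power pdiff_Vr)
  have deg: "(of_nat (k - 1) + 2) * (2 / of_nat k) + (of_nat 2 + 2) * (1 - 1 / of_nat k) - 4 =
      (of_nat (k - 1) * (2 / of_nat k) :: rat)"
    "(of_nat (k - 1) + 2) * (2 / of_nat k) + (of_nat 2 + 2) * (1 - 1 / of_nat k) - 4 =
      (of_nat 2 * (1 - 1 / of_nat k) :: rat)"
    using assms by (simp_all add: of_nat_diff field_simps)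
  show ?thesis
    unfolding residue_data_def
  proof (intro conjI exI)
    let ?c = "Cst (1 / of_nat k) * ?x" and ?d = "Cst (- 1 / (2 * of_nat k)) * ?y"
      and ?e = "?y" and ?h = "Cst (- of_nat k / 2) * ?x ^ (k - 2)"
    show "{?c, ?d, ?e, ?h} \<subseteq> polys_in {..<2}"
      by (auto intro!: polys_in_intros simp: polys_in_Vr)
    have "Cst (1 / of_nat k) * Cst (- of_nat k / 2) = Cst (- 1 / 2)"
      using assms by (simp flip: Cst_mult)
    moreover have "?x * ?x ^ (k - 2) = ?x ^ (k - 1)"
      by (metis k(2) power_Suc)
    ultimately have ch: "?c * ?h = Cst (- 1 / 2) * ?x ^ (k - 1)"
      by (metis (no_types, opaque_lifting) mult.assoc mult.commute)
    show "Cst (- 1 / 2) * Vr 0 ^ (k - 1) + Cst (1 / (2 * of_nat k)) * Vr 1 ^ 2 = ?c * ?h - ?d * ?e"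
      unfolding ch by (simp add: power2_eq_square Cst_uminus[symmetric] mult.assoc)
        (simp add: Cst_uminus)
    have "Cst (- 1 / (2 * of_nat k)) * 2 = (- Cst (1 / of_nat k) :: nat mpol)"
      by (simp flip: Cst_mult Cst_numeral Cst_uminus)
    then have "?c * (of_nat k * ?x ^ (k - 1) + ?y ^ 2) + ?d * (2 * ?x * ?y) =
        Cst (1 / of_nat k) * of_nat k * (?x * ?x ^ (k - 1))"
      by (simp add: algebra_simps power2_eq_square)
    then show "Vr 0 ^ Suc (k - 1) = ?c * pdiff 0 (pot (W_D (k + 1))) + ?d * pdiff 1 (pot (W_D (k + 1)))"
      unfolding f inv by simp
    have "Cst (- of_nat k / 2) * 2 = - (of_nat k :: nat mpol)"
      by (simp flip: Cst_mult Cst_numeral Cst_uminus Cst_of_nat)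
    moreover have "?h * (2 * ?x * ?y) = (Cst (- of_nat k / 2) * 2) * (?x * ?x ^ (k - 2)) * ?y"
      by (simp only: mult_ac)
    ultimately have "?h * (2 * ?x * ?y) = - of_nat k * (?x * ?x ^ (k - 2)) * ?y"
      by (simp only:)
    then show "Vr 1 ^ Suc 2 = ?e * pdiff 0 (pot (W_D (k + 1))) + ?h * pdiff 1 (pot (W_D (k + 1)))"
      unfolding f \<open>?x * ?x ^ (k - 2) = ?x ^ (k - 1)\<close>
      by (simp add: algebra_simps power2_eq_square numeral_3_eq_3)
    show "homogeneous (vdeg (W_D (k + 1))) ((of_nat (k - 1) + 2) * vdeg (W_D (k + 1)) 0 +
        (of_nat 2 + 2) * vdeg (W_D (k + 1)) 1 - 4)
        (Cst (- 1 / 2) * Vr 0 ^ (k - 1) + Cst (1 / (2 * of_nat k)) * Vr 1 ^ 2)"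
      using deg by (intro homogeneous_add homogeneous_mult[OF homogeneous_Cst
            homogeneous_power[OF homogeneous_Vr refl]]) (simp_all add: W_D_def two_vars_def)
  qed
qed

lemma two_var_potential_D:
  assumes "k \<ge> 3"
  shows "two_var_potential (W_D (k + 1))"
proof -
  have "homogeneous (\<lambda>i. if i = 0 then 2 / of_nat k else 1 - 1 / of_nat k) 2
      (Vr 0 ^ k + Vr 0 * Vr 1 ^ 2 :: nat mpol)"
    using assms by (intro homogeneous_add homogeneous_power[OF homogeneous_Vr]
        homogeneous_mult[OF homogeneous_Vr homogeneous_power[OF homogeneous_Vr refl]]) 
      (auto simp: field_simps)
  moreover have "1 / of_nat k < (1 :: rat)"
    using assms by simp
  ultimately show ?thesis
    unfolding W_D_def add_diff_cancel_right'
    using residue_data_D[OF assms] assms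
    by (intro two_varsI) (auto simp: W_D_def pdiff_power pdiff_Vr lookup_mult_0 lookup_power_0 polys_in_Vr
        lookup_add intro!: polys_in_intros)
qed

text \<open>With f0 = 3 x^2 + y^3 and f1 = 3 x y^2 one has x^3 = x f0 / 3 - y f1 / 9 and y^5 = y^2
  f0 - x f1.\<close>

lemma residue_data_E7:
  "residue_data W_E7 2 4 (Cst (- 1 / 3) * Vr 0 ^ 2 + Cst (1 / 9) * Vr 1 ^ 3)"
proof -
  let ?x = "Vr 0 :: nat mpol" and ?y = "Vr 1 :: nat mpol"
  have f: "pdiff 0 (pot W_E7) = 3 * ?x ^ 2 + ?y ^ 3" "pdiff 1 (pot W_E7) = 3 * ?x * ?y ^ 2"
    by (simp_all add: W_E7_def two_vars_def pdiff_power pdiff_Vr)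
  have inv: "Cst (1 / 3) * 3 = 1" "Cst (- 1 / 9) * 3 = - Cst (1 / 3)"
    by (simp_all flip: Cst_mult Cst_numeral Cst_uminus Cst_1)
  show ?thesis
    unfolding residue_data_def
  proof (intro conjI exI)
    let ?c = "Cst (1 / 3) * ?x" and ?d = "Cst (- 1 / 9) * ?y" and ?e = "?y ^ 2" and ?h = "- ?x"
    show "{?c, ?d, ?e, ?h} \<subseteq> polys_in {..<2}"
      by (auto intro!: polys_in_intros simp: polys_in_Vr)
    show "Cst (- 1 / 3) * Vr 0 ^ 2 + Cst (1 / 9) * Vr 1 ^ 3 = ?c * ?h - ?d * ?e"
      by (simp add: power2_eq_square power3_eq_cube mult.assoc Cst_uminus)
    have "?c * (3 * ?x ^ 2 + ?y ^ 3) + ?d * (3 * ?x * ?y ^ 2) = (Cst (1 / 3) * 3) * ?x ^ 3 +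
        (Cst (1 / 3) + Cst (- 1 / 9) * 3) * ?x * ?y ^ 3"
      by (simp add: algebra_simps power2_eq_square power3_eq_cube)
    then show "Vr 0 ^ Suc 2 = ?c * pdiff 0 (pot W_E7) + ?d * pdiff 1 (pot W_E7)"
      unfolding f inv by simp
    show "Vr 1 ^ Suc 4 = ?e * pdiff 0 (pot W_E7) + ?h * pdiff 1 (pot W_E7)"
      unfolding f by (simp add: algebra_simps power2_eq_square power3_eq_cube numeral_eq_Suc)
    show "homogeneous (vdeg W_E7) ((of_nat 2 + 2) * vdeg W_E7 0 +
        (of_nat 4 + 2) * vdeg W_E7 1 - 4) (Cst (- 1 / 3) * Vr 0 ^ 2 + Cst (1 / 9) * Vr 1 ^ 3)"
      by (intro homogeneous_add homogeneous_mult[OF homogeneous_Cst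
            homogeneous_power[OF homogeneous_Vr refl]]) (simp_all add: W_E7_def two_vars_def)
  qed
qed

lemma two_var_potential_E7: "two_var_potential W_E7"
proof -
  have "homogeneous (\<lambda>i. if i = 0 then 2 / 3 else 4 / 9) 2
      (Vr 0 ^ 3 + Vr 0 * Vr 1 ^ 3 :: nat mpol)"
    by (intro homogeneous_add homogeneous_power[OF homogeneous_Vr]
        homogeneous_mult[OF homogeneous_Vr homogeneous_power[OF homogeneous_Vr refl]]) auto
  then show ?thesis
    unfolding W_E7_def
    using residue_data_E7
    by (intro two_varsI) (auto simp: W_E7_def pdiff_power pdiff_Vr lookup_mult_0 lookup_power_0 polys_in_Vr
        lookup_add intro!: polys_in_intros)
qed

lemma W_A_eq_Fermat: "d \<ge> 2 \<Longrightarrow> W_A (d - 1) = W_Fermat d 2"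
  by (simp add: W_A_def W_Fermat_def)

lemma W_E6_eq_Fermat: "W_E6 = W_Fermat 3 4" and W_E8_eq_Fermat: "W_E8 = W_Fermat 3 5"
  by (simp_all add: W_E6_def W_E8_def W_Fermat_def)

lemma ADE_cases [consumes 1, case_names A D E6 E7 E8]:
  assumes "W \<in> ADE"
  obtains (A) d where "d \<ge> 2" "W = W_A (d - 1)" | (D) k where "k \<ge> 3" "W = W_D (k + 1)"
    | (E6) "W = W_E6" | (E7) "W = W_E7" | (E8) "W = W_E8"
  using assms unfolding ADE_def by blast

lemma two_var_potential_ADE:
  assumes "W \<in> ADE"
  shows "two_var_potential W"
  using assms
proof (cases rule: ADE_cases)
  case (A d)
  then show ?thesis by (simp only: W_A_eq_Fermat two_var_potential_Fermat)
next
  case (D k)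
  then show ?thesis by (simp only: two_var_potential_D)
next
  case E6
  then show ?thesis by (simp add: W_E6_eq_Fermat two_var_potential_Fermat)
next
  case E7
  then show ?thesis by (simp only: two_var_potential_E7)
next
  case E8
  then show ?thesis by (simp add: W_E8_eq_Fermat two_var_potential_Fermat)
qed

section \<open>Renaming variables\<close>

lemma rename_hom [simp]:
  "rename f (p + q) = rename f p + rename f q" "rename f (p * q) = rename f p * rename f q"
  "rename f (p - q) = rename f p - rename f q" "rename f (- p) = - rename f p"
  "rename f (p ^ n) = rename f p ^ n" "rename f 0 = 0" "rename f 1 = 1"
  "rename f (Cst c) = Cst c" "rename f (Vr v) = Vr (f v)" "rename f (numeral k) = numeral k"
  by (simp_all add: rename_def)

lemma pdiff_rename:
  assumes "inj f"
  shows "pdiff (f v) (rename f p) = rename f (pdiff v p)"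
  unfolding rename_def
  using assms by (subst pdiff_msubst[where w = v]) (auto simp: pdiff_Vr inj_eq)

lemma rename_polys_in: "p \<in> polys_in S \<Longrightarrow> rename f p \<in> polys_in (f ` S)"
  unfolding rename_def by (erule msubst_polys_in) (simp add: polys_in_Vr)

lemma homogeneous_rename: "homogeneous (\<lambda>v. w (f v)) q p \<Longrightarrow> homogeneous w q (rename f p)"
  unfolding rename_def by (erule homogeneous_msubst) (rule homogeneous_Vr)

definition res_mon :: "(nat \<Rightarrow> 'v) \<Rightarrow> nat \<Rightarrow> nat \<Rightarrow> 'v \<Rightarrow>\<^sub>0 nat" where
  "res_mon f a b = single (f 0) a + single (f 1) b"

lemma groth_residue_rename:
  assumes "residue_data W a b \<Delta>" "inj f"
  shows "groth_residue 2 f (\<lambda>i. pdiff (f i) (rename f (pot W))) g =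
    coeff_in (f ` {..<2}) (res_mon f a b) (rename f \<Delta> * g)"
proof -
  obtain c d e h where *: "\<Delta> = c * h - d * e"
    "Vr 0 ^ Suc a = c * pdiff 0 (pot W) + d * pdiff 1 (pot W)"
    "Vr 1 ^ Suc b = e * pdiff 0 (pot W) + h * pdiff 1 (pot W)"
    using assms(1) by (rule residue_dataE)
  define C where "C = mat 2 2 (\<lambda>(i, j). rename f (if i = 0 then if j = 0 then c else d
    else if j = (0::nat) then e else h))"
  have C: "C \<in> carrier_mat 2 2" by (simp add: C_def)
  have r: "Vr (f 0) ^ Suc a = rename f (Vr 0 ^ Suc a)" "Vr (f 1) ^ Suc b = rename f (Vr 1 ^ Suc b)"
    by simp_all
  have "Vr (f j) ^ Suc ((if j = 0 then a else b)) =
      (\<Sum>k<2. C $$ (j, k) * pdiff (f k) (rename f (pot W)))" if "j < 2" for j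
  proof -
    have "j = 0 \<or> j = 1" using that by auto
    then show ?thesis
      using r unfolding * pdiff_rename[OF assms(2)]
      by (auto simp: C_def numeral_2_eq_2 simp del: power_Suc)
  qed
  then have "groth_residue 2 f (\<lambda>i. pdiff (f i) (rename f (pot W))) g =
      coeff_in (f ` {..<2}) (\<Sum>j<2. single (f j) (if j = 0 then a else b)) (det C * g)"
    using assms(2) by (intro groth_residue_eq[OF C]) (auto simp: inj_eq)
  moreover have "det C = rename f \<Delta>"
    unfolding det_two[OF C] * by (simp add: C_def)
  ultimately show ?thesis
    by (simp add: res_mon_def numeral_2_eq_2)
qed

section \<open>The obstruction: equivalent potentials have equal sums of variable degrees\<close>

section \<open>Quantum dimensions have degree zero\<close>

definition vars4 :: "(nat + nat) set" where
  "vars4 = {Inl 0, Inl 1, Inr 0, Inr 1}"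

lemma x_vars_two: "nvars V = 2 \<Longrightarrow> x_vars V = [Inl 0, Inl 1]"
  and y_vars_two: "nvars V = 2 \<Longrightarrow> y_vars V = [Inr 0, Inr 1]"
  by (simp_all add: x_vars_def y_vars_def numeral_2_eq_2)

abbreviation wt :: "graded_poly \<Rightarrow> graded_poly \<Rightarrow> nat + nat \<Rightarrow> rat" where
  "wt V W \<equiv> case_sum (vdeg V) (vdeg W)"

lemma potential_vdeg_pos: "potential V \<Longrightarrow> nvars V = 2 \<Longrightarrow> vdeg V 0 > 0 \<and> vdeg V 1 > 0"
  by (simp add: potential_def)

text \<open>Endomorphisms of degree \<open>a\<close> of a free module with basis degrees
  \<open>\<delta>\<close>. A factorization \<open>d\<close> has degree 1, and differentiation by
  \<open>v\<close> lowers the degree by \<open>w v\<close>.\<close>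

definition hom_mat :: "(nat + nat \<Rightarrow> rat) \<Rightarrow> nat \<Rightarrow> (nat \<Rightarrow> rat) \<Rightarrow> rat \<Rightarrow> (nat + nat) mpol mat \<Rightarrow> bool" where
  "hom_mat w n \<delta> a A \<longleftrightarrow> A \<in> carrier_mat n n \<and>
     (\<forall>i<n. \<forall>j<n. A $$ (i, j) \<in> polys_in vars4 \<and> homogeneous w (\<delta> j - \<delta> i + a) (A $$ (i, j)))"

lemma hom_mat_mult:
  assumes "hom_mat w n \<delta> a A" "hom_mat w n \<delta> b B" "c = a + b"
  shows "hom_mat w n \<delta> c (A * B)"
proof -
  have "A * B \<in> carrier_mat n n"
    using assms unfolding hom_mat_def by auto
  moreover have "(A * B) $$ (i, j) = (\<Sum>k<n. A $$ (i, k) * B $$ (k, j))" if "i < n" "j < n" for i j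
    using assms that unfolding hom_mat_def
    by (auto simp: scalar_prod_def lessThan_atLeast0 intro!: sum.cong)
  moreover have "homogeneous w (\<delta> j - \<delta> i + c) (A $$ (i, k) * B $$ (k, j))"
    if "i < n" "j < n" "k < n" for i j k
    using assms that unfolding hom_mat_def
    by (intro homogeneous_mult[of w "\<delta> k - \<delta> i + a" _ "\<delta> j - \<delta> k + b"]) auto
  ultimately show ?thesis
    using assms unfolding hom_mat_def
    by (auto intro!: homogeneous_sum polys_in_intros)
qed

lemma hom_mat_one: "hom_mat w n \<delta> 0 (1\<^sub>m n)"
  by (auto simp: hom_mat_def homogeneous_1)

lemma hom_mat_pdiff:
  assumes "hom_mat w n \<delta> a A" "b = a - w v"
  shows "hom_mat w n \<delta> b (map_mat (pdiff v) A)"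
proof -
  have "homogeneous w (\<delta> j - \<delta> i + b) (pdiff v (A $$ (i, j)))" if "i < n" "j < n" for i j
    using assms that by (intro homogeneous_pdiff[of w "\<delta> j - \<delta> i + a"]) (auto simp: hom_mat_def)
  then show ?thesis
    using assms by (auto simp: hom_mat_def intro!: pdiff_polys_in)
qed

text \<open>Four factors of degree 1, each lowered by the degree of one variable; on the diagonal
  the basis degrees cancel.\<close>

lemma str_derivs_homogeneous:
  assumes "graded_mf V W p q \<delta> d" "nvars V = 2" "nvars W = 2"
  shows "str_derivs V W p q d \<in> polys_in vars4"
    and "homogeneous (wt V W) (4 - (vdeg V 0 + vdeg V 1) - (vdeg W 0 + vdeg W 1)) (str_derivs V W p q d)"
proof -
  let ?w = "wt V W" and ?n = "p + q"
  have d: "hom_mat ?w ?n \<delta> 1 d"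
    using assms unfolding graded_mf_def hom_mat_def
    by (auto simp: x_vars_two y_vars_two vars4_def insert_commute algebra_simps)
  define M where "M = foldr (\<lambda>v M. map_mat (pdiff v) d * M) (x_vars V @ y_vars W) (1\<^sub>m ?n)"
  have "hom_mat ?w ?n \<delta> (4 - (vdeg V 0 + vdeg V 1) - (vdeg W 0 + vdeg W 1)) M"
    unfolding M_def x_vars_two[OF assms(2)] y_vars_two[OF assms(3)] append.simps foldr.simps comp_apply id_apply
    by (rule hom_mat_mult[OF hom_mat_pdiff[OF d refl] hom_mat_mult[OF hom_mat_pdiff[OF d refl]
        hom_mat_mult[OF hom_mat_pdiff[OF d refl] hom_mat_mult[OF hom_mat_pdiff[OF d refl] hom_mat_one refl]
        refl] refl]]) simp
  moreover from this have "homogeneous ?w (4 - (vdeg V 0 + vdeg V 1) - (vdeg W 0 + vdeg W 1)) (M $$ (i, i))"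
    if "i < ?n" for i
    unfolding hom_mat_def using that by (metis add_0 diff_self)
  ultimately show "str_derivs V W p q d \<in> polys_in vars4"
    and "homogeneous ?w (4 - (vdeg V 0 + vdeg V 1) - (vdeg W 0 + vdeg W 1)) (str_derivs V W p q d)"
    unfolding str_derivs_def supertrace_def M_def[symmetric] hom_mat_def
    by (auto intro!: polys_in_intros homogeneous_diff homogeneous_sum)
qed

lemma wdeg_res_mon: "wdeg w (res_mon f a b) = of_nat a * w (f 0) + of_nat b * w (f 1)"
  by (simp add: res_mon_def wdeg_add)

lemma keys_res_mon: "keys (res_mon f a b) \<subseteq> f ` {..<2}"
  unfolding res_mon_def using keys_add[of "single (f 0) a" "single (f 1) b"]
  by (auto split: if_splits simp: numeral_2_eq_2)

lemma coeff_in_polys_in: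
  assumes "p \<in> polys_in S"
  shows "coeff_in Y \<mu> p \<in> polys_in S"
  unfolding coeff_in_def
proof (rule polys_in_sum)
  fix m assume "m \<in> {m \<in> keys p. \<forall>v\<in>Y. lookup m v = lookup \<mu> v}"
  then have "keys (m - \<mu>) \<subseteq> S"
    using assms by (force simp: polys_in_def in_keys_iff lookup_minus)
  then show "single (m - \<mu>) (lookup p m) \<in> polys_in S"
    by (simp add: polys_in_def)
qed

lemma residue_data_\<Delta>_polys_in: "residue_data W a b \<Delta> \<Longrightarrow> \<Delta> \<in> polys_in {..<2}"
  by (auto elim!: residue_dataE intro!: polys_in_intros)

text \<open>The residue has degree s + 2 w0 + 2 w1 - 4, because the exponents a and b cancel between
  \<open>\<Delta>\<close> and the extracted monomial. A non-zero polynomial in positively weighted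
  variables cannot have negative degree.\<close>

lemma residue_eq_0:
  assumes "residue_data W a b \<Delta>" "inj f" "f ` {..<2} \<subseteq> vars4" "\<And>v. v \<in> vars4 \<Longrightarrow> w v > 0"
    and "vdeg W = (\<lambda>i. w (f i))" "g \<in> polys_in vars4" "homogeneous w s g"
    and "s + 2 * vdeg W 0 + 2 * vdeg W 1 < 4"
  shows "groth_residue 2 f (\<lambda>i. pdiff (f i) (rename f (pot W))) g = 0"
  unfolding groth_residue_rename[OF assms(1,2)]
proof (rule homogeneous_neg_eq_0)
  have "homogeneous w ((of_nat a + 2) * vdeg W 0 + (of_nat b + 2) * vdeg W 1 - 4) (rename f \<Delta>)"
    using assms(1,5) by (auto simp: residue_data_def intro!: homogeneous_rename)
  then show "homogeneous w (s + 2 * vdeg W 0 + 2 * vdeg W 1 - 4)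
      (coeff_in (f ` {..<2}) (res_mon f a b) (rename f \<Delta> * g))"
    using assms(5,7)
    by (intro homogeneous_coeff_in[OF homogeneous_mult[OF _ _ refl]])
      (auto simp: wdeg_res_mon keys_res_mon algebra_simps)
  have "rename f \<Delta> \<in> polys_in vars4"
    using rename_polys_in[OF residue_data_\<Delta>_polys_in[OF assms(1)]] assms(3) polys_in_mono by blast
  then have "coeff_in (f ` {..<2}) (res_mon f a b) (rename f \<Delta> * g) \<in> polys_in vars4"
    using assms(6) by (intro coeff_in_polys_in polys_in_mult)
  then show "w v \<ge> 0" if "m \<in> keys (coeff_in (f ` {..<2}) (res_mon f a b) (rename f \<Delta> * g))" "v \<in> keys m" for m v
    using that assms(4)[of v] by (force simp: polys_in_def)
qed (use assms(8) in simp)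

lemma orbifold_equivalent_vdeg:
  assumes "two_var_potential V" "two_var_potential W" "orbifold_equivalent V W"
  shows "vdeg V 0 + vdeg V 1 = vdeg W 0 + vdeg W 1"
proof -
  obtain p q \<delta> d where mf: "graded_mf V W p q \<delta> d"
    and l: "qdim_l V W p q d \<notin> jacobi_ideal (set (x_vars V)) (in_x V)"
    and r: "qdim_r V W p q d \<notin> jacobi_ideal (set (y_vars W)) (in_y W)"
    using assms(3) by (auto simp: orbifold_equivalent_def)
  have n: "nvars V = 2" "nvars W = 2" and pos: "potential V" "potential W"
    using assms by (auto simp: two_var_potential_def)
  obtain a b \<Delta> where V: "residue_data V a b \<Delta>"
    using assms by (auto simp: two_var_potential_def)
  obtain a' b' \<Delta>' where W: "residue_data W a' b' \<Delta>'"
    using assms by (auto simp: two_var_potential_def)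
  have w: "wt V W v > 0" if "v \<in> vars4" for v
    using that potential_vdeg_pos[OF pos(1) n(1)] potential_vdeg_pos[OF pos(2) n(2)]
    by (auto simp: vars4_def)
  note s = str_derivs_homogeneous[OF mf n]
  have "\<not> vdeg W 0 + vdeg W 1 < vdeg V 0 + vdeg V 1"
  proof
    assume "vdeg W 0 + vdeg W 1 < vdeg V 0 + vdeg V 1"
    then have "groth_residue 2 Inr (\<lambda>i. pdiff (Inr i) (rename Inr (pot W))) (str_derivs V W p q d) = 0"
      by (intro residue_eq_0[OF W _ _ w _ s]) (auto simp: vars4_def less_2_cases_iff)
    then have "qdim_l V W p q d = 0"
      by (simp add: qdim_l_def n in_y_def)
    then show False using l jacobi_ideal_0 by metis
  qed
  moreover have "\<not> vdeg V 0 + vdeg V 1 < vdeg W 0 + vdeg W 1"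
  proof
    assume "vdeg V 0 + vdeg V 1 < vdeg W 0 + vdeg W 1"
    then have "groth_residue 2 Inl (\<lambda>i. pdiff (Inl i) (rename Inl (pot V))) (str_derivs V W p q d) = 0"
      by (intro residue_eq_0[OF V _ _ w _ s]) (auto simp: vars4_def less_2_cases_iff)
    then have "qdim_r V W p q d = 0"
      by (simp add: qdim_r_def n in_x_def)
    then show False using r jacobi_ideal_0 by metis
  qed
  ultimately show ?thesis by linarith
qed

section \<open>Block calculus for products and traces\<close>

section \<open>Matrices as functions\<close>

text \<open>As functions on all index pairs, matrices satisfy associativity, block multiplication
  and compatibility with substitution as plain equations, free of carrier conditions. Factorizations
  are converted to \<open>mat\<close> only through \<open>odd_fmat\<close>.\<close>

definition fmul :: "nat \<Rightarrow> (nat \<Rightarrow> nat \<Rightarrow> 'a::comm_ring_1) \<Rightarrow> (nat \<Rightarrow> nat \<Rightarrow> 'a) \<Rightarrow> nat \<Rightarrow> nat \<Rightarrow> 'a" where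
  "fmul n A B i j = (\<Sum>k<n. A i k * B k j)"

definition ftr :: "nat \<Rightarrow> (nat \<Rightarrow> nat \<Rightarrow> 'a::comm_ring_1) \<Rightarrow> 'a" where
  "ftr n A = (\<Sum>i<n. A i i)"

definition blk :: "nat \<Rightarrow> (nat \<Rightarrow> nat \<Rightarrow> 'a) \<Rightarrow> (nat \<Rightarrow> nat \<Rightarrow> 'a) \<Rightarrow> (nat \<Rightarrow> nat \<Rightarrow> 'a) \<Rightarrow>
    (nat \<Rightarrow> nat \<Rightarrow> 'a) \<Rightarrow> nat \<Rightarrow> nat \<Rightarrow> 'a" where
  "blk n A B C D i j = (if i < n then if j < n then A i j else B i (j - n)
     else if j < n then C (i - n) j else D (i - n) (j - n))"

lemma sum_lessThan_add: "(\<Sum>k<m + n. f k) = (\<Sum>k<m. f k) + (\<Sum>k<n. f (m + k))"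
  for f :: "nat \<Rightarrow> 'a::comm_monoid_add"
  by (induction n) (simp_all add: add.assoc)

lemma sum_atLeastLessThan_double: "(\<Sum>k\<in>{n..<n + n}. f k) = (\<Sum>k<n. f (n + k))"
  for f :: "nat \<Rightarrow> 'a::comm_monoid_add"
  using sum.shift_bounds_nat_ivl[of f 0 n n] by (simp add: add.commute lessThan_atLeast0)

lemma blk_simps [simp]:
  "i < n \<Longrightarrow> j < n \<Longrightarrow> blk n A B C D i j = A i j"
  "i < n \<Longrightarrow> blk n A B C D i (n + j) = B i j"
  "j < n \<Longrightarrow> blk n A B C D (n + i) j = C i j"
  "blk n A B C D (n + i) (n + j) = D i j"
  by (simp_all add: blk_def)

lemma fmul_blk: "fmul (n + n) (blk n A B C D) (blk n A' B' C' D') =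
    blk n (\<lambda>i j. fmul n A A' i j + fmul n B C' i j) (\<lambda>i j. fmul n A B' i j + fmul n B D' i j)
      (\<lambda>i j. fmul n C A' i j + fmul n D C' i j) (\<lambda>i j. fmul n C B' i j + fmul n D D' i j)"
  by (intro ext) (simp add: fmul_def sum_lessThan_add, simp add: blk_def)

lemma ftr_blk: "ftr (n + n) (blk n A B C D) = ftr n A + ftr n D"
  by (simp add: ftr_def sum_lessThan_add)

lemma fmul_assoc: "fmul n (fmul n A B) C = fmul n A (fmul n B C)"
proof (intro ext)
  fix i j
  have "fmul n (fmul n A B) C i j = (\<Sum>k<n. \<Sum>l<n. A i l * B l k * C k j)"
    by (simp add: fmul_def sum_distrib_right)
  also have "\<dots> = (\<Sum>l<n. \<Sum>k<n. A i l * B l k * C k j)"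
    by (rule sum.swap)
  also have "\<dots> = fmul n A (fmul n B C) i j"
    by (simp add: fmul_def sum_distrib_left mult.assoc)
  finally show "fmul n (fmul n A B) C i j = fmul n A (fmul n B C) i j" .
qed

lemma ftr_fmul_commute: "ftr n (fmul n A B) = ftr n (fmul n B A)"
  unfolding ftr_def fmul_def by (subst sum.swap) (simp add: mult.commute)

lemma fmul_0 [simp]: "fmul n (\<lambda>i j. 0) A = (\<lambda>i j. 0)" "fmul n A (\<lambda>i j. 0) = (\<lambda>i j. 0)"
  by (simp_all add: fmul_def fun_eq_iff)

lemma fmul_msubst: "fmul n (\<lambda>i j. msubst \<phi> (A i j)) (\<lambda>i j. msubst \<phi> (B i j)) =
    (\<lambda>i j. msubst \<phi> (fmul n A B i j))"
  by (simp add: fmul_def msubst_sum fun_eq_iff)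

lemma ftr_msubst: "ftr n (\<lambda>i j. msubst \<phi> (A i j)) = msubst \<phi> (ftr n A)"
  by (simp add: ftr_def msubst_sum)

lemma fmul_scale: "fmul n (\<lambda>i j. c * A i j) B = (\<lambda>i j. c * fmul n A B i j)"
  "fmul n A (\<lambda>i j. c * B i j) = (\<lambda>i j. c * fmul n A B i j)"
  by (simp_all add: fmul_def sum_distrib_left fun_eq_iff mult_ac)

lemma ftr_scale: "ftr n (\<lambda>i j. c * A i j) = c * ftr n A"
  by (simp add: ftr_def sum_distrib_left)

abbreviation fmat :: "nat \<Rightarrow> (nat \<Rightarrow> nat \<Rightarrow> 'a) \<Rightarrow> 'a mat" where
  "fmat n A \<equiv> mat n n (\<lambda>(i, j). A i j)"

lemma fmat_mult: "fmat n A * fmat n B = fmat n (fmul n A B)"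
  by (rule eq_matI) (auto simp: fmul_def scalar_prod_def lessThan_atLeast0 intro!: sum.cong)

lemma map_fmat: "map_mat f (fmat n A) = fmat n (\<lambda>i j. f (A i j))"
  by (rule eq_matI) auto

section \<open>Matrix factorizations with blocks of equal size\<close>

abbreviation fdiff :: "'v \<Rightarrow> (nat \<Rightarrow> nat \<Rightarrow> 'v mpol) \<Rightarrow> nat \<Rightarrow> nat \<Rightarrow> 'v mpol" where
  "fdiff v A \<equiv> \<lambda>i j. pdiff v (A i j)"

text \<open>For an odd matrix with off-diagonal blocks \<open>P\<close> and \<open>Q\<close>, a
  product of four derivatives has diagonal blocks of the shapes PQPQ and QPQP; the supertrace is the
  difference of their traces.\<close>

definition str4 :: "nat \<Rightarrow> (nat \<Rightarrow> nat \<Rightarrow> (nat + nat) mpol) \<Rightarrow> (nat \<Rightarrow> nat \<Rightarrow> (nat + nat) mpol) \<Rightarrow> (nat + nat) mpol" where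
  "str4 n P Q =
     ftr n (fmul n (fdiff (Inl 0) P) (fmul n (fdiff (Inl 1) Q) (fmul n (fdiff (Inr 0) P) (fdiff (Inr 1) Q)))) -
     ftr n (fmul n (fdiff (Inl 0) Q) (fmul n (fdiff (Inl 1) P) (fmul n (fdiff (Inr 0) Q) (fdiff (Inr 1) P))))"

text \<open>\<open>\<delta>\<close> and \<open>\<epsilon>\<close> are the degrees of the even and
  odd basis elements; \<open>P\<close> maps odd to even, \<open>Q\<close> even to odd.\<close>

definition block_mf :: "graded_poly \<Rightarrow> graded_poly \<Rightarrow> nat \<Rightarrow> (nat \<Rightarrow> rat) \<Rightarrow> (nat \<Rightarrow> rat) \<Rightarrow>
    (nat \<Rightarrow> nat \<Rightarrow> (nat + nat) mpol) \<Rightarrow> (nat \<Rightarrow> nat \<Rightarrow> (nat + nat) mpol) \<Rightarrow> bool" where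
  "block_mf V W n \<delta> \<epsilon> P Q \<longleftrightarrow>
     (\<forall>i<n. \<forall>j<n. P i j \<in> polys_in vars4 \<and> Q i j \<in> polys_in vars4 \<and>
        homogeneous (wt V W) (\<epsilon> j + 1 - \<delta> i) (P i j) \<and> homogeneous (wt V W) (\<delta> j + 1 - \<epsilon> i) (Q i j) \<and>
        fmul n P Q i j = (if i = j then in_y W - in_x V else 0) \<and>
        fmul n Q P i j = (if i = j then in_y W - in_x V else 0))"

definition odd_fmat :: "nat \<Rightarrow> (nat \<Rightarrow> nat \<Rightarrow> 'a::zero) \<Rightarrow> (nat \<Rightarrow> nat \<Rightarrow> 'a) \<Rightarrow> 'a mat" where
  "odd_fmat n P Q = fmat (n + n) (blk n (\<lambda>i j. 0) P Q (\<lambda>i j. 0))"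

lemma less_double_cases:
  fixes i n :: nat
  assumes "i < n + n"
  obtains "i < n" | k where "i = n + k" "k < n"
  using assms by (metis add_less_cancel_left le_Suc_ex not_le_imp_less)

lemma block_mf_graded_mf:
  assumes "block_mf V W n \<delta> \<epsilon> P Q" "nvars V = 2" "nvars W = 2"
  shows "graded_mf V W n n (\<lambda>i. if i < n then \<delta> i else \<epsilon> (i - n)) (odd_fmat n P Q)"
proof -
  have S: "set (x_vars V) \<union> set (y_vars W) = vars4"
    using assms by (auto simp: x_vars_two y_vars_two vars4_def)
  have "odd_fmat n P Q * odd_fmat n P Q = (in_y W - in_x V) \<cdot>\<^sub>m 1\<^sub>m (n + n)"
    unfolding odd_fmat_def fmat_mult fmul_blk
    using assms(1) unfolding block_mf_def
    by (intro eq_matI) (auto elim!: less_double_cases)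
  then show ?thesis
    using assms(1) unfolding graded_mf_def S block_mf_def
    by (auto simp: odd_fmat_def elim!: less_double_cases)
qed

lemma str_derivs_odd_fmat:
  assumes "nvars V = 2" "nvars W = 2"
  shows "str_derivs V W n n (odd_fmat n P Q) = str4 n P Q"
proof -
  have map: "map_mat (pdiff v) (odd_fmat n P Q) = fmat (n + n) (blk n (\<lambda>i j. 0) (fdiff v P) (fdiff v Q) (\<lambda>i j. 0))" for v
    unfolding odd_fmat_def map_fmat by (intro arg_cong[of _ _ "fmat (n + n)"] ext) (simp add: blk_def)
  have one: "fmat m A * 1\<^sub>m m = fmat m A" for m and A :: "nat \<Rightarrow> nat \<Rightarrow> (nat + nat) mpol"
    by (rule right_mult_one_mat[of _ m m]) simp
  show ?thesis
    unfolding str_derivs_def x_vars_two[OF assms(1)] y_vars_two[OF assms(2)] append.simps foldr.simps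
      comp_apply id_apply map one fmat_mult fmul_blk supertrace_def sum_atLeastLessThan_double
    by (auto simp: str4_def ftr_def intro!: arg_cong2[of _ _ _ _ "(-)"] sum.cong)
qed

text \<open>The two lookups are the constant terms of the quantum dimensions, up to sign; elements of a Jacobi
  ideal have no constant term.\<close>

definition strongly_equivalent :: "graded_poly \<Rightarrow> graded_poly \<Rightarrow> bool" where
  "strongly_equivalent V W \<longleftrightarrow> (\<exists>n \<delta> \<epsilon> P Q a b \<Delta> a' b' \<Delta>'. block_mf V W n \<delta> \<epsilon> P Q \<and>
     residue_data V a b \<Delta> \<and> residue_data W a' b' \<Delta>' \<and>
     lookup (rename Inl \<Delta> * str4 n P Q) (res_mon Inl a b) \<noteq> 0 \<and>
     lookup (rename Inr \<Delta>' * str4 n P Q) (res_mon Inr a' b') \<noteq> 0)"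

lemma lookup_rename_pot_0:
  assumes "potential W" "i < nvars W" "inj f"
  shows "lookup (pdiff (f i) (rename f (pot W))) 0 = 0"
proof -
  have "lookup (rename f p) 0 = lookup p 0" for p
    by (induction p rule: mpol_induct) (simp_all add: lookup_Cst lookup_add lookup_mult_0)
  then show ?thesis
    using assms by (simp add: pdiff_rename potential_def)
qed

lemma notin_jacobi_ideal:
  assumes "lookup q 0 \<noteq> 0" "potential W" "inj f"
  shows "q \<notin> jacobi_ideal (f ` {..<nvars W}) (rename f (pot W))"
proof
  assume "q \<in> jacobi_ideal (f ` {..<nvars W}) (rename f (pot W))"
  then have "lookup q 0 = 0"
    by (rule lookup_jacobi_ideal) (use assms lookup_rename_pot_0 in auto)
  then show False using assms(1) by simp
qed

lemma lookup_neg_one_power: "lookup ((- 1) ^ n * p :: 'v mpol) m = (- 1) ^ n * lookup p m"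
proof -
  have "(- 1 :: 'v mpol) ^ n = Cst ((- 1) ^ n)"
    by (simp add: Cst_power Cst_uminus)
  then show ?thesis by simp
qed

lemma strongly_equivalent_orbifold:
  assumes "two_var_potential V" "two_var_potential W" "strongly_equivalent V W"
  shows "orbifold_equivalent V W"
proof -
  obtain n \<delta> \<epsilon> P Q a b \<Delta> a' b' \<Delta>' where mf: "block_mf V W n \<delta> \<epsilon> P Q"
    and V: "residue_data V a b \<Delta>" and W: "residue_data W a' b' \<Delta>'"
    and r: "lookup (rename Inl \<Delta> * str4 n P Q) (res_mon Inl a b) \<noteq> 0"
    and l: "lookup (rename Inr \<Delta>' * str4 n P Q) (res_mon Inr a' b') \<noteq> 0"
    using assms(3) unfolding strongly_equivalent_def by blast
  have n: "nvars V = 2" "nvars W = 2" and pot: "potential V" "potential W"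
    using assms by (auto simp: two_var_potential_def)
  let ?d = "odd_fmat n P Q"
  have "lookup (qdim_l V W n n ?d) 0 \<noteq> 0"
    unfolding qdim_l_def n in_y_def groth_residue_rename[OF W inj_Inr] str_derivs_odd_fmat[OF n]
      lookup_neg_one_power lookup_coeff_in_0[OF keys_res_mon]
    using l by simp
  then have "qdim_l V W n n ?d \<notin> jacobi_ideal (set (x_vars V)) (in_x V)"
    using notin_jacobi_ideal[OF _ pot(1) inj_Inl] by (simp add: x_vars_def in_x_def atLeast0LessThan)
  moreover have "lookup (qdim_r V W n n ?d) 0 \<noteq> 0"
    unfolding qdim_r_def n in_x_def groth_residue_rename[OF V inj_Inl] str_derivs_odd_fmat[OF n]
      lookup_neg_one_power lookup_coeff_in_0[OF keys_res_mon]
    using r by simp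
  then have "qdim_r V W n n ?d \<notin> jacobi_ideal (set (y_vars W)) (in_y W)"
    using notin_jacobi_ideal[OF _ pot(2) inj_Inr] by (simp add: y_vars_def in_y_def atLeast0LessThan)
  ultimately show ?thesis
    unfolding orbifold_equivalent_def using pot block_mf_graded_mf[OF mf n] by blast
qed

subsection \<open>Symmetry\<close>

definition swap_sum :: "'a + 'b \<Rightarrow> 'b + 'a" where
  "swap_sum = case_sum Inr Inl"

lemma swap_sum_simps [simp]: "swap_sum (Inl a) = Inr a" "swap_sum (Inr b) = Inl b"
  by (simp_all add: swap_sum_def)

lemma inj_swap_sum: "inj swap_sum"
  by (auto simp: inj_def swap_sum_def split: sum.splits)

lemma rename_rename: "rename f (rename g p) = rename (\<lambda>v. f (g v)) p"
  by (simp add: rename_def msubst_msubst)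

definition push_mon :: "('v \<Rightarrow> 'u) \<Rightarrow> ('v \<Rightarrow>\<^sub>0 nat) \<Rightarrow> 'u \<Rightarrow>\<^sub>0 nat" where
  "push_mon f m = (\<Sum>v\<in>keys m. single (f v) (lookup m v))"

lemma push_mon_add: "push_mon f (m + n) = push_mon f m + push_mon f n"
  unfolding push_mon_def by (rule sum_keys_add) (simp_all add: single_add)

lemma push_mon_single [simp]: "push_mon f (single v n) = single (f v) n"
  by (simp add: push_mon_def)

lemma inj_push_mon:
  assumes "inj f" "push_mon f m = push_mon f n"
  shows "m = n"
proof (rule poly_mapping_eqI)
  have "lookup (push_mon f m) (f v) = lookup m v" for m v
    using assms(1) by (simp add: push_mon_def lookup_sum lookup_single when_def inj_eq in_keys_iff)
  then show "lookup m v = lookup n v" for v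
    using assms(2) by metis
qed

lemma rename_single: "rename f (single m c) = single (push_mon f m) c"
proof -
  have "single (\<Sum>v\<in>A. single (f v) (lookup m v)) (1::complex) = (\<Prod>v\<in>A. Vr (f v) ^ lookup m v)"
    if "finite A" for A
    using that
  proof induction
    case (insert a A)
    have "single (\<Sum>v\<in>insert a A. single (f v) (lookup m v)) (1::complex) =
        single (single (f a) (lookup m a)) 1 * single (\<Sum>v\<in>A. single (f v) (lookup m v)) 1"
      using insert.hyps by (simp add: mult_single)
    then show ?case
      using insert by (simp add: Vr_power)
  qed simp
  then have "mon_eval (\<lambda>v. Vr (f v)) m = single (push_mon f m) 1"
    by (simp add: mon_eval_def push_mon_def)
  then show ?thesis
    by (simp add: rename_def msubst_single flip: single_eq_Cst_mult)
qed

lemma lookup_rename: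
  assumes "inj f"
  shows "lookup (rename f p) (push_mon f \<mu>) = lookup p \<mu>"
proof (induction p rule: single_induct)
  case (single m c)
  then show ?case
    using inj_push_mon[OF assms] by (auto simp: rename_single lookup_single when_def)
qed (simp add: lookup_add)

text \<open>Multiplying by the imaginary unit turns a factorization of \<open>W - V\<close> into one of \<open>V - W\<close>.\<close>

lemma strongly_equivalent_sym:
  assumes "strongly_equivalent V W"
  shows "strongly_equivalent W V"
proof -
  obtain n \<delta> \<epsilon> P Q a b \<Delta> a' b' \<Delta>' where mf: "block_mf V W n \<delta> \<epsilon> P Q"
    and V: "residue_data V a b \<Delta>" and W: "residue_data W a' b' \<Delta>'"
    and r: "lookup (rename Inl \<Delta> * str4 n P Q) (res_mon Inl a b) \<noteq> 0"
    and l: "lookup (rename Inr \<Delta>' * str4 n P Q) (res_mon Inr a' b') \<noteq> 0"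
    using assms unfolding strongly_equivalent_def by blast
  let ?s = "rename (swap_sum :: nat + nat \<Rightarrow> nat + nat)"
  define P' Q' where "P' i j = Cst \<i> * ?s (P i j)" and "Q' i j = Cst \<i> * ?s (Q i j)" for i j
  have ii: "Cst \<i> * (Cst \<i> * p) = - p" for p :: "(nat + nat) mpol"
    by (simp flip: mult.assoc Cst_mult) (simp add: Cst_uminus)
  have fm: "fmul n (\<lambda>i j. Cst \<i> * ?s (A i j)) (\<lambda>i j. Cst \<i> * ?s (B i j)) = (\<lambda>i j. - ?s (fmul n A B i j))"
    for A B
    unfolding fmul_scale ii using fmul_msubst[of n "\<lambda>v. Vr (swap_sum v)" A B] by (simp add: rename_def)
  have fm': "fmul n (\<lambda>i j. - ?s (A i j)) (\<lambda>i j. - ?s (B i j)) = (\<lambda>i j. ?s (fmul n A B i j))" for A B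
    using fmul_msubst[of n "\<lambda>v. Vr (swap_sum v)" A B]
      fmul_scale(1)[of n "-1" "\<lambda>i j. ?s (A i j)"] fmul_scale(2)[of n _ "-1" "\<lambda>i j. ?s (B i j)"]
    by (simp add: rename_def)
  have "block_mf W V n \<delta> \<epsilon> P' Q'"
    unfolding block_mf_def
  proof (intro allI impI)
    fix i j assume ij: "i < n" "j < n"
    have s: "swap_sum ` vars4 = vars4" by (auto simp: vars4_def)
    have w: "(\<lambda>v. wt W V (swap_sum v)) = wt V W"
      by (auto simp: fun_eq_iff swap_sum_def split: sum.splits)
    have "?s (in_x V) = in_y V" "?s (in_y W) = in_x W"
      by (simp_all add: in_x_def in_y_def rename_rename)
    moreover have "homogeneous (wt W V) (\<epsilon> j + 1 - \<delta> i) (P' i j)" "homogeneous (wt W V) (\<delta> j + 1 - \<epsilon> i) (Q' i j)"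
      using mf ij homogeneous_rename[of "wt W V" swap_sum, unfolded w]
      unfolding P'_def Q'_def block_mf_def
      by (auto simp del: add_diff_cancel_left' intro!: homogeneous_mult[OF homogeneous_Cst])
    ultimately show "P' i j \<in> polys_in vars4 \<and> Q' i j \<in> polys_in vars4 \<and>
        homogeneous (wt W V) (\<epsilon> j + 1 - \<delta> i) (P' i j) \<and> homogeneous (wt W V) (\<delta> j + 1 - \<epsilon> i) (Q' i j) \<and>
        fmul n P' Q' i j = (if i = j then in_y V - in_x W else 0) \<and>
        fmul n Q' P' i j = (if i = j then in_y V - in_x W else 0)"
      using mf ij rename_polys_in[of _ vars4 swap_sum, unfolded s]
      unfolding P'_def Q'_def fm block_mf_def
      by (auto intro!: polys_in_mult)
  qed
  \<comment> \<open>The imaginary unit enters four times and its fourth power is 1. After renaming,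
    the y-derivatives precede the x-derivatives; the trace is cyclic, and moving a pair of factors
    past a pair keeps \<open>P\<close> and \<open>Q\<close> alternating, so no sign arises.\<close>
  moreover have str: "str4 n P' Q' = ?s (str4 n P Q)"
  proof -
    have d: "fdiff (swap_sum v) P' = (\<lambda>i j. Cst \<i> * ?s (fdiff v P i j))"
      "fdiff (swap_sum v) Q' = (\<lambda>i j. Cst \<i> * ?s (fdiff v Q i j))" for v
      by (simp_all add: P'_def Q'_def pdiff_rename[OF inj_swap_sum] fun_eq_iff)
    have dd: "fdiff (Inl k) P' = (\<lambda>i j. Cst \<i> * ?s (fdiff (Inr k) P i j))"
      "fdiff (Inl k) Q' = (\<lambda>i j. Cst \<i> * ?s (fdiff (Inr k) Q i j))"
      "fdiff (Inr k) P' = (\<lambda>i j. Cst \<i> * ?s (fdiff (Inl k) P i j))"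
      "fdiff (Inr k) Q' = (\<lambda>i j. Cst \<i> * ?s (fdiff (Inl k) Q i j))" for k
      using d[of "Inr k"] d[of "Inl k"] by simp_all
    have four: "fmul n A (fmul n B (fmul n C D)) = fmul n (fmul n A B) (fmul n C D)"
      for A B C D :: "nat \<Rightarrow> nat \<Rightarrow> (nat + nat) mpol"
      by (simp only: fmul_assoc)
    have t: "ftr n (\<lambda>i j. ?s (A i j)) = ?s (ftr n A)" for A
      using ftr_msubst[of n "\<lambda>v. Vr (swap_sum v)" A] by (simp add: rename_def)
    show ?thesis
      unfolding str4_def four unfolding dd fm fm' t
      by (simp only: rename_hom ftr_fmul_commute[of n "fmul n (fdiff (Inr 0) P) (fdiff (Inr 1) Q)"]
          ftr_fmul_commute[of n "fmul n (fdiff (Inr 0) Q) (fdiff (Inr 1) P)"])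
  qed
  have lk: "lookup (?s p) (res_mon Inr a b) = lookup p (res_mon Inl a b)"
    "lookup (?s p) (res_mon Inl a b) = lookup p (res_mon Inr a b)" for p a b
    using lookup_rename[OF inj_swap_sum, of p "res_mon Inl a b"]
      lookup_rename[OF inj_swap_sum, of p "res_mon Inr a b"]
    by (simp_all add: res_mon_def push_mon_add)
  have eq: "rename Inl \<Delta>' * ?s (str4 n P Q) = ?s (rename Inr \<Delta>' * str4 n P Q)"
    "rename Inr \<Delta> * ?s (str4 n P Q) = ?s (rename Inl \<Delta> * str4 n P Q)"
    by (simp_all add: rename_rename)
  have "lookup (rename Inl \<Delta>' * str4 n P' Q') (res_mon Inl a' b') \<noteq> 0"
    "lookup (rename Inr \<Delta> * str4 n P' Q') (res_mon Inr a b) \<noteq> 0"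
    unfolding str eq lk using l r by simp_all
  ultimately show ?thesis
    unfolding strongly_equivalent_def using V W by blast
qed

section \<open>Koszul factorizations and reflexivity\<close>

section \<open>Identity defects\<close>

text \<open>The divided difference (y^n - x^n) / (y - x), that is, the complete homogeneous
  polynomial of degree n - 1.\<close>

fun hs :: "nat \<Rightarrow> 'a::comm_ring_1 \<Rightarrow> 'a \<Rightarrow> 'a" where
  "hs 0 x y = 0"
| "hs (Suc n) x y = x * hs n x y + y ^ n"

lemma hs_mult_diff: "(y - x) * hs n x y = y ^ n - x ^ n"
proof (induction n)
  case (Suc n)
  have "(y - x) * hs (Suc n) x y = x * ((y - x) * hs n x y) + (y - x) * y ^ n"
    by (simp add: algebra_simps)
  then show ?case
    unfolding Suc by (simp add: algebra_simps)
qed simp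

lemma hs_commute: "hs n x y = hs n y x"
proof -
  have r: "hs (Suc n) x y = y * hs n x y + x ^ n" for n
  proof (induction n)
    case (Suc n)
    have "hs (Suc (Suc n)) x y = x * (y * hs n x y + x ^ n) + y ^ Suc n"
      unfolding Suc[symmetric] by simp
    then show ?case by (simp add: algebra_simps)
  qed simp
  show ?thesis
  proof (induction n)
    case (Suc n)
    then show ?case unfolding r by simp
  qed simp
qed

lemma polys_in_hs: "x \<in> polys_in S \<Longrightarrow> y \<in> polys_in S \<Longrightarrow> hs n x y \<in> polys_in S"
  by (induction n) (auto intro!: polys_in_intros)

lemma homogeneous_hs:
  assumes "homogeneous w a x" "homogeneous w a y" "b = (of_nat n - 1) * a"
  shows "homogeneous w b (hs n x y)"
  using assms(3)
proof (induction n arbitrary: b)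
  case (Suc n)
  then show ?case
    using homogeneous_mult[OF assms(1) Suc.IH[OF refl]] homogeneous_power[OF assms(2) refl, of n]
    by (auto intro!: homogeneous_add simp: algebra_simps)
qed simp

lemma restr_hom [simp]:
  "restr S (p + q) = restr S p + restr S q" "restr S (p * q) = restr S p * restr S q"
  "restr S (p - q) = restr S p - restr S q" "restr S (- p) = - restr S p"
  "restr S (p ^ n) = restr S p ^ n" "restr S 0 = 0" "restr S 1 = 1"
  "restr S (Cst c) = Cst c" "restr S (numeral k) = numeral k" "restr S (of_nat m) = of_nat m"
  by (simp_all add: restr_def)

lemma restr_Vr: "restr S (Vr v) = (if v \<in> S then Vr v else 0)"
  by (simp add: restr_def)

lemma restr_hs:
  assumes "u \<notin> S" "v \<in> S"
  shows "restr S (hs (Suc n) (Vr u) (Vr v)) = Vr v ^ n" "restr S (hs (Suc n) (Vr v) (Vr u)) = Vr v ^ n"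
  using assms hs_commute[of "Suc n" "Vr v" "Vr u"] by (simp_all add: restr_Vr)

text \<open>To first order in u the polynomial is v^(n-1) + u v^(n-2); at u = 0 its two derivatives
  are (n - 1) v^(n-2) and v^(n-2).\<close>

lemma restr_diff_hs:
  assumes "u \<notin> S" "v \<in> S" "n \<ge> 2"
  shows "restr S (pdiff u (hs n (Vr u) (Vr v)) + pdiff v (hs n (Vr u) (Vr v))) = of_nat n * Vr v ^ (n - 2)"
proof -
  obtain m where n: "n = Suc (Suc m)"
    using assms(3) by (metis add_2_eq_Suc le_Suc_ex)
  have m: "Vr v * (of_nat m * Vr v ^ (m - Suc 0)) = of_nat m * Vr v ^ m"
    by (cases m) (simp_all add: mult_ac)
  have "u \<noteq> v" using assms by auto
  then show ?thesis
    using assms restr_hs[OF assms(1,2), of m] unfolding n hs.simps(2)[of "Suc m"]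
    by (simp add: pdiff_Vr pdiff_power restr_Vr m algebra_simps del: hs.simps)
qed

lemma lookup_monomial:
  assumes "f 0 \<noteq> f 1"
  shows "lookup (Vr (f 0) ^ i * Vr (f 1) ^ j) (res_mon f a b) = (if i = a \<and> j = b then 1 else 0)"
proof -
  have "res_mon f i j = res_mon f a b \<longleftrightarrow> i = a \<and> j = b"
  proof
    assume "res_mon f i j = res_mon f a b"
    then have "lookup (res_mon f i j) (f k) = lookup (res_mon f a b) (f k)" for k by simp
    from this[of 0] this[of 1] show "i = a \<and> j = b"
      using assms by (simp_all add: res_mon_def lookup_add lookup_single when_def)
  qed simp
  then show ?thesis
    unfolding Vr_power_mult unfolding res_mon_def[symmetric]
    by (simp add: lookup_single when_def)
qed

definition m22 :: "'a \<Rightarrow> 'a \<Rightarrow> 'a \<Rightarrow> 'a \<Rightarrow> nat \<Rightarrow> nat \<Rightarrow> 'a" where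
  "m22 a b c d i j = (if i = 0 then if j = 0 then a else b else if j = 0 then c else d)"

lemma fdiff_m22: "fdiff v (m22 a b c d) = m22 (pdiff v a) (pdiff v b) (pdiff v c) (pdiff v d)"
  by (simp add: m22_def fun_eq_iff)

lemma fmul_m22: "fmul 2 (m22 a b c d) (m22 a' b' c' d') =
    m22 (a * a' + b * c') (a * b' + b * d') (c * a' + d * c') (c * b' + d * d')"
  by (simp add: fmul_def m22_def fun_eq_iff numeral_2_eq_2)

lemma ftr_m22: "ftr 2 (m22 a b c d) = a + d"
  by (simp add: ftr_def m22_def numeral_2_eq_2)

text \<open>The linear forms \<open>b1\<close> and \<open>b2\<close> have constant derivatives,
  which leaves minus the determinant of the derivations d/dx_j + d/dy_j applied to \<open>a1\<close>
  and \<open>a2\<close>. If b1 a1 + b2 a2 = W(y) - W(x), this restricts to minus the Hessian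
  determinant of W on the diagonal x = y.\<close>

lemma koszul_str4:
  fixes a1 a2 :: "(nat + nat) mpol"
  defines "b1 \<equiv> Vr (Inr 0) - Vr (Inl 0)" and "b2 \<equiv> Vr (Inr 1) - Vr (Inl 1)"
  shows "str4 2 (m22 b1 b2 a2 (- a1)) (m22 a1 b2 a2 (- b1)) =
    (pdiff (Inl 1) a1 + pdiff (Inr 1) a1) * (pdiff (Inl 0) a2 + pdiff (Inr 0) a2) -
    (pdiff (Inl 0) a1 + pdiff (Inr 0) a1) * (pdiff (Inl 1) a2 + pdiff (Inr 1) a2)"
  unfolding str4_def fdiff_m22 fmul_m22 ftr_m22
  by (simp add: b1_def b2_def pdiff_Vr algebra_simps)

lemma koszul_block_mf:
  fixes a1 a2 :: "(nat + nat) mpol"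
  defines "b1 \<equiv> Vr (Inr 0) - Vr (Inl 0)" and "b2 \<equiv> Vr (Inr 1) - Vr (Inl 1)"
  assumes "a1 \<in> polys_in vars4" "a2 \<in> polys_in vars4"
    and "homogeneous (wt W W) (2 - vdeg W 0) a1" "homogeneous (wt W W) (2 - vdeg W 1) a2"
    and "b1 * a1 + b2 * a2 = in_y W - in_x W"
  shows "block_mf W W 2 (\<lambda>i. if i = 0 then 0 else vdeg W 0 + vdeg W 1 - 2)
    (\<lambda>i. if i = 0 then vdeg W 0 - 1 else vdeg W 1 - 1)
    (m22 b1 b2 a2 (- a1)) (m22 a1 b2 a2 (- b1))"
proof -
  have b: "homogeneous (wt W W) (vdeg W 0) b1" "homogeneous (wt W W) (vdeg W 1) b2"
    using homogeneous_Vr[of "wt W W" "Inr 0"] homogeneous_Vr[of "wt W W" "Inl 0"]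
      homogeneous_Vr[of "wt W W" "Inr 1"] homogeneous_Vr[of "wt W W" "Inl 1"]
    by (auto simp: b1_def b2_def intro!: homogeneous_diff)
  have pb: "b1 \<in> polys_in vars4" "b2 \<in> polys_in vars4"
    by (auto simp: b1_def b2_def vars4_def polys_in_Vr intro!: polys_in_intros)
  show ?thesis
    unfolding block_mf_def fmul_m22
    using assms(3-) b pb
    by (auto simp: m22_def less_2_cases_iff algebra_simps
        intro!: polys_in_uminus homogeneous_uminus)
qed

lemma strongly_equivalent_refl_Fermat:
  assumes "a \<ge> 2" "b \<ge> 2"
  shows "strongly_equivalent (W_Fermat a b) (W_Fermat a b)"
proof -
  let ?W = "W_Fermat a b"
  let ?a1 = "hs a (Vr (Inl 0)) (Vr (Inr 0)) :: (nat + nat) mpol"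
  let ?a2 = "hs b (Vr (Inl 1)) (Vr (Inr 1)) :: (nat + nat) mpol"
  let ?P = "m22 (Vr (Inr 0) - Vr (Inl 0)) (Vr (Inr 1) - Vr (Inl 1)) ?a2 (- ?a1)"
  let ?Q = "m22 ?a1 (Vr (Inr 1) - Vr (Inl 1)) ?a2 (- (Vr (Inr 0) - Vr (Inl 0)))"
  have pot: "in_x ?W = Vr (Inl 0) ^ a + Vr (Inl 1) ^ b" "in_y ?W = Vr (Inr 0) ^ a + Vr (Inr 1) ^ b"
    by (simp_all add: in_x_def in_y_def W_Fermat_def two_vars_def)
  have h: "homogeneous (wt ?W ?W) (2 / of_nat a) (Vr (Inl 0))" "homogeneous (wt ?W ?W) (2 / of_nat a) (Vr (Inr 0))"
    "homogeneous (wt ?W ?W) (2 / of_nat b) (Vr (Inl 1))" "homogeneous (wt ?W ?W) (2 / of_nat b) (Vr (Inr 1))"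
    using homogeneous_Vr[of "wt ?W ?W"]
    by (simp_all add: homogeneous_iff Vr_def W_Fermat_def two_vars_def)
  have vd: "vdeg ?W 0 = 2 / of_nat a" "vdeg ?W 1 = 2 / of_nat b"
    by (simp_all add: W_Fermat_def two_vars_def)
  have mf: "block_mf ?W ?W 2 (\<lambda>i. if i = 0 then 0 else vdeg ?W 0 + vdeg ?W 1 - 2)
      (\<lambda>i. if i = 0 then vdeg ?W 0 - 1 else vdeg ?W 1 - 1) ?P ?Q"
  proof (rule koszul_block_mf)
    show "?a1 \<in> polys_in vars4" "?a2 \<in> polys_in vars4"
      by (auto intro!: polys_in_hs simp: polys_in_Vr vars4_def)
    show "homogeneous (wt ?W ?W) (2 - vdeg ?W 0) ?a1" "homogeneous (wt ?W ?W) (2 - vdeg ?W 1) ?a2"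
      unfolding vd using assms
      by (intro homogeneous_hs[OF h(1,2)] homogeneous_hs[OF h(3,4)]; simp add: field_simps)+
    show "(Vr (Inr 0) - Vr (Inl 0)) * ?a1 + (Vr (Inr 1) - Vr (Inl 1)) * ?a2 = in_y ?W - in_x ?W"
      unfolding pot hs_mult_diff by simp
  qed
  have v: "pdiff v (hs n (Vr u) (Vr u')) = 0" if "v \<noteq> u" "v \<noteq> u'" for v u u' n
    by (rule pdiff_polys_in_notin[OF polys_in_hs[of _ "{u, u'}"]]) (use that in \<open>auto simp: polys_in_Vr\<close>)
  have T: "str4 2 ?P ?Q = - ((pdiff (Inl 0) ?a1 + pdiff (Inr 0) ?a1) * (pdiff (Inl 1) ?a2 + pdiff (Inr 1) ?a2))"
    unfolding koszul_str4 by (simp add: v)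
  have ab: "of_nat a * of_nat b \<noteq> (0 :: complex)" using assms by simp
  have fin: "lookup (Cst (1 / (of_nat a * of_nat b)) * - (of_nat a * Vr (f 0) ^ (a - 2) * (of_nat b * Vr (f 1) ^ (b - 2))))
      (res_mon f (a - 2) (b - 2)) \<noteq> 0" if "f 0 \<noteq> f 1" for f :: "nat \<Rightarrow> nat + nat"
  proof -
    have "Cst (1 / (of_nat a * of_nat b)) * - (of_nat a * Vr (f 0) ^ (a - 2) * (of_nat b * Vr (f 1) ^ (b - 2)))
        = - (Cst (1 / (of_nat a * of_nat b)) * Cst (of_nat a * of_nat b)) * (Vr (f 0) ^ (a - 2) * Vr (f 1) ^ (b - 2))"
      by (simp add: Cst_mult mult_ac)
    also have "\<dots> = Cst (- 1) * (Vr (f 0) ^ (a - 2) * Vr (f 1) ^ (b - 2))"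
      unfolding Cst_inverse_mult[OF ab] by (simp add: Cst_uminus)
    finally have "Cst (1 / (of_nat a * of_nat b)) * - (of_nat a * Vr (f 0) ^ (a - 2) * (of_nat b * Vr (f 1) ^ (b - 2))) = \<dots>" .
    then show ?thesis
      by (simp only: lookup_Cst_mult lookup_monomial[OF that]) simp
  qed
  have kx: "keys (res_mon Inl i j) \<subseteq> {Inl 0, Inl (1::nat)}" "keys (res_mon Inr i j) \<subseteq> {Inr 0, Inr (1::nat)}"
    for i j
    using keys_res_mon[of Inl i j] keys_res_mon[of Inr i j] by (auto simp: less_2_cases_iff)
  \<comment> \<open>With one set of variables set to zero the trace becomes minus a b times a
    monomial, and \<open>\<Delta>\<close> = 1/(a b) makes the required coefficient -1.\<close>
  have l: "restr {Inl 0, Inl 1} (pdiff (Inl 0) ?a1 + pdiff (Inr 0) ?a1) = of_nat a * Vr (Inl 0) ^ (a - 2)"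
    "restr {Inl 0, Inl 1} (pdiff (Inl 1) ?a2 + pdiff (Inr 1) ?a2) = of_nat b * Vr (Inl 1) ^ (b - 2)"
    using restr_diff_hs[of "Inr 0" "{Inl 0, Inl 1}" "Inl 0" a]
      restr_diff_hs[of "Inr 1" "{Inl 0, Inl 1}" "Inl 1" b] assms
    unfolding hs_commute[of _ "Vr (Inr _)"] by (simp_all add: add.commute del: restr_hom One_nat_def)
  have r: "restr {Inr 0, Inr 1} (pdiff (Inl 0) ?a1 + pdiff (Inr 0) ?a1) = of_nat a * Vr (Inr 0) ^ (a - 2)"
    "restr {Inr 0, Inr 1} (pdiff (Inl 1) ?a2 + pdiff (Inr 1) ?a2) = of_nat b * Vr (Inr 1) ^ (b - 2)"
    using restr_diff_hs[of "Inl 0" "{Inr 0, Inr 1}" "Inr 0" a]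
      restr_diff_hs[of "Inl 1" "{Inr 0, Inr 1}" "Inr 1" b] assms
    by (simp_all del: restr_hom One_nat_def)
  have ne: "(Inl 0 :: nat + nat) \<noteq> Inl 1" "(Inr 0 :: nat + nat) \<noteq> Inr 1" by simp_all
  have "restr {Inl 0, Inl 1} (rename Inl (Cst (1 / (of_nat a * of_nat b))) * str4 2 ?P ?Q) =
      Cst (1 / (of_nat a * of_nat b)) * - (of_nat a * Vr (Inl 0) ^ (a - 2) * (of_nat b * Vr (Inl 1) ^ (b - 2)))"
    unfolding T restr_hom(2,4) l by simp
  then have "lookup (restr {Inl 0, Inl 1} (rename Inl (Cst (1 / (of_nat a * of_nat b))) * str4 2 ?P ?Q))
      (res_mon Inl (a - 2) (b - 2)) \<noteq> 0"
    by (simp only: fin[OF ne(1)] not_False_eq_True)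
  then have l0: "lookup (rename Inl (Cst (1 / (of_nat a * of_nat b))) * str4 2 ?P ?Q) (res_mon Inl (a - 2) (b - 2)) \<noteq> 0"
    unfolding lookup_restr[OF kx(1)] .
  have "restr {Inr 0, Inr 1} (rename Inr (Cst (1 / (of_nat a * of_nat b))) * str4 2 ?P ?Q) =
      Cst (1 / (of_nat a * of_nat b)) * - (of_nat a * Vr (Inr 0) ^ (a - 2) * (of_nat b * Vr (Inr 1) ^ (b - 2)))"
    unfolding T restr_hom(2,4) r by simp
  then have "lookup (restr {Inr 0, Inr 1} (rename Inr (Cst (1 / (of_nat a * of_nat b))) * str4 2 ?P ?Q))
      (res_mon Inr (a - 2) (b - 2)) \<noteq> 0"
    by (simp only: fin[OF ne(2)] not_False_eq_True)
  then have r0: "lookup (rename Inr (Cst (1 / (of_nat a * of_nat b))) * str4 2 ?P ?Q) (res_mon Inr (a - 2) (b - 2)) \<noteq> 0"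
    unfolding lookup_restr[OF kx(2)] .
  show ?thesis
    unfolding strongly_equivalent_def using mf residue_data_Fermat[OF assms] l0 r0 by blast
qed

text \<open>Seeds relate E7 only to types A and D, so the pair (E7, E7) needs its own Koszul
  factorization. It comes from the splitting y y'^3 - x x'^3 = (y - x) y'^3 + x (y'^3 -
  x'^3).\<close>

lemma strongly_equivalent_refl_E7: "strongly_equivalent W_E7 W_E7"
proof -
  let ?x = "Vr (Inl 0) :: (nat + nat) mpol" and ?x' = "Vr (Inl 1) :: (nat + nat) mpol"
    and ?y = "Vr (Inr 0) :: (nat + nat) mpol" and ?y' = "Vr (Inr 1) :: (nat + nat) mpol"
  let ?a1 = "hs 3 ?x ?y + ?y' ^ 3" and ?a2 = "?x * hs 3 ?x' ?y'"
  let ?P = "m22 (?y - ?x) (?y' - ?x') ?a2 (- ?a1)" and ?Q = "m22 ?a1 (?y' - ?x') ?a2 (- (?y - ?x))"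
  let ?\<Delta> = "Cst (- 1 / 3) * Vr 0 ^ 2 + Cst (1 / 9) * Vr 1 ^ 3 :: nat mpol"
  have pot: "in_x W_E7 = ?x ^ 3 + ?x * ?x' ^ 3" "in_y W_E7 = ?y ^ 3 + ?y * ?y' ^ 3"
    by (simp_all add: in_x_def in_y_def W_E7_def two_vars_def)
  have h: "homogeneous (wt W_E7 W_E7) (2 / 3) ?x" "homogeneous (wt W_E7 W_E7) (2 / 3) ?y"
    "homogeneous (wt W_E7 W_E7) (4 / 9) ?x'" "homogeneous (wt W_E7 W_E7) (4 / 9) ?y'"
    by (simp_all add: homogeneous_iff Vr_def W_E7_def two_vars_def)
  have vd: "vdeg W_E7 0 = 2 / 3" "vdeg W_E7 1 = 4 / 9"
    by (simp_all add: W_E7_def two_vars_def)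
  have mf: "block_mf W_E7 W_E7 2 (\<lambda>i. if i = 0 then 0 else vdeg W_E7 0 + vdeg W_E7 1 - 2)
      (\<lambda>i. if i = 0 then vdeg W_E7 0 - 1 else vdeg W_E7 1 - 1) ?P ?Q"
  proof (rule koszul_block_mf)
    show "?a1 \<in> polys_in vars4" "?a2 \<in> polys_in vars4"
      by (auto intro!: polys_in_hs polys_in_intros simp: polys_in_Vr vars4_def)
    show "homogeneous (wt W_E7 W_E7) (2 - vdeg W_E7 0) ?a1" "homogeneous (wt W_E7 W_E7) (2 - vdeg W_E7 1) ?a2"
      unfolding vd
      by (auto intro!: homogeneous_add homogeneous_mult[OF h(1) homogeneous_hs[OF h(3,4) refl]]
          homogeneous_hs[OF h(1,2)] homogeneous_power[OF h(4)] simp del: One_nat_def)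
    have "(?y - ?x) * ?a1 + (?y' - ?x') * ?a2 =
        (?y - ?x) * hs 3 ?x ?y + (?y - ?x) * ?y' ^ 3 + ?x * ((?y' - ?x') * hs 3 ?x' ?y')"
      by (simp add: ring_distribs mult_ac)
    then show "(?y - ?x) * ?a1 + (?y' - ?x') * ?a2 = in_y W_E7 - in_x W_E7"
      unfolding pot hs_mult_diff by (simp add: algebra_simps)
  qed
  have hs3: "hs 3 p q = p ^ 2 + p * q + q ^ 2" for p q :: "(nat + nat) mpol"
    by (simp add: numeral_3_eq_3 power2_eq_square algebra_simps)
  have T: "str4 2 ?P ?Q = 3 * ?y' ^ 2 * hs 3 ?x' ?y' - (3 * ?x + 3 * ?y) * (?x * (3 * ?x' + 3 * ?y'))"
    unfolding koszul_str4 hs3 by (simp add: pdiff_Vr pdiff_power algebra_simps)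
  have kx: "keys (res_mon Inl i j) \<subseteq> {Inl 0, Inl (1::nat)}" "keys (res_mon Inr i j) \<subseteq> {Inr 0, Inr (1::nat)}"
    for i j
    using keys_res_mon[of Inl i j] keys_res_mon[of Inr i j] by (auto simp: less_2_cases_iff)
  have c: "Cst (1 / 3) * 3 = (1 :: (nat + nat) mpol)" "Cst (1 / 9) * 9 = (1 :: (nat + nat) mpol)"
    "Cst (- 1 / 3) = (- Cst (1 / 3) :: (nat + nat) mpol)" "Cst (1 / 9) * 3 = (Cst (1 / 3) :: (nat + nat) mpol)"
    by (simp_all flip: Cst_mult Cst_numeral Cst_uminus Cst_1)
  have "restr {Inl 0, Inl 1} (rename Inl ?\<Delta> * str4 2 ?P ?Q) =
      (Cst (1 / 3) * 3) * (3 * (?x ^ 4 * ?x' ^ 1)) - (Cst (1 / 9) * 9) * (?x ^ 2 * ?x' ^ 4)"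
    unfolding T unfolding hs3 by (simp add: Cst_uminus restr_Vr algebra_simps power2_eq_square power3_eq_cube power4_eq_xxxx)
  also have "\<dots> = Cst 3 * (?x ^ 4 * ?x' ^ 1) + Cst (- 1) * (?x ^ 2 * ?x' ^ 4)"
    unfolding c by (simp add: Cst_uminus)
  finally have 1: "restr {Inl 0, Inl 1} (rename Inl ?\<Delta> * str4 2 ?P ?Q) = \<dots>" .
  have "restr {Inr 0, Inr 1} (rename Inr ?\<Delta> * str4 2 ?P ?Q) =
      - (Cst (1 / 3) * 3) * (?y ^ 2 * ?y' ^ 4) + (Cst (1 / 9) * 3) * (?y ^ 0 * ?y' ^ 7)"
    unfolding T unfolding hs3 by (simp add: Cst_uminus restr_Vr algebra_simps power2_eq_square power3_eq_cube eval_nat_numeral)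
  also have "\<dots> = Cst (- 1) * (?y ^ 2 * ?y' ^ 4) + Cst (1 / 3) * (?y ^ 0 * ?y' ^ 7)"
    unfolding c by (simp add: Cst_uminus)
  finally have 2: "restr {Inr 0, Inr 1} (rename Inr ?\<Delta> * str4 2 ?P ?Q) = \<dots>" .
  have ne: "(Inl 0 :: nat + nat) \<noteq> Inl 1" "(Inr 0 :: nat + nat) \<noteq> Inr 1" by simp_all
  have "lookup (rename Inl ?\<Delta> * str4 2 ?P ?Q) (res_mon Inl 2 4) =
      lookup (restr {Inl 0, Inl 1} (rename Inl ?\<Delta> * str4 2 ?P ?Q)) (res_mon Inl 2 4)"
    by (rule lookup_restr[OF kx(1), symmetric])
  also have "\<dots> = - 1"
    unfolding 1 lookup_add lookup_Cst_mult lookup_monomial[OF ne(1)] by simp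
  finally have 1: "lookup (rename Inl ?\<Delta> * str4 2 ?P ?Q) (res_mon Inl 2 4) = - 1" .
  have "lookup (rename Inr ?\<Delta> * str4 2 ?P ?Q) (res_mon Inr 2 4) =
      lookup (restr {Inr 0, Inr 1} (rename Inr ?\<Delta> * str4 2 ?P ?Q)) (res_mon Inr 2 4)"
    by (rule lookup_restr[OF kx(2), symmetric])
  also have "\<dots> = - 1"
    unfolding 2 lookup_add lookup_Cst_mult lookup_monomial[OF ne(2)] by simp
  finally have 2: "lookup (rename Inr ?\<Delta> * str4 2 ?P ?Q) (res_mon Inr 2 4) = - 1" .
  have "lookup (rename Inl ?\<Delta> * str4 2 ?P ?Q) (res_mon Inl 2 4) \<noteq> 0"
    "lookup (rename Inr ?\<Delta> * str4 2 ?P ?Q) (res_mon Inr 2 4) \<noteq> 0"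
    unfolding 1 2 by simp_all
  then show ?thesis
    unfolding strongly_equivalent_def using mf residue_data_E7 by blast
qed

section \<open>Square roots of W - c u^(2k) and the two equivalences drawn from each\<close>

section \<open>Seeds\<close>

definition vars3 :: "(nat + nat) set" where
  "vars3 = {Inl 0, Inr 0, Inr 1}"

text \<open>The matrices \<open>E\<close> and \<open>F\<close> are the even and odd parts of \<open>M(u) = E(u\<^sup>2) + u F(u\<^sup>2)\<close>, with
  \<open>M\<^sup>2 = W - c u\<^bsup>2k\<^esup>\<close>; the variable \<open>Inl 0\<close> stands for \<open>u\<^sup>2\<close>. The even part in \<open>u\<close> of
  \<open>tr(\<partial>\<^sub>u M \<partial>\<^sub>x M \<partial>\<^sub>y M)\<close> is \<open>seed_trace\<close>; it determines the
  quantum dimensions of both equivalences obtained from the seed.\<close>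

definition seed_trace :: "nat \<Rightarrow> (nat \<Rightarrow> nat \<Rightarrow> (nat + nat) mpol) \<Rightarrow> (nat \<Rightarrow> nat \<Rightarrow> (nat + nat) mpol) \<Rightarrow> (nat + nat) mpol" where
  "seed_trace r E F =
     ftr r (fmul r (\<lambda>i j. F i j + 2 * Vr (Inl 0) * fdiff (Inl 0) F i j)
       (\<lambda>i j. fmul r (fdiff (Inr 0) E) (fdiff (Inr 1) E) i j +
          Vr (Inl 0) * fmul r (fdiff (Inr 0) F) (fdiff (Inr 1) F) i j)) +
     2 * Vr (Inl 0) * ftr r (fmul r (fdiff (Inl 0) E)
       (\<lambda>i j. fmul r (fdiff (Inr 0) E) (fdiff (Inr 1) F) i j + fmul r (fdiff (Inr 0) F) (fdiff (Inr 1) E) i j))"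

text \<open>\<open>F\<close> has degree lower by 1/k, the degree of u, and the square condition is
  split into its even and odd parts in u. The constant \<open>c\<close> is left free because the E
  types do not produce c = 1 directly. The last two conjuncts hold the coefficients that decide the
  quantum dimensions.\<close>

definition seed :: "graded_poly \<Rightarrow> nat \<Rightarrow> complex \<Rightarrow> nat \<Rightarrow> (nat \<Rightarrow> rat) \<Rightarrow>
    (nat \<Rightarrow> nat \<Rightarrow> (nat + nat) mpol) \<Rightarrow> (nat \<Rightarrow> nat \<Rightarrow> (nat + nat) mpol) \<Rightarrow> bool" where
  "seed W k c r \<delta> E F \<longleftrightarrow>
     (\<forall>i j. E i j \<in> polys_in vars3 \<and> F i j \<in> polys_in vars3) \<and>
     (\<forall>i<r. \<forall>j<r.
        homogeneous (case_sum (\<lambda>_. 2 / of_nat k) (vdeg W)) (\<delta> j + 1 - \<delta> i) (E i j) \<and>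
        homogeneous (case_sum (\<lambda>_. 2 / of_nat k) (vdeg W)) (\<delta> j + 1 - \<delta> i - 1 / of_nat k) (F i j) \<and>
        fmul r E E i j + Vr (Inl 0) * fmul r F F i j = (if i = j then in_y W - Cst c * Vr (Inl 0) ^ k else 0) \<and>
        fmul r E F i j + fmul r F E i j = 0) \<and>
     lookup (seed_trace r E F) (single (Inl 0) (k - 1)) \<noteq> 0 \<and>
     (\<exists>a b \<Delta>. residue_data W a b \<Delta> \<and> lookup (rename Inr \<Delta> * seed_trace r E F) (res_mon Inr a b) \<noteq> 0)"

lemma Cst_prod: "Cst (prod f A) = (\<Prod>i\<in>A. Cst (f i))"
  by (induction A rule: infinite_finite_induct) (simp_all add: Cst_mult)

lemma lookup_msubst_scale: "lookup (msubst (\<lambda>v. Cst (s v) * Vr v) p) m = mon_eval s m * lookup p m"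
proof (induction p rule: single_induct)
  case (single n c)
  have "mon_eval (\<lambda>v. Cst (s v) * Vr v) n = Cst (mon_eval s n) * mon_eval Vr n"
    by (simp add: mon_eval_def power_mult_distrib prod.distrib Cst_prod Cst_power)
  then show ?case
    by (simp add: msubst_single mon_eval_Vr lookup_single when_def)
qed (simp_all add: lookup_add ring_distribs)

lemma restr_msubst:
  assumes "\<And>v. v \<in> S \<Longrightarrow> restr S (\<phi> v) = Vr v" "\<And>v. v \<notin> S \<Longrightarrow> restr S (\<phi> v) = 0"
  shows "restr S (msubst \<phi> p) = restr S p"
  unfolding restr_def msubst_msubst using assms
  by (intro arg_cong2[of _ _ _ _ msubst] ext refl) (auto simp: restr_def)

lemma Inr_vars: "keys (res_mon Inr a b) \<subseteq> {Inr 0, Inr (1 :: nat)}"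
  using keys_res_mon[of Inr a b] by (auto simp: less_2_cases_iff)

lemma msubst_rename_Inr:
  assumes "\<And>v. \<phi> (Inr v) = Vr (Inr v)"
  shows "msubst \<phi> (rename Inr p) = rename Inr p"
  unfolding rename_def msubst_msubst by (simp add: assms)

text \<open>Rescaling the variable \<open>Inl 0\<close> by \<open>\<omega>\<^sup>2\<close> normalises the constant \<open>c\<close>.\<close>

lemma seed_normalise:
  assumes "seed W k c r \<delta> E F" "c \<noteq> 0" "k > 0"
  obtains E' F' where "seed W k 1 r \<delta> E' F'"
proof -
  obtain \<omega> :: complex where \<omega>: "\<omega> ^ (2 * k) = 1 / c"
    using nth_root_exists[of "2 * k" "1 / c"] assms(3) by auto
  then have "\<omega> \<noteq> 0" using assms(2,3) by (auto simp: power_0_left)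
  define s :: "nat + nat \<Rightarrow> complex" where "s v = (if v = Inl 0 then \<omega> ^ 2 else 1)" for v
  define \<phi> :: "nat + nat \<Rightarrow> (nat + nat) mpol" where "\<phi> v = Cst (s v) * Vr v" for v
  let ?p = "Vr (Inl 0) :: (nat + nat) mpol" and ?\<phi> = "msubst \<phi>" and ?w = "Cst \<omega> :: (nat + nat) mpol"
  \<comment> \<open>\<open>F\<close> stands next to a factor u in M, so replacing u by omega u gives
    it a factor omega of its own, whereas \<open>E\<close> depends on u^2 only.\<close>
  define E' F' where "E' i j = ?\<phi> (E i j)" and "F' i j = ?w * ?\<phi> (F i j)" for i j
  have \<phi>p: "?\<phi> ?p = ?w * ?w * ?p" and \<phi>r: "\<phi> (Inr v) = Vr (Inr v)" for v
    by (simp_all add: \<phi>_def s_def power2_eq_square Cst_mult)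
  have "pdiff (Inl 0) (?\<phi> f) = ?\<phi> (pdiff (Inl 0) f) * pdiff (Inl 0) (\<phi> (Inl 0))" for f
    by (rule pdiff_msubst) (simp add: \<phi>_def pdiff_Vr)
  then have d0: "pdiff (Inl 0) (?\<phi> f) = ?w * (?w * ?\<phi> (pdiff (Inl 0) f))" for f
    by (simp add: \<phi>_def s_def pdiff_Vr power2_eq_square Cst_mult mult_ac)
  have "pdiff (Inr v) (?\<phi> f) = ?\<phi> (pdiff (Inr v) f) * pdiff (Inr v) (\<phi> (Inr v))" for f v
    by (rule pdiff_msubst) (simp add: \<phi>_def pdiff_Vr)
  then have dr: "pdiff (Inr v) (?\<phi> f) = ?\<phi> (pdiff (Inr v) f)" for f v
    by (simp add: \<phi>r pdiff_Vr)
  have fd: "fdiff (Inl 0) E' = (\<lambda>i j. ?w * (?w * ?\<phi> (fdiff (Inl 0) E i j)))"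
    "fdiff (Inr v) E' = (\<lambda>i j. ?\<phi> (fdiff (Inr v) E i j))"
    "fdiff (Inr v) F' = (\<lambda>i j. ?w * ?\<phi> (fdiff (Inr v) F i j))" for v
    by (simp_all add: E'_def F'_def d0 dr)
  have K: "(\<lambda>i j. F' i j + 2 * ?p * fdiff (Inl 0) F' i j) =
      (\<lambda>i j. ?w * ?\<phi> (F i j + 2 * ?p * fdiff (Inl 0) F i j))"
    by (intro ext) (simp add: F'_def d0 \<phi>p[simplified] algebra_simps)
  have fp: "fmul r (\<lambda>i j. ?\<phi> (A i j)) (\<lambda>i j. ?\<phi> (B i j)) = (\<lambda>i j. ?\<phi> (fmul r A B i j))" for A B
    by (rule fmul_msubst)
  \<comment> \<open>The trace contains one u-derivative, which contributes the single factor
    omega.\<close>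
  have tr: "seed_trace r E' F' = ?w * ?\<phi> (seed_trace r E F)"
  proof -
    have 1: "(\<lambda>i j. fmul r (fdiff (Inr 0) E') (fdiff (Inr 1) E') i j +
          ?p * fmul r (fdiff (Inr 0) F') (fdiff (Inr 1) F') i j) =
        (\<lambda>i j. ?\<phi> (fmul r (fdiff (Inr 0) E) (fdiff (Inr 1) E) i j +
          ?p * fmul r (fdiff (Inr 0) F) (fdiff (Inr 1) F) i j))"
      unfolding fd fmul_scale fp by (simp add: \<phi>p[simplified] mult_ac)
    have 2: "(\<lambda>i j. fmul r (fdiff (Inr 0) E') (fdiff (Inr 1) F') i j + fmul r (fdiff (Inr 0) F') (fdiff (Inr 1) E') i j) =
        (\<lambda>i j. ?w * ?\<phi> (fmul r (fdiff (Inr 0) E) (fdiff (Inr 1) F) i j + fmul r (fdiff (Inr 0) F) (fdiff (Inr 1) E) i j))"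
      unfolding fd fmul_scale fp by (simp add: algebra_simps)
    show ?thesis
      unfolding seed_trace_def 1 2 K fd(1) fmul_scale fp ftr_scale ftr_msubst
      by (simp add: \<phi>p[simplified] algebra_simps)
  qed
  obtain a b \<Delta> where W: "residue_data W a b \<Delta>" "lookup (rename Inr \<Delta> * seed_trace r E F) (res_mon Inr a b) \<noteq> 0"
    using assms(1) unfolding seed_def by blast
  have "seed W k 1 r \<delta> E' F'"
    unfolding seed_def
  proof (intro conjI allI impI exI)
    have EF: "E i j \<in> polys_in vars3" "F i j \<in> polys_in vars3" for i j
      using assms(1) unfolding seed_def by blast+
    have "\<phi> v \<in> polys_in vars3" if "v \<in> vars3" for v
      unfolding \<phi>_def using that by (intro polys_in_mult) (auto simp: polys_in_Vr)
    then show "E' i j \<in> polys_in vars3" "F' i j \<in> polys_in vars3" for i j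
      unfolding E'_def F'_def by (intro polys_in_mult polys_in_Cst msubst_polys_in[OF EF(1)] msubst_polys_in[OF EF(2)]; assumption)+
    fix i j assume ij: "i < r" "j < r"
    let ?W = "case_sum (\<lambda>_. 2 / of_nat k) (vdeg W)"
    have h: "homogeneous ?W q f \<Longrightarrow> homogeneous ?W q (?\<phi> f)" for q f
      by (erule homogeneous_msubst) (auto simp: \<phi>_def intro!: homogeneous_mult[OF homogeneous_Cst homogeneous_Vr])
    show "homogeneous ?W (\<delta> j + 1 - \<delta> i) (E' i j)"
      using assms(1) ij unfolding seed_def E'_def by (intro h) simp
    show "homogeneous ?W (\<delta> j + 1 - \<delta> i - 1 / of_nat k) (F' i j)"
      unfolding F'_def
      by (rule homogeneous_mult[OF homogeneous_Cst h]) (use assms(1) ij in \<open>auto simp: seed_def\<close>)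
    have eq: "fmul r E E i j + ?p * fmul r F F i j = (if i = j then in_y W - Cst c * ?p ^ k else 0)"
      "fmul r E F i j + fmul r F E i j = 0"
      using assms(1) ij unfolding seed_def by simp_all
    have wk: "Cst c * (?w * ?w) ^ k = 1"
      using \<omega> assms(2) by (simp add: power_mult power2_eq_square flip: Cst_mult Cst_power)
    have "fmul r E' E' i j + ?p * fmul r F' F' i j = ?\<phi> (fmul r E E i j + ?p * fmul r F F i j)"
      unfolding E'_def F'_def fmul_scale fp by (simp add: \<phi>p[simplified] mult_ac)
    also have "\<dots> = (if i = j then ?\<phi> (in_y W) - (Cst c * (?w * ?w) ^ k) * ?p ^ k else 0)"
      unfolding eq by (simp add: \<phi>p[simplified] power_mult_distrib mult_ac)
    also have "?\<phi> (in_y W) = in_y W"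
      unfolding in_y_def by (rule msubst_rename_Inr) (rule \<phi>r)
    finally show "fmul r E' E' i j + ?p * fmul r F' F' i j = (if i = j then in_y W - Cst 1 * ?p ^ k else 0)"
      unfolding wk by simp
    have "fmul r E' F' i j + fmul r F' E' i j = ?w * ?\<phi> (fmul r E F i j + fmul r F E i j)"
      unfolding E'_def F'_def fmul_scale fp by (simp add: algebra_simps)
    then show "fmul r E' F' i j + fmul r F' E' i j = 0"
      unfolding eq by simp
  next
    have "mon_eval s (single (Inl 0) (k - 1)) \<noteq> 0"
      using \<open>\<omega> \<noteq> 0\<close> by (simp add: mon_eval_def s_def)
    then show "lookup (seed_trace r E' F') (single (Inl 0) (k - 1)) \<noteq> 0"
      using assms(1) \<open>\<omega> \<noteq> 0\<close> lookup_msubst_scale[of s] unfolding tr seed_def \<phi>_def by simp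
    show "residue_data W a b \<Delta>" by (rule W)
    let ?S = "{Inr 0, Inr 1} :: (nat + nat) set"
    have "restr ?S (?\<phi> f) = restr ?S f" for f
      by (rule restr_msubst) (auto simp: \<phi>_def s_def restr_Vr)
    then have "restr ?S (rename Inr \<Delta> * seed_trace r E' F') = restr ?S (?w * (rename Inr \<Delta> * seed_trace r E F))"
      unfolding tr by (simp add: mult_ac)
    then have "lookup (rename Inr \<Delta> * seed_trace r E' F') (res_mon Inr a b) =
        lookup (?w * (rename Inr \<Delta> * seed_trace r E F)) (res_mon Inr a b)"
      using lookup_restr[OF Inr_vars] by metis
    then show "lookup (rename Inr \<Delta> * seed_trace r E' F') (res_mon Inr a b) \<noteq> 0"
      using W(2) \<open>\<omega> \<noteq> 0\<close> by (simp only: lookup_Cst_mult) simp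
  qed
  then show ?thesis by (rule that)
qed

text \<open>\<open>Inl 0\<close> denotes p in the argument and u in the result: p is replaced by u^2
  without a change of name.\<close>

definition sq_subst :: "nat + nat \<Rightarrow> (nat + nat) mpol" where
  "sq_subst v = (if v = Inl 0 then Vr (Inl 0) ^ 2 else Vr v)"

lemma sq_subst_simps [simp]: "sq_subst (Inl 0) = Vr (Inl 0) ^ 2" "sq_subst (Inr v) = Vr (Inr v)"
  by (simp_all add: sq_subst_def)

lemma msubst_sq_single: "msubst sq_subst (single m c) = single (m + single (Inl 0) (lookup m (Inl 0))) c"
proof -
  let ?A = "insert (Inl 0) (keys m)"
  have "mon_eval sq_subst m = (\<Prod>v\<in>?A. sq_subst v ^ lookup m v)"
    by (rule mon_eval_superset) auto
  also have "\<dots> = (\<Prod>v\<in>?A. Vr v ^ lookup m v * (if v = Inl 0 then Vr (Inl 0) ^ lookup m (Inl 0) else 1))"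
    by (intro prod.cong refl) (simp add: sq_subst_def power2_eq_square power_mult_distrib)
  also have "\<dots> = mon_eval Vr m * Vr (Inl 0) ^ lookup m (Inl 0)"
    using mon_eval_superset[OF finite.insertI[OF finite_keys] subset_insertI, of Vr m "Inl 0"]
    by (simp add: prod.distrib)
  finally show ?thesis
    by (simp add: msubst_single mon_eval_Vr Vr_power mult_single flip: single_eq_Cst_mult)
qed

lemma lookup_msubst_sq:
  "lookup (msubst sq_subst p) (single (Inl 0) j) = (if even j then lookup p (single (Inl 0) (j div 2)) else 0)"
proof (induction p rule: single_induct)
  case (single m c)
  have "m + single (Inl 0) (lookup m (Inl 0)) = single (Inl 0) j \<longleftrightarrow> even j \<and> m = single (Inl 0) (j div 2)"
    (is "?l = ?r \<longleftrightarrow> _")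
  proof
    assume eq: "?l = ?r"
    have "lookup ?l v = lookup ?r v" for v by (simp add: eq)
    then have *: "lookup m v + (lookup m (Inl 0) when v = Inl 0) = (j when v = Inl 0)" for v
      by (simp add: lookup_add lookup_single eq_commute)
    have j: "j = 2 * lookup m (Inl 0)"
      using *[of "Inl 0"] by simp
    have "m = single (Inl 0) (j div 2)"
    proof (rule poly_mapping_eqI)
      show "lookup m v = lookup (single (Inl 0) (j div 2)) v" for v
        using *[of v] j by (cases "v = Inl 0") (simp_all add: lookup_single)
    qed
    then show "even j \<and> m = single (Inl 0) (j div 2)"
      using j by simp
  next
    assume *: "even j \<and> m = single (Inl 0) (j div 2)"
    then have "j div 2 + j div 2 = j" by auto
    then show "?l = ?r"
      using * by (simp flip: single_add)
  qed
  then show ?case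
    unfolding msubst_sq_single by (auto simp: lookup_single when_def)
qed (simp_all add: lookup_add)

subsection \<open>From seeds to type A\<close>

definition even_odd :: "(nat \<Rightarrow> nat \<Rightarrow> (nat + nat) mpol) \<Rightarrow> (nat \<Rightarrow> nat \<Rightarrow> (nat + nat) mpol) \<Rightarrow> nat \<Rightarrow> nat \<Rightarrow> (nat + nat) mpol" where
  "even_odd A B i j = msubst sq_subst (A i j) + Vr (Inl 0) * msubst sq_subst (B i j)"

text \<open>Parity in u is multiplicative and u^2 = p, so products and traces of M can be computed
  over p alone.\<close>

lemma fmul_even_odd: "fmul n (even_odd A B) (even_odd C D) =
    even_odd (\<lambda>i j. fmul n A C i j + Vr (Inl 0) * fmul n B D i j) (\<lambda>i j. fmul n A D i j + fmul n B C i j)"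
  by (intro ext) (simp add: even_odd_def fmul_def msubst_sum sum_distrib_left sum.distrib[symmetric]
      algebra_simps power2_eq_square)

lemma ftr_even_odd: "ftr n (even_odd A B) = msubst sq_subst (ftr n A) + Vr (Inl 0) * msubst sq_subst (ftr n B)"
  by (simp add: ftr_def even_odd_def msubst_sum sum_distrib_left sum.distrib)

lemma pdiff_msubst_sq:
  "pdiff (Inl 0) (msubst sq_subst p) = 2 * Vr (Inl 0) * msubst sq_subst (pdiff (Inl 0) p)"
  "pdiff (Inr v) (msubst sq_subst p) = msubst sq_subst (pdiff (Inr v) p)"
proof -
  have "pdiff (Inl 0) (msubst sq_subst p) = msubst sq_subst (pdiff (Inl 0) p) * pdiff (Inl 0) (sq_subst (Inl 0))"
    by (rule pdiff_msubst) (simp add: sq_subst_def pdiff_Vr)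
  then show "pdiff (Inl 0) (msubst sq_subst p) = 2 * Vr (Inl 0) * msubst sq_subst (pdiff (Inl 0) p)"
    by (simp add: pdiff_power pdiff_Vr mult_ac)
  have "pdiff (Inr v) (msubst sq_subst p) = msubst sq_subst (pdiff (Inr v) p) * pdiff (Inr v) (sq_subst (Inr v))"
    by (rule pdiff_msubst) (auto simp: sq_subst_def pdiff_Vr pdiff_power)
  then show "pdiff (Inr v) (msubst sq_subst p) = msubst sq_subst (pdiff (Inr v) p)"
    by (simp add: pdiff_Vr)
qed

lemma fdiff_even_odd:
  "fdiff (Inl 0) (even_odd A B) =
    even_odd (\<lambda>i j. B i j + 2 * Vr (Inl 0) * fdiff (Inl 0) B i j) (\<lambda>i j. 2 * fdiff (Inl 0) A i j)"
  "fdiff (Inr v) (even_odd A B) = even_odd (fdiff (Inr v) A) (fdiff (Inr v) B)"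
  by (intro ext; simp add: even_odd_def pdiff_msubst_sq pdiff_Vr algebra_simps power2_eq_square)+

abbreviation scalar_mat :: "'a::zero \<Rightarrow> nat \<Rightarrow> nat \<Rightarrow> 'a" where
  "scalar_mat c \<equiv> \<lambda>i j. if i = j then c else 0"

lemma fmul_scalar_mat:
  "i < n \<Longrightarrow> fmul n (scalar_mat c) A i j = c * A i j"
  "j < n \<Longrightarrow> fmul n A (scalar_mat c) i j = c * A i j"
  by (simp_all add: fmul_def if_distrib[of "\<lambda>x. x * _"] if_distrib[of "(*) _"] mult.commute cong: if_cong)

lemma fmul_add:
  "fmul n (\<lambda>i j. A i j + B i j) C = (\<lambda>i j. fmul n A C i j + fmul n B C i j)"
  "fmul n A (\<lambda>i j. B i j + C i j) = (\<lambda>i j. fmul n A B i j + fmul n A C i j)"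
  "fmul n (\<lambda>i j. A i j - B i j) C = (\<lambda>i j. fmul n A C i j - fmul n B C i j)"
  "fmul n A (\<lambda>i j. B i j - C i j) = (\<lambda>i j. fmul n A B i j - fmul n A C i j)"
  by (simp_all add: fmul_def fun_eq_iff sum.distrib sum_subtractf ring_distribs)

lemma ftr_add: "ftr n (\<lambda>i j. A i j + B i j) = ftr n A + ftr n B"
  by (simp add: ftr_def sum.distrib)

lemma fmul_scalar_mat_conj:
  assumes "i < n" "j < n"
  shows "fmul n (\<lambda>i j. N i j - scalar_mat v i j) (\<lambda>i j. N i j + scalar_mat v i j) i j =
      fmul n N N i j - scalar_mat (v * v) i j"
    "fmul n (\<lambda>i j. N i j + scalar_mat v i j) (\<lambda>i j. N i j - scalar_mat v i j) i j =
      fmul n N N i j - scalar_mat (v * v) i j"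
  using assms by (simp_all add: fmul_add fmul_scalar_mat del: if_cancel)

lemma ftr_scalar_mat: "ftr n (fmul n A (fmul n (scalar_mat c) B)) = c * ftr n (fmul n A B)"
proof -
  have "ftr n (fmul n A (fmul n (scalar_mat c) B)) = ftr n (fmul n A (\<lambda>i j. c * B i j))"
    unfolding ftr_def fmul_def[of n A] by (intro sum.cong refl) (simp add: fmul_scalar_mat)
  then show ?thesis
    by (simp add: fmul_scale ftr_scale)
qed

lemma vars3_subset: "vars3 \<subseteq> vars4"
  by (auto simp: vars3_def vars4_def)

lemma pdiff_vars3: "p \<in> polys_in vars3 \<Longrightarrow> pdiff (Inl 1) p = 0"
  by (rule pdiff_polys_in_notin[of p vars3]) (auto simp: vars3_def)

lemma polys_in_msubst_sq: "p \<in> polys_in vars3 \<Longrightarrow> msubst sq_subst p \<in> polys_in vars3"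
  by (erule msubst_polys_in) (auto simp: vars3_def polys_in_Vr sq_subst_def intro!: polys_in_power)

lemma seed_type_A:
  assumes "seed W k 1 r \<delta> E F" "k \<ge> 2"
  shows "strongly_equivalent (W_A (2 * k - 1)) W"
proof -
  let ?u = "Vr (Inl 0) :: (nat + nat) mpol" and ?v = "Vr (Inl 1) :: (nat + nat) mpol"
  let ?V = "W_A (2 * k - 1)" and ?G = "seed_trace r E F"
  define N where "N = even_odd E F"
  define P where "P = (\<lambda>i j. N i j - scalar_mat ?v i j)"
  define Q where "Q = (\<lambda>i j. N i j + scalar_mat ?v i j)"
  have V: "?V = W_Fermat (2 * k) 2"
    using W_A_eq_Fermat[of "2 * k"] assms(2) by simp
  obtain a b \<Delta> where W: "residue_data W a b \<Delta>" "lookup (rename Inr \<Delta> * ?G) (res_mon Inr a b) \<noteq> 0"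
    using assms(1) unfolding seed_def by blast
  have EF: "E i j \<in> polys_in vars3" "F i j \<in> polys_in vars3" for i j
    using assms(1) unfolding seed_def by blast+
  have pot: "in_x ?V = ?u ^ (2 * k) + ?v * ?v"
    unfolding V by (simp add: in_x_def W_Fermat_def two_vars_def power2_eq_square)
  have "block_mf ?V W r \<delta> \<delta> P Q"
    unfolding block_mf_def
  proof (intro allI impI)
    fix i j assume ij: "i < r" "j < r"
    have eq: "fmul r E E i j + ?u * fmul r F F i j = (if i = j then in_y W - ?u ^ k else 0)"
      "fmul r E F i j + fmul r F E i j = 0"
      using assms(1) ij unfolding seed_def by simp_all
    have "msubst sq_subst (in_y W) = in_y W"
      unfolding in_y_def by (rule msubst_rename_Inr) simp
    then have NN: "fmul r N N i j = (if i = j then in_y W - ?u ^ (2 * k) else 0)"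
      unfolding N_def fmul_even_odd by (simp add: even_odd_def eq power_mult)
    have "fmul r P Q i j = (if i = j then in_y W - in_x ?V else 0)"
      "fmul r Q P i j = (if i = j then in_y W - in_x ?V else 0)"
      unfolding P_def Q_def fmul_scalar_mat_conj[OF ij] NN pot by simp_all
    moreover have N4: "N i j \<in> polys_in vars4"
      unfolding N_def even_odd_def
      by (intro polys_in_intros polys_in_mono[OF vars3_subset] polys_in_msubst_sq EF)
        (simp add: polys_in_Vr vars3_def)
    then have "P i j \<in> polys_in vars4" "Q i j \<in> polys_in vars4"
      unfolding P_def Q_def by (auto intro!: polys_in_intros simp: polys_in_Vr vars4_def)
    moreover have "homogeneous (wt ?V W) (\<delta> j + 1 - \<delta> i) (N i j)"
      unfolding N_def even_odd_def
    proof (rule homogeneous_add)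
      let ?w = "case_sum (\<lambda>_. 2 / of_nat k) (vdeg W)"
      \<comment> \<open>On \<open>vars3\<close> this agrees with \<open>?w\<close>, where
        \<open>Inl 0\<close> is weighed as p. Elsewhere it is the target grading, which makes
        \<open>sq_subst\<close> degree-preserving: u^2 has degree 2/k.\<close>
      let ?w' = "\<lambda>v. if v = Inl 0 then 2 / of_nat k else wt ?V W v"
      have w0: "wt ?V W (Inl 0) = 1 / of_nat k"
        unfolding V using assms(2) by (simp add: W_Fermat_def two_vars_def)
      have hm: "homogeneous (wt ?V W) s (msubst sq_subst f)" if "homogeneous ?w s f" "f \<in> polys_in vars3" for s f
      proof (rule homogeneous_msubst)
        have "wdeg ?w' m = wdeg ?w m" if "keys m \<subseteq> vars3" for m
          unfolding wdeg_def using that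
          by (intro sum.cong) (auto simp: vars3_def)
        then show "homogeneous ?w' s f"
          using that by (auto simp: homogeneous_iff polys_in_def)
        show "homogeneous (wt ?V W) (?w' v) (sq_subst v)" for v
          using w0 homogeneous_Vr[of "wt ?V W" v]
          by (auto simp: sq_subst_def intro!: homogeneous_power[OF homogeneous_Vr])
      qed
      show "homogeneous (wt ?V W) (\<delta> j + 1 - \<delta> i) (msubst sq_subst (E i j))"
        using assms(1) ij EF unfolding seed_def by (intro hm) auto
      have "homogeneous (wt ?V W) (\<delta> j + 1 - \<delta> i - 1 / of_nat k) (msubst sq_subst (F i j))"
        using assms(1) ij EF unfolding seed_def by (intro hm) auto
      then show "homogeneous (wt ?V W) (\<delta> j + 1 - \<delta> i) (?u * msubst sq_subst (F i j))"
        by (rule homogeneous_mult[OF homogeneous_Vr]) (use w0 in simp)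
    qed
    moreover have "wt ?V W (Inl 1) = 1"
      unfolding V by (simp add: W_Fermat_def two_vars_def)
    then have "homogeneous (wt ?V W) 1 ?v"
      using homogeneous_Vr[of "wt ?V W" "Inl 1"] by simp
    then have "homogeneous (wt ?V W) (\<delta> j + 1 - \<delta> i) (scalar_mat ?v i j)"
      by simp
    ultimately show "P i j \<in> polys_in vars4 \<and> Q i j \<in> polys_in vars4 \<and>
        homogeneous (wt ?V W) (\<delta> j + 1 - \<delta> i) (P i j) \<and> homogeneous (wt ?V W) (\<delta> j + 1 - \<delta> i) (Q i j) \<and>
        fmul r P Q i j = (if i = j then in_y W - in_x ?V else 0) \<and>
        fmul r Q P i j = (if i = j then in_y W - in_x ?V else 0)"
      unfolding P_def Q_def by (blast intro: homogeneous_add homogeneous_diff)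
  qed
  \<comment> \<open>The v-derivatives of \<open>P\<close> and \<open>Q\<close> are the scalars -1
    and 1, so the two halves of \<open>str4\<close> add up to twice tr(M_u M_x M_y). Its even part
    in u is the seed trace, its odd part is u times \<open>H\<close>, both taken at u^2.\<close>
  moreover obtain H where T: "str4 r P Q = Cst 2 * (msubst sq_subst ?G + ?u * msubst sq_subst H)"
  proof
    have d: "fdiff (Inl 1) P = scalar_mat (- 1)" "fdiff (Inl 1) Q = scalar_mat 1"
      using pdiff_vars3[OF polys_in_msubst_sq[OF EF(1)]] pdiff_vars3[OF polys_in_msubst_sq[OF EF(2)]]
      by (auto simp: P_def Q_def N_def even_odd_def pdiff_Vr fun_eq_iff)
    have d': "fdiff v P = fdiff v N" "fdiff v Q = fdiff v N" if "v \<noteq> Inl 1" for v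
      using that by (auto simp: P_def Q_def pdiff_Vr fun_eq_iff)
    let ?H = "ftr r (\<lambda>i j. fmul r (\<lambda>i j. F i j + 2 * ?u * fdiff (Inl 0) F i j)
        (\<lambda>i j. fmul r (fdiff (Inr 0) E) (fdiff (Inr 1) F) i j + fmul r (fdiff (Inr 0) F) (fdiff (Inr 1) E) i j) i j +
      fmul r (\<lambda>i j. 2 * fdiff (Inl 0) E i j)
        (\<lambda>i j. fmul r (fdiff (Inr 0) E) (fdiff (Inr 1) E) i j + ?u * fmul r (fdiff (Inr 0) F) (fdiff (Inr 1) F) i j) i j)"
    have "str4 r P Q = 2 * ftr r (fmul r (fdiff (Inl 0) N) (fmul r (fdiff (Inr 0) N) (fdiff (Inr 1) N)))"
      unfolding str4_def d by (simp add: d' ftr_scalar_mat)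
    also have "ftr r (fmul r (fdiff (Inl 0) N) (fmul r (fdiff (Inr 0) N) (fdiff (Inr 1) N))) =
        msubst sq_subst ?G + ?u * msubst sq_subst ?H"
      unfolding N_def fdiff_even_odd fmul_even_odd ftr_even_odd seed_trace_def
      by (simp add: ftr_add fmul_scale ftr_scale mult_ac)
    finally show "str4 r P Q = Cst 2 * (msubst sq_subst ?G + ?u * msubst sq_subst ?H)"
      by simp
  qed
  have "lookup (rename Inl (Cst (1 / (of_nat (2 * k) * of_nat 2))) * str4 r P Q) (res_mon Inl (2 * k - 2) (2 - 2)) \<noteq> 0"
  proof -
    \<comment> \<open>The exponent 2k - 2 is written so that one factor u can be split off from the
      odd part; this leaves the odd exponent 2 (k - 2) + 1, at which a polynomial in u^2 has
      coefficient zero.\<close>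
    have m: "res_mon Inl (2 * k - 2) (2 - 2) = single (Inl 0) (1 + 2 * (k - 2) + 1)"
      using assms(2) by (auto simp: res_mon_def intro!: arg_cong[of _ _ "single (Inl 0)"])
    have "lookup (?u * msubst sq_subst H) (single (Inl 0) (1 + 2 * (k - 2) + 1)) =
        lookup (msubst sq_subst H) (single (Inl 0) (2 * (k - 2) + 1))"
      using lookup_single_mult[of "single (Inl 0) 1" 1 "msubst sq_subst H" "single (Inl 0) (2 * (k - 2) + 1)"]
      by (simp add: Vr_def single_add[symmetric])
    moreover have "(1 + 2 * (k - 2) + 1) div 2 = k - 1" "even (1 + 2 * (k - 2) + 1)"
      using assms(2) by auto
    ultimately have "lookup (str4 r P Q) (res_mon Inl (2 * k - 2) (2 - 2)) = 2 * lookup ?G (single (Inl 0) (k - 1))"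
      unfolding T m lookup_Cst_mult lookup_add lookup_msubst_sq by simp
    then show ?thesis
      using assms unfolding seed_def by simp
  qed
  moreover have "lookup (rename Inr \<Delta> * str4 r P Q) (res_mon Inr a b) \<noteq> 0"
  proof -
    let ?S = "{Inr 0, Inr 1} :: (nat + nat) set"
    have "restr ?S (msubst sq_subst p) = restr ?S p" for p
      by (rule restr_msubst) (auto simp: restr_Vr sq_subst_def)
    then have "restr ?S (rename Inr \<Delta> * str4 r P Q) = restr ?S (Cst 2 * (rename Inr \<Delta> * ?G))"
      unfolding T by (simp add: restr_Vr mult_ac)
    then have "lookup (rename Inr \<Delta> * str4 r P Q) (res_mon Inr a b) =
        lookup (Cst 2 * (rename Inr \<Delta> * ?G)) (res_mon Inr a b)"
      using lookup_restr[OF Inr_vars] by metis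
    then show ?thesis
      using W(2) by (simp only: lookup_Cst_mult) simp
  qed
  moreover have "residue_data ?V (2 * k - 2) (2 - 2) (Cst (1 / (of_nat (2 * k) * of_nat 2)))"
    unfolding V using assms(2) by (intro residue_data_Fermat) auto
  ultimately show ?thesis
    unfolding strongly_equivalent_def using W(1) by blast
qed

subsection \<open>From seeds to type D\<close>

text \<open>The matrix of A + u B after restriction of scalars from u to p = u^2, in the basis 1, u:
  the columns record (A + u B) 1 = A + u B and (A + u B) u = p B + u A.\<close>

abbreviation ext2 :: "nat \<Rightarrow> (nat \<Rightarrow> nat \<Rightarrow> (nat + nat) mpol) \<Rightarrow> (nat \<Rightarrow> nat \<Rightarrow> (nat + nat) mpol) \<Rightarrow> nat \<Rightarrow> nat \<Rightarrow> (nat + nat) mpol" where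
  "ext2 r A B \<equiv> blk r A (\<lambda>i j. Vr (Inl 0) * B i j) B A"

lemma fdiff_blk: "fdiff v (blk r A B C D) = blk r (fdiff v A) (fdiff v B) (fdiff v C) (fdiff v D)"
  by (simp add: blk_def fun_eq_iff)

lemma fmul_ext2: "fmul (r + r) (ext2 r A B) (ext2 r C D) =
    ext2 r (\<lambda>i j. fmul r A C i j + Vr (Inl 0) * fmul r B D i j) (\<lambda>i j. fmul r A D i j + fmul r B C i j)"
  unfolding fmul_blk fmul_scale by (simp add: ring_distribs add.commute)

lemma ftr_fmul_cong:
  "(\<And>i j. i < n \<Longrightarrow> j < n \<Longrightarrow> A i j = A' i j) \<Longrightarrow> (\<And>i j. i < n \<Longrightarrow> j < n \<Longrightarrow> B i j = B' i j) \<Longrightarrow>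
    ftr n (fmul n A B) = ftr n (fmul n A' B')"
  unfolding ftr_def fmul_def by (intro sum.cong refl) simp

text \<open>With v = u q, the factors M - v and M + v are E + u (F - q) and E + u (F + q), so only
  the odd part changes before restricting scalars.\<close>

lemma seed_type_D:
  assumes "seed W k 1 r \<delta> E F" "k \<ge> 3"
  shows "strongly_equivalent (W_D (k + 1)) W"
proof -
  let ?p = "Vr (Inl 0) :: (nat + nat) mpol" and ?q = "Vr (Inl 1) :: (nat + nat) mpol"
  let ?V = "W_D (k + 1)" and ?G = "seed_trace r E F"
  let ?F = "\<lambda>s i j. F i j + scalar_mat s i j"
  define P where "P = ext2 r E (?F (- ?q))"
  define Q where "Q = ext2 r E (?F ?q)"
  \<comment> \<open>The second half of the basis is u times the first, hence of degree higher by
    1/k.\<close>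
  define \<epsilon> where "\<epsilon> i = (if i < r then \<delta> i else \<delta> (i - r) + 1 / of_nat k)" for i
  obtain a b \<Delta> where W: "residue_data W a b \<Delta>" "lookup (rename Inr \<Delta> * ?G) (res_mon Inr a b) \<noteq> 0"
    using assms(1) unfolding seed_def by blast
  have EF: "E i j \<in> polys_in vars3" "F i j \<in> polys_in vars3" for i j
    using assms(1) unfolding seed_def by blast+
  have vd: "wt ?V W (Inl 0) = 2 / of_nat k" "wt ?V W (Inl 1) = 1 - 1 / of_nat k"
    by (simp_all add: W_D_def two_vars_def)
  have pot: "in_x ?V = ?p ^ k + ?p * ?q ^ 2"
    by (simp add: W_D_def in_x_def two_vars_def)
  have prod: "fmul (r + r) (ext2 r E (?F s)) (ext2 r E (?F t)) i j = (if i = j then in_y W - in_x ?V else 0)"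
    if ij: "i < r + r" "j < r + r" and st: "s + t = 0" "s * t = - (?q ^ 2)" for s t i j
  proof -
    have eq: "fmul r E E i j + ?p * fmul r F F i j = (if i = j then in_y W - ?p ^ k else 0)"
      "fmul r E F i j + fmul r F E i j = 0" if "i < r" "j < r" for i j
      using assms(1) that unfolding seed_def by simp_all
    have A: "fmul r E E i j + ?p * fmul r (?F s) (?F t) i j = (if i = j then in_y W - in_x ?V else 0)"
      if ij: "i < r" "j < r" for i j
    proof -
      have "fmul r (?F s) (?F t) i j = fmul r F F i j + (s + t) * F i j + scalar_mat (s * t) i j"
        unfolding fmul_add using ij by (simp add: fmul_scalar_mat algebra_simps)
      then have "fmul r E E i j + ?p * fmul r (?F s) (?F t) i j =
          (fmul r E E i j + ?p * fmul r F F i j) + ?p * scalar_mat (s * t) i j"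
        unfolding st(1) by (simp add: algebra_simps)
      then show ?thesis
        unfolding eq(1)[OF ij] st(2) pot by simp
    qed
    have B: "fmul r E (?F t) i j + fmul r (?F s) E i j = 0" if ij: "i < r" "j < r" for i j
    proof -
      have "fmul r E (?F t) i j + fmul r (?F s) E i j = (fmul r E F i j + fmul r F E i j) + (s + t) * E i j"
        unfolding fmul_add using ij by (simp add: fmul_scalar_mat algebra_simps)
      then show ?thesis unfolding eq(2)[OF ij] st(1) by simp
    qed
    show ?thesis
      unfolding fmul_ext2 using ij by (auto simp: A B elim!: less_double_cases)
  qed
  have "block_mf ?V W (r + r) \<epsilon> \<epsilon> P Q"
    unfolding block_mf_def
  proof (intro allI impI)
    fix i j assume ij: "i < r + r" "j < r + r"
    have "fmul (r + r) P Q i j = (if i = j then in_y W - in_x ?V else 0)"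
      "fmul (r + r) Q P i j = (if i = j then in_y W - in_x ?V else 0)"
      unfolding P_def Q_def by (rule prod[OF ij]; simp add: power2_eq_square)+
    moreover have
      "ext2 r E (?F s) i j \<in> polys_in vars4"
      "homogeneous (wt ?V W) (\<epsilon> j + 1 - \<epsilon> i) (ext2 r E (?F s) i j)"
      if s: "s \<in> polys_in vars4" "homogeneous (wt ?V W) (1 - 1 / of_nat k) s" for s
    proof -
      let ?w = "case_sum (\<lambda>_. 2 / of_nat k) (vdeg W)"
      have hm: "homogeneous (wt ?V W) t f" if "homogeneous ?w t f" "f \<in> polys_in vars3" for t f
      proof -
        have "wdeg (wt ?V W) m = wdeg ?w m" if "keys m \<subseteq> vars3" for m
        proof -
          have "wt ?V W v = ?w v" if "v \<in> vars3" for v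
            using that vd(1) by (auto simp: vars3_def)
          then show ?thesis
            unfolding wdeg_def using that by (intro sum.cong) auto
        qed
        then show ?thesis
          using that by (auto simp: homogeneous_iff polys_in_def)
      qed
      have E4: "E i j \<in> polys_in vars4" "?F s i j \<in> polys_in vars4" for i j
        using EF polys_in_mono[OF vars3_subset] s(1) by (auto intro!: polys_in_add)
      have p4: "?p \<in> polys_in vars4"
        by (simp add: polys_in_Vr vars4_def)
      show "ext2 r E (?F s) i j \<in> polys_in vars4"
        unfolding blk_def
        by (cases "i < r"; cases "j < r"; simp only: if_True if_False E4 polys_in_mult[OF p4 E4(2)])
      have hE: "homogeneous (wt ?V W) (\<delta> j + 1 - \<delta> i) (E i j)" if "i < r" "j < r" for i j
        using assms(1) that EF unfolding seed_def by (intro hm) auto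
      have hF: "homogeneous (wt ?V W) (\<delta> j + 1 - \<delta> i - 1 / of_nat k) (?F s i j)" if "i < r" "j < r" for i j
      proof (rule homogeneous_add)
        show "homogeneous (wt ?V W) (\<delta> j + 1 - \<delta> i - 1 / of_nat k) (F i j)"
          using assms(1) that EF unfolding seed_def by (intro hm) auto
        show "homogeneous (wt ?V W) (\<delta> j + 1 - \<delta> i - 1 / of_nat k) (scalar_mat s i j)"
          using s(2) by simp
      qed
      have hpF: "homogeneous (wt ?V W) (\<delta> j + 1 - \<delta> i + 1 / of_nat k) (?p * ?F s i j)" if "i < r" "j < r" for i j
        by (rule homogeneous_mult[OF homogeneous_Vr hF[OF that]]) (use vd(1) in simp)
      from ij(1) show "homogeneous (wt ?V W) (\<epsilon> j + 1 - \<epsilon> i) (ext2 r E (?F s) i j)"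
      proof (rule less_double_cases)
        assume i: "i < r"
        from ij(2) show ?thesis
        proof (rule less_double_cases)
          assume "j < r"
          then show ?thesis using hE[OF i] i by (simp add: \<epsilon>_def)
        next
          fix j' assume j: "j = r + j'" "j' < r"
          have e: "\<epsilon> j + 1 - \<epsilon> i = \<delta> j' + 1 - \<delta> i + 1 / of_nat k"
            using i j by (simp add: \<epsilon>_def)
          show ?thesis unfolding e using hpF[OF i j(2)] i j by simp
        qed
      next
        fix i' assume i: "i = r + i'" "i' < r"
        from ij(2) show ?thesis
        proof (rule less_double_cases)
          assume j: "j < r"
          have e: "\<epsilon> j + 1 - \<epsilon> i = \<delta> j + 1 - \<delta> i' - 1 / of_nat k"
            using i j by (simp add: \<epsilon>_def)
          show ?thesis unfolding e using hF[OF i(2) j] i j by simp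
        next
          fix j' assume j: "j = r + j'" "j' < r"
          have e: "\<epsilon> j + 1 - \<epsilon> i = \<delta> j' + 1 - \<delta> i'"
            using i j by (simp add: \<epsilon>_def)
          show ?thesis unfolding e using hE[OF i(2) j(2)] i j by simp
        qed
      qed
    qed
    moreover have "?q \<in> polys_in vars4" "- ?q \<in> polys_in vars4"
      by (auto intro!: polys_in_uminus simp: polys_in_Vr vars4_def)
    moreover have "homogeneous (wt ?V W) (1 - 1 / of_nat k) ?q" "homogeneous (wt ?V W) (1 - 1 / of_nat k) (- ?q)"
      using homogeneous_Vr[of "wt ?V W" "Inl 1"] unfolding vd(2) by (auto intro: homogeneous_uminus)
    ultimately show "P i j \<in> polys_in vars4 \<and> Q i j \<in> polys_in vars4 \<and>
        homogeneous (wt ?V W) (\<epsilon> j + 1 - \<epsilon> i) (P i j) \<and> homogeneous (wt ?V W) (\<epsilon> j + 1 - \<epsilon> i) (Q i j) \<and>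
        fmul (r + r) P Q i j = (if i = j then in_y W - in_x ?V else 0) \<and>
        fmul (r + r) Q P i j = (if i = j then in_y W - in_x ?V else 0)"
      unfolding P_def Q_def by blast
  qed
  moreover have T: "str4 (r + r) P Q = Cst 2 * ?G"
  proof -
    let ?A = "\<lambda>i j. fmul r (fdiff (Inr 0) E) (fdiff (Inr 1) E) i j + ?p * fmul r (fdiff (Inr 0) F) (fdiff (Inr 1) F) i j"
    let ?B = "\<lambda>i j. fmul r (fdiff (Inr 0) E) (fdiff (Inr 1) F) i j + fmul r (fdiff (Inr 0) F) (fdiff (Inr 1) E) i j"
    let ?E' = "fdiff (Inl 0) E" and ?F' = "fdiff (Inl 0) F"
    have dq: "fdiff (Inl 1) P = ext2 r (\<lambda>i j. 0) (scalar_mat (- 1))" "fdiff (Inl 1) Q = ext2 r (\<lambda>i j. 0) (scalar_mat 1)"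
      using pdiff_vars3[OF EF(1)] pdiff_vars3[OF EF(2)]
      by (auto simp: P_def Q_def blk_def pdiff_Vr fun_eq_iff)
    have dr: "fdiff (Inr v) P = ext2 r (fdiff (Inr v) E) (fdiff (Inr v) F)"
      "fdiff (Inr v) Q = ext2 r (fdiff (Inr v) E) (fdiff (Inr v) F)" for v
      by (auto simp: P_def Q_def blk_def pdiff_Vr fun_eq_iff)
    have dp: "fdiff (Inl 0) P = blk r ?E' (\<lambda>i j. ?F (- ?q) i j + ?p * ?F' i j) ?F' ?E'"
      "fdiff (Inl 0) Q = blk r ?E' (\<lambda>i j. ?F ?q i j + ?p * ?F' i j) ?F' ?E'"
      by (auto simp: P_def Q_def blk_def pdiff_Vr fun_eq_iff)
    \<comment> \<open>The p-derivative also hits the factor p in the upper right block, which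
      produces the coefficient 2 p in the seed trace. The term linear in \<open>s\<close> cancels
      between the two halves of \<open>str4\<close>, where (\<open>s\<close>, \<open>t\<close>) is
      (-q, 1) and (q, -1).\<close>
    have half: "ftr (r + r) (fmul (r + r) (blk r ?E' (\<lambda>i j. ?F s i j + ?p * ?F' i j) ?F' ?E')
        (fmul (r + r) (ext2 r (\<lambda>i j. 0) (scalar_mat t)) (ext2 r ?A ?B))) =
        t * (ftr r (fmul r (\<lambda>i j. F i j + 2 * ?p * ?F' i j) ?A) + 2 * ?p * ftr r (fmul r ?E' ?B) + s * ftr r ?A)" for s t
    proof -
      have "ftr (r + r) (fmul (r + r) (blk r ?E' (\<lambda>i j. ?F s i j + ?p * ?F' i j) ?F' ?E')
        (fmul (r + r) (ext2 r (\<lambda>i j. 0) (scalar_mat t)) (ext2 r ?A ?B))) =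
        ftr (r + r) (fmul (r + r) (blk r ?E' (\<lambda>i j. ?F s i j + ?p * ?F' i j) ?F' ?E')
        (blk r (\<lambda>i j. t * (?p * ?B i j)) (\<lambda>i j. t * (?p * ?A i j)) (\<lambda>i j. t * ?A i j) (\<lambda>i j. t * (?p * ?B i j))))"
        unfolding fmul_ext2 fmul_0
        by (intro ftr_fmul_cong refl) (auto simp: fmul_scalar_mat mult_ac elim!: less_double_cases)
      moreover have "ftr r (fmul r (scalar_mat s) ?A) = s * ftr r ?A"
        unfolding ftr_scale[symmetric] unfolding ftr_def by (intro sum.cong refl) (simp add: fmul_scalar_mat)
      ultimately show ?thesis
        unfolding fmul_blk ftr_blk ftr_add fmul_scale ftr_scale fmul_add(1)
        by (simp add: algebra_simps)
    qed
    show ?thesis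
      unfolding str4_def dp dq dr fmul_ext2[of r "fdiff (Inr 0) E"] half seed_trace_def
      by (simp add: algebra_simps)
  qed
  moreover have "lookup (rename Inl (Cst (- 1 / 2) * Vr 0 ^ (k - 1) + Cst (1 / (2 * of_nat k)) * Vr 1 ^ 2) * str4 (r + r) P Q)
      (res_mon Inl (k - 1) 2) \<noteq> 0"
  proof -
    have G: "?G \<in> polys_in vars3"
      unfolding seed_trace_def ftr_def fmul_def
      by (intro polys_in_intros pdiff_polys_in EF polys_in_numeral) (auto simp: polys_in_Vr vars3_def)
    have m: "res_mon Inl (k - 1) 2 = single (Inl 0) (k - 1) + single (Inl 1) 2"
      by (simp add: res_mon_def)
    \<comment> \<open>The term of \<open>\<Delta>\<close> with p^(k-1) would need q^2 from the seed
      trace, in which q does not occur; only the term with q^2 contributes.\<close>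
    have "lookup ?G (single (Inl 1) 2) = 0"
      by (rule lookup_polys_in[OF G]) (auto simp: vars3_def)
    then have 1: "lookup (?p ^ (k - 1) * ?G) (res_mon Inl (k - 1) 2) = 0"
      unfolding m Vr_power lookup_single_mult by simp
    have 2: "lookup (?q ^ 2 * ?G) (res_mon Inl (k - 1) 2) = lookup ?G (single (Inl 0) (k - 1))"
      unfolding m Vr_power add.commute[of "single (Inl 0) (k - 1)"] lookup_single_mult by simp
    have "rename Inl (Cst (- 1 / 2) * Vr 0 ^ (k - 1) + Cst (1 / (2 * of_nat k)) * Vr 1 ^ 2) * str4 (r + r) P Q =
        Cst (- 1 / 2) * (Cst 2 * (?p ^ (k - 1) * ?G)) + Cst (1 / (2 * of_nat k)) * (Cst 2 * (?q ^ 2 * ?G))"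
      unfolding T by (simp add: ring_distribs mult_ac)
    then have "lookup (rename Inl (Cst (- 1 / 2) * Vr 0 ^ (k - 1) + Cst (1 / (2 * of_nat k)) * Vr 1 ^ 2) * str4 (r + r) P Q)
        (res_mon Inl (k - 1) 2) = 1 / of_nat k * lookup ?G (single (Inl 0) (k - 1))"
      by (simp only: lookup_add lookup_Cst_mult 1 2) simp
    then show ?thesis
      using assms unfolding seed_def by simp
  qed
  moreover have "lookup (rename Inr \<Delta> * str4 (r + r) P Q) (res_mon Inr a b) \<noteq> 0"
  proof -
    have "rename Inr \<Delta> * str4 (r + r) P Q = Cst 2 * (rename Inr \<Delta> * ?G)"
      unfolding T by (rule mult.left_commute)
    then show ?thesis
      using W(2) by (simp only: lookup_Cst_mult) simp
  qed
  ultimately show ?thesis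
    unfolding strongly_equivalent_def using W(1) residue_data_D[OF assms(2)] by blast
qed

lemma seed_equivalent:
  assumes "seed W k c r \<delta> E F" "c \<noteq> 0" "k \<ge> 3"
  shows "strongly_equivalent (W_A (2 * k - 1)) W" "strongly_equivalent (W_D (k + 1)) W"
proof -
  obtain E' F' where "seed W k 1 r \<delta> E' F'"
    using seed_normalise[OF assms(1,2)] assms(3) by auto
  then show "strongly_equivalent (W_A (2 * k - 1)) W" "strongly_equivalent (W_D (k + 1)) W"
    using seed_type_A seed_type_D assms(3) by auto
qed

section \<open>Traceless 2 by 2 square roots for D, E6 and E7\<close>

section \<open>Seeds of rank one\<close>

lemma m22_lin:
  "(\<lambda>i j. m22 a b c d i j + m22 a' b' c' d' i j) = m22 (a + a') (b + b') (c + c') (d + d')"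
  "(\<lambda>i j. m22 a b c d i j + x * m22 a' b' c' d' i j) =
    m22 (a + x * a') (b + x * b') (c + x * c') (d + x * d')"
  "(\<lambda>i j. m22 a b c d i j + x * pdiff v (m22 a'' b'' c'' d'' i j)) =
    m22 (a + x * pdiff v a'') (b + x * pdiff v b'') (c + x * pdiff v c'') (d + x * pdiff v d'')"
  by (simp_all add: m22_def fun_eq_iff)

lemma seed_trace_m22: "seed_trace 2 (m22 a b c d) (m22 a' b' c' d') =
    (let p = Vr (Inl 0); D = pdiff (Inl 0); X = pdiff (Inr 0); Y = pdiff (Inr 1) in
     (a' + 2 * p * D a') * (X a * Y a + X b * Y c + p * (X a' * Y a' + X b' * Y c')) +
     (b' + 2 * p * D b') * (X c * Y a + X d * Y c + p * (X c' * Y a' + X d' * Y c')) +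
     ((c' + 2 * p * D c') * (X a * Y b + X b * Y d + p * (X a' * Y b' + X b' * Y d')) +
      (d' + 2 * p * D d') * (X c * Y b + X d * Y d + p * (X c' * Y b' + X d' * Y d'))) +
     2 * p * (D a * (X a * Y a' + X b * Y c' + (X a' * Y a + X b' * Y c)) +
       D b * (X c * Y a' + X d * Y c' + (X c' * Y a + X d' * Y c)) +
      (D c * (X a * Y b' + X b * Y d' + (X a' * Y b + X b' * Y d)) +
       D d * (X c * Y b' + X d * Y d' + (X c' * Y b + X d' * Y d)))))"
  unfolding seed_trace_def Let_def fdiff_m22 fmul_m22 m22_lin ftr_m22 by simp

text \<open>A traceless 2 by 2 matrix has scalar square by Cayley-Hamilton, so the matrix equation
  reduces to two scalar ones, the even and odd parts in u of minus the determinant.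
  \<open>\<beta>\<close> is the degree of the upper right entry.\<close>

lemma seed_m22:
  assumes "{a, b, c, a', b', c'} \<subseteq> polys_in vars3"
    and "w = case_sum (\<lambda>_. 2 / of_nat k) (vdeg W)"
    and "homogeneous w 1 a" "homogeneous w \<beta> b" "homogeneous w (2 - \<beta>) c"
    and "homogeneous w (1 - 1 / of_nat k) a'" "homogeneous w (\<beta> - 1 / of_nat k) b'"
      "homogeneous w (2 - \<beta> - 1 / of_nat k) c'"
    and "a * a + b * c + Vr (Inl 0) * (a' * a' + b' * c') = in_y W - Cst t * Vr (Inl 0) ^ k"
    and "2 * (a * a') + b * c' + b' * c = 0"
    and "lookup (seed_trace 2 (m22 a b c (- a)) (m22 a' b' c' (- a'))) (single (Inl 0) (k - 1)) \<noteq> 0"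
    and "residue_data W i j \<Delta>"
      "lookup (rename Inr \<Delta> * seed_trace 2 (m22 a b c (- a)) (m22 a' b' c' (- a'))) (res_mon Inr i j) \<noteq> 0"
  shows "seed W k t 2 (\<lambda>i. if i = 0 then 0 else \<beta> - 1) (m22 a b c (- a)) (m22 a' b' c' (- a'))"
  unfolding seed_def
proof (intro conjI allI impI exI)
  show "m22 a b c (- a) i j \<in> polys_in vars3" "m22 a' b' c' (- a') i j \<in> polys_in vars3" for i j
    using assms(1) by (auto simp: m22_def intro: polys_in_uminus)
  fix i j :: nat assume ij: "i < 2" "j < 2"
  then show "homogeneous (case_sum (\<lambda>_. 2 / of_nat k) (vdeg W))
      ((if j = 0 then 0 else \<beta> - 1) + 1 - (if i = 0 then 0 else \<beta> - 1)) (m22 a b c (- a) i j)"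
    "homogeneous (case_sum (\<lambda>_. 2 / of_nat k) (vdeg W))
      ((if j = 0 then 0 else \<beta> - 1) + 1 - (if i = 0 then 0 else \<beta> - 1) - 1 / of_nat k) (m22 a' b' c' (- a') i j)"
    using assms(3-8) unfolding assms(2)[symmetric]
    by (auto simp: m22_def algebra_simps intro: homogeneous_uminus)
  show "fmul 2 (m22 a b c (- a)) (m22 a b c (- a)) i j +
      Vr (Inl 0) * fmul 2 (m22 a' b' c' (- a')) (m22 a' b' c' (- a')) i j =
      (if i = j then in_y W - Cst t * Vr (Inl 0) ^ k else 0)"
    using ij unfolding fmul_m22 assms(9)[symmetric]
    by (auto simp: m22_def less_2_cases_iff algebra_simps)
  show "fmul 2 (m22 a b c (- a)) (m22 a' b' c' (- a')) i j + fmul 2 (m22 a' b' c' (- a')) (m22 a b c (- a)) i j = 0"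
    using ij assms(10) unfolding fmul_m22
    by (auto simp: m22_def less_2_cases_iff algebra_simps)
qed (rule assms)+

lemma homogeneous_CstI: "q = 0 \<Longrightarrow> homogeneous w q (Cst c)"
  by (simp add: homogeneous_Cst)

lemma homogeneous_numeral: "q = 0 \<Longrightarrow> homogeneous w q (numeral n)"
  using homogeneous_Cst[of w "numeral n"] by simp

lemma homogeneous_VrI: "q = w v \<Longrightarrow> homogeneous w q (Vr v)"
  by (simp add: homogeneous_Vr)

lemmas homogeneous_intros = homogeneous_add homogeneous_diff homogeneous_uminus homogeneous_mult
  homogeneous_power homogeneous_0 homogeneous_CstI homogeneous_numeral homogeneous_VrI

lemma lookup_restr_power:
  assumes "restr {v} p = Cst c * Vr v ^ n"
  shows "lookup p (single v n) = c"
proof -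
  have "lookup p (single v n) = lookup (restr {v} p) (single v n)"
    by (rule lookup_restr[symmetric]) auto
  then show ?thesis
    unfolding assms by (simp add: Vr_power)
qed

lemma lookup_restr_res_mon:
  assumes "restr {Inr 0, Inr 1} p = q"
  shows "lookup p (res_mon Inr i j) = lookup q (res_mon Inr i j)"
  unfolding assms[symmetric] by (rule lookup_restr[OF Inr_vars, symmetric])

lemma lookup_Inr_monomial:
  "lookup (Vr (Inr 0) ^ i * Vr (Inr 1) ^ j :: (nat + nat) mpol) (res_mon Inr a b) = (if i = a \<and> j = b then 1 else 0)"
  by (rule lookup_monomial) simp

subsection \<open>Type D\<close>

text \<open>On the section x = u^2 the difference W - u^(2k) is (u y)^2, so the diagonal entries are
  u y and -u y and the off-diagonal ones are x - u^2 and its cofactor.\<close>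

lemma seed_D:
  assumes "k \<ge> 3"
  shows "\<exists>\<delta> E F. seed (W_D (k + 1)) k 1 2 \<delta> E F"
proof -
  let ?p = "Vr (Inl 0) :: (nat + nat) mpol" and ?x = "Vr (Inr 0) :: (nat + nat) mpol" and ?y = "Vr (Inr 1) :: (nat + nat) mpol"
  let ?h = "hs k ?p ?x"
  let ?T = "seed_trace 2 (m22 0 (?x - ?p) (?h + ?y ^ 2) (- 0)) (m22 ?y 0 0 (- ?y))"
  have "pdiff (Inr 1) ?h = 0"
    by (rule pdiff_polys_in_notin[OF polys_in_hs[of _ "{Inl 0, Inr 0}"]]) (auto simp: polys_in_Vr)
  then have T: "?T = 2 * ?y ^ 2 - 2 * ?p * (pdiff (Inl 0) ?h + pdiff (Inr 0) ?h)"
    unfolding seed_trace_m22 Let_def by (simp add: pdiff_Vr pdiff_power algebra_simps power2_eq_square)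
  have pot: "in_y (W_D (k + 1)) = ?x ^ k + ?x * ?y ^ 2"
    by (simp add: in_y_def W_D_def two_vars_def)
  have w: "vdeg (W_D (k + 1)) = (\<lambda>i. if i = 0 then 2 / of_nat k else 1 - 1 / of_nat k)"
    by (simp add: W_D_def two_vars_def)
  have k: "k - 1 = Suc (k - 2)" using assms by simp
  have "seed (W_D (k + 1)) k 1 2 (\<lambda>i. if i = 0 then 0 else 2 / of_nat k - 1)
      (m22 0 (?x - ?p) (?h + ?y ^ 2) (- 0)) (m22 ?y 0 0 (- ?y))"
  proof (rule seed_m22[OF _ refl])
    show "{0, ?x - ?p, ?h + ?y ^ 2, ?y, 0, 0} \<subseteq> polys_in vars3"
      by (auto simp: polys_in_Vr vars3_def intro!: polys_in_intros polys_in_hs)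
    let ?w = "case_sum (\<lambda>_. 2 / of_nat k) (vdeg (W_D (k + 1)))"
    have hp: "homogeneous ?w (2 / of_nat k) ?p" "homogeneous ?w (2 / of_nat k) ?x" "homogeneous ?w (1 - 1 / of_nat k) ?y"
      by (rule homogeneous_VrI; simp add: W_D_def two_vars_def)+
    show "homogeneous ?w (2 / of_nat k) (?x - ?p)"
      by (intro homogeneous_diff hp)
    have "homogeneous ?w (2 - 2 / of_nat k) ?h"
      by (rule homogeneous_hs[OF hp(1,2)]) (use assms in \<open>simp add: field_simps\<close>)
    then show "homogeneous ?w (2 - 2 / of_nat k) (?h + ?y ^ 2)"
      by (rule homogeneous_add[OF _ homogeneous_power[OF hp(3)]]) simp
    show "homogeneous ?w (1 - 1 / of_nat k) ?y" by (rule hp)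
    have "0 * 0 + (?x - ?p) * (?h + ?y ^ 2) + ?p * (?y * ?y + 0 * 0) = (?x - ?p) * ?h + ?x * ?y ^ 2"
      by (simp add: algebra_simps power2_eq_square)
    then show "0 * 0 + (?x - ?p) * (?h + ?y ^ 2) + ?p * (?y * ?y + 0 * 0) = in_y (W_D (k + 1)) - Cst 1 * ?p ^ k"
      unfolding pot hs_mult_diff by simp
    have "restr {Inl 0} (pdiff (Inl 0) ?h + pdiff (Inr 0) ?h) = of_nat k * ?p ^ (k - 2)"
      using restr_diff_hs[of "Inr 0 :: nat + nat" "{Inl 0}" "Inl 0" k] assms
      unfolding hs_commute[of k ?x ?p] by (simp add: add.commute del: restr_hom)
    then have "restr {Inl 0} ?T = Cst (- 2 * of_nat k) * ?p ^ (k - 1)"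
      unfolding T k power_Suc restr_hom(2,3)[of _ "_ * _"] 
      by (simp add: restr_Vr Cst_mult Cst_uminus mult_ac del: restr_hom(1))
    then have "lookup ?T (single (Inl 0) (k - 1)) = - 2 * of_nat k"
      by (rule lookup_restr_power)
    then show "lookup ?T (single (Inl 0) (k - 1)) \<noteq> 0"
      using assms by simp
    show "residue_data (W_D (k + 1)) (k - 1) 2
        (Cst (- 1 / 2) * Vr 0 ^ (k - 1) + Cst (1 / (2 * of_nat k)) * Vr 1 ^ 2)"
      by (rule residue_data_D[OF assms])
    let ?R = "rename Inr (Cst (- 1 / 2) * Vr 0 ^ (k - 1) + Cst (1 / (2 * of_nat k)) * Vr 1 ^ 2) * ?T"
    have "restr {Inr 0, Inr 1} ?R = Cst (- 1 / 2) * (Cst 2 * (?x ^ (k - 1) * ?y ^ 2)) +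
        Cst (1 / (2 * of_nat k)) * (Cst 2 * (?x ^ 0 * ?y ^ 4))"
      unfolding T by (simp add: restr_Vr algebra_simps power2_eq_square eval_nat_numeral)
    then have "lookup ?R (res_mon Inr (k - 1) 2) = - 1"
      by (subst lookup_restr_res_mon, assumption)
        (simp only: lookup_add lookup_Cst_mult lookup_Inr_monomial, simp)
    then show "lookup ?R (res_mon Inr (k - 1) 2) \<noteq> 0" by simp
  qed simp_all
  then show ?thesis by blast
qed

subsection \<open>Type E6\<close>

lemmas Cst_fold = Cst_numeral[symmetric] Cst_1[symmetric] Cst_add[symmetric] Cst_diff[symmetric]
  Cst_mult[symmetric] Cst_uminus[symmetric] Cst_power[symmetric]

lemma complex_poly_root:
  fixes p :: "complex poly"
  assumes "degree p > 0"
  obtains z where "poly p z = 0"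
  using alg_closed_imp_poly_has_root[OF assms] by blast

text \<open>On the section \<open>x = 2 n u\<^sup>4 + 2 y u\<close>, the polynomial \<open>x\<^sup>3 + y\<^sup>4 - c u\<^sup>1\<^sup>2\<close> is a square for
  suitable \<open>c\<close> if and only if \<open>3 n\<^sup>2 - 12 n + 8 = 0\<close>.\<close>

lemma seed_E6: "\<exists>c \<delta> E F. c \<noteq> 0 \<and> seed W_E6 6 c 2 \<delta> E F"
proof -
  obtain z :: complex where z: "3 * z ^ 2 - 12 * z + 8 = 0"
    by (rule complex_poly_root[of "[:8, - 12, 3:]"]) (auto simp: algebra_simps power2_eq_square)
  let ?p = "Vr (Inl 0) :: (nat + nat) mpol" and ?x = "Vr (Inr 0) :: (nat + nat) mpol" and ?y = "Vr (Inr 1) :: (nat + nat) mpol"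
  have "z \<noteq> 0" using z by auto
  \<comment> \<open>The factor 9 z - 8 occurs both in c and in the coefficient of the trace; the
    identity makes it a unit modulo the quadratic equation.\<close>
  moreover have "(9 * z - 8) * (9 * z - 28) = 27 * (3 * z ^ 2 - 12 * z + 8) + 8"
    by (simp add: algebra_simps power2_eq_square)
  then have "9 * z - 8 \<noteq> 0" unfolding z by auto
  ultimately have nz: "24 * z ^ 2 * (9 * z - 8) \<noteq> 0" by simp
  define n :: "(nat + nat) mpol" where "n = Cst z"
  have n: "3 * n ^ 2 - 12 * n + 8 = 0"
    unfolding n_def by (simp only: Cst_fold z Cst_0)
  \<comment> \<open>With the section s = 2 n u^4 + 2 y u, these are the even and odd parts in u of v
    = y^2 + 4 y u^3 + 3 n^2 u^6, of x - s, and of x^2 + x s + s^2. The form of v is forced by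
    comparing s^3 + y^4 - c u^12 with v^2.\<close>
  let ?a = "?y ^ 2 + 3 * n ^ 2 * ?p ^ 3" and ?b = "?x - 2 * n * ?p ^ 2"
    and ?c = "?x ^ 2 + 2 * n * ?x * ?p ^ 2 + 4 * n ^ 2 * ?p ^ 4 + 4 * ?y ^ 2 * ?p"
    and ?a' = "4 * ?y * ?p" and ?b' = "- 2 * ?y" and ?c' = "2 * ?x * ?y + 8 * n * ?y * ?p ^ 2"
  let ?T = "seed_trace 2 (m22 ?a ?b ?c (- ?a)) (m22 ?a' ?b' ?c' (- ?a'))"
  have pn: "pdiff v n = 0" "restr S n = n" for v S
    by (simp_all add: n_def)
  have W: "W_E6 = W_Fermat 3 4" by (rule W_E6_eq_Fermat)
  have pot: "in_y W_E6 = ?x ^ 3 + ?y ^ 4"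
    by (simp add: in_y_def W_E6_def two_vars_def)
  have w: "vdeg W_E6 = (\<lambda>i. if i = 0 then 2 / 3 else 1 / 2)"
    by (simp add: W_E6_def two_vars_def)
  have "seed W_E6 6 (8 * z ^ 3 - 9 * z ^ 4) 2 (\<lambda>i. if i = 0 then 0 else 2 / 3 - 1)
      (m22 ?a ?b ?c (- ?a)) (m22 ?a' ?b' ?c' (- ?a'))"
  proof (rule seed_m22[OF _ refl])
    show "{?a, ?b, ?c, ?a', ?b', ?c'} \<subseteq> polys_in vars3"
      by (auto simp: polys_in_Vr vars3_def n_def intro!: polys_in_intros)
    let ?w = "case_sum (\<lambda>_. 2 / of_nat 6) (vdeg W_E6)"
    show "homogeneous ?w 1 ?a" "homogeneous ?w (2 / 3) ?b" "homogeneous ?w (2 - 2 / 3) ?c"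
      "homogeneous ?w (1 - 1 / of_nat 6) ?a'" "homogeneous ?w (2 / 3 - 1 / of_nat 6) ?b'"
      "homogeneous ?w (2 - 2 / 3 - 1 / of_nat 6) ?c'"
      unfolding n_def by ((rule refl | rule homogeneous_intros | simp add: w)+)
    have "?a * ?a + ?b * ?c + ?p * (?a' * ?a' + ?b' * ?c') =
        ?x ^ 3 + ?y ^ 4 - (8 * n ^ 3 - 9 * n ^ 4) * ?p ^ 6 + 2 * (3 * n ^ 2 - 12 * n + 8) * (?y ^ 2 * ?p ^ 3)"
      by (simp add: algebra_simps eval_nat_numeral)
    also have "8 * n ^ 3 - 9 * n ^ 4 = Cst (8 * z ^ 3 - 9 * z ^ 4)"
      unfolding n_def by (simp only: Cst_fold)
    finally show "?a * ?a + ?b * ?c + ?p * (?a' * ?a' + ?b' * ?c') =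
        in_y W_E6 - Cst (8 * z ^ 3 - 9 * z ^ 4) * ?p ^ 6"
      unfolding n pot by simp
    show "2 * (?a * ?a') + ?b * ?c' + ?b' * ?c = 0"
      by (simp add: algebra_simps eval_nat_numeral)
    have "restr {Inl 0} ?T = 24 * n ^ 2 * (9 * n - 8) * ?p ^ 5"
      unfolding seed_trace_m22 Let_def
      by (simp add: pdiff_Vr pdiff_power pn restr_Vr algebra_simps eval_nat_numeral)
    also have "24 * n ^ 2 * (9 * n - 8) = Cst (24 * z ^ 2 * (9 * z - 8))"
      unfolding n_def by (simp only: Cst_fold)
    finally have "lookup ?T (single (Inl 0) 5) = 24 * z ^ 2 * (9 * z - 8)"
      by (rule lookup_restr_power)
    then show "lookup ?T (single (Inl 0) (6 - 1)) \<noteq> 0"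
      using nz by simp
    show "residue_data W_E6 (3 - 2) (4 - 2) (Cst (1 / (of_nat 3 * of_nat 4)))"
      unfolding W by (rule residue_data_Fermat) simp_all
    let ?R = "rename Inr (Cst (1 / (of_nat 3 * of_nat 4))) * ?T"
    have "restr {Inr 0, Inr 1} ?T = Cst (- 12) * (?x ^ 1 * ?y ^ 2)"
      unfolding seed_trace_m22 Let_def
      by (simp add: pdiff_Vr pdiff_power pn restr_Vr Cst_uminus algebra_simps eval_nat_numeral)
    then have "restr {Inr 0, Inr 1} ?R = Cst (1 / (of_nat 3 * of_nat 4)) * (Cst (- 12) * (?x ^ 1 * ?y ^ 2))"
      by (simp only: restr_hom rename_hom)
    then have "lookup ?R (res_mon Inr (3 - 2) (4 - 2)) = - 1"
      by (subst lookup_restr_res_mon, assumption)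
        (simp only: lookup_add lookup_Cst_mult lookup_Inr_monomial, simp)
    then show "lookup ?R (res_mon Inr (3 - 2) (4 - 2)) \<noteq> 0"
      by simp
  qed
  moreover have "8 * z ^ 3 - 9 * z ^ 4 = - (z * (z ^ 2 * (9 * z - 8)))"
    by (simp add: algebra_simps eval_nat_numeral)
  then have "8 * z ^ 3 - 9 * z ^ 4 \<noteq> 0"
    using nz by simp
  ultimately show ?thesis by blast
qed

subsection \<open>Type E7\<close>

text \<open>Here the section is \<open>x = y u\<^sup>2 + g u\<^sup>6\<close> with \<open>g = 2 e - 1\<close>, and
  \<open>v = u (y\<^sup>2 + e y u\<^sup>4 + f u\<^sup>8)\<close>.\<close>

lemma seed_E7: "\<exists>c \<delta> E F. c \<noteq> 0 \<and> seed W_E7 9 c 2 \<delta> E F"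
proof -
  \<comment> \<open>Comparing W - c u^18 on the section with v^2, the terms y^3 u^6 and y^2 u^10
    determine g and f from e; the term y u^14 then becomes this cubic, and the term without y gives
    c.\<close>
  obtain e :: complex where e: "e ^ 3 + 6 * e ^ 2 - 9 * e + 3 = 0"
    by (rule complex_poly_root[of "[:3, - 9, 6, 1:]"]) (auto simp: algebra_simps power2_eq_square power3_eq_cube)
  define g where "g = 2 * e - 1"
  define f where "f = (6 * e - 3 - e ^ 2) / 2"
  have f: "2 * f = 6 * e - 3 - e ^ 2" by (simp add: f_def)
  have "2 * (e * f) - 3 * g ^ 2 = - (e ^ 3 + 6 * e ^ 2 - 9 * e + 3)"
    unfolding f_def g_def by (simp add: field_simps power2_eq_square power3_eq_cube)
  then have ef: "2 * (e * f) = 3 * g ^ 2"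
    unfolding e by simp
  define c where "c = g ^ 3 - f ^ 2"
  \<comment> \<open>The cofactors certify that \<open>c\<close> and \<open>g (3 f - 2 e g)\<close> are invertible modulo the cubic equation of \<open>e\<close>.\<close>
  have "c * (26220 * e ^ 2 + 172368 * e - 137056) =
      1 + (e ^ 3 + 6 * e ^ 2 - 9 * e + 3) * (148477 - 426581 * e + 284658 * e ^ 2 - 6555 * e ^ 3)"
    unfolding c_def f_def g_def by (simp add: field_simps eval_nat_numeral)
  then have c0: "c \<noteq> 0" unfolding e by auto
  have "g * (3 * f - 2 * e * g) * (52968 - 66606 * e - 10132 * e ^ 2) =
      3 + (e ^ 3 + 6 * e ^ 2 - 9 * e + 3) * (79451 - 214676 * e + 111452 * e ^ 2)"
    unfolding f_def g_def by (simp add: field_simps eval_nat_numeral)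
  then have g0: "9 * g * (3 * f - 2 * e * g) \<noteq> 0" unfolding e by auto
  let ?p = "Vr (Inl 0) :: (nat + nat) mpol" and ?x = "Vr (Inr 0) :: (nat + nat) mpol" and ?y = "Vr (Inr 1) :: (nat + nat) mpol"
  define E G F :: "(nat + nat) mpol" where "E = Cst e" and "G = Cst g" and "F = Cst f"
  have F: "2 * F = 6 * E - 3 - E ^ 2" and EF: "2 * (E * F) = 3 * G ^ 2" and G: "G = 2 * E - 1"
    unfolding E_def F_def G_def by (simp_all only: Cst_fold f ef g_def)
  let ?s = "?y * ?p + G * ?p ^ 3"
  \<comment> \<open>The off-diagonal entries are x - s and (W(x) - W(s)) / (x - s). The section is
    even in u and v is odd, so the diagonal contributes only to the odd part.\<close>
  let ?b = "?x - ?s" and ?c = "?x ^ 2 + ?x * ?s + ?s ^ 2 + ?y ^ 3" and ?a' = "?y ^ 2 + E * ?y * ?p ^ 2 + F * ?p ^ 4"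
  let ?T = "seed_trace 2 (m22 0 ?b ?c (- 0)) (m22 ?a' 0 0 (- ?a'))"
  have pn: "pdiff v E = 0" "restr S E = E" "pdiff v F = 0" "restr S F = F" "pdiff v G = 0" "restr S G = G" for v S
    by (simp_all add: E_def F_def G_def)
  have pot: "in_y W_E7 = ?x ^ 3 + ?x * ?y ^ 3"
    by (simp add: in_y_def W_E7_def two_vars_def)
  have w: "vdeg W_E7 = (\<lambda>i. if i = 0 then 2 / 3 else 4 / 9)"
    by (simp add: W_E7_def two_vars_def)
  have "seed W_E7 9 c 2 (\<lambda>i. if i = 0 then 0 else 2 / 3 - 1)
      (m22 0 ?b ?c (- 0)) (m22 ?a' 0 0 (- ?a'))"
  proof (rule seed_m22[OF _ refl])
    show "{0, ?b, ?c, ?a', 0, 0} \<subseteq> polys_in vars3"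
      by (auto simp: polys_in_Vr vars3_def E_def F_def G_def intro!: polys_in_intros)
    let ?w = "case_sum (\<lambda>_. 2 / of_nat 9) (vdeg W_E7)"
    show "homogeneous ?w (2 / 3) ?b" "homogeneous ?w (2 - 2 / 3) ?c" "homogeneous ?w (1 - 1 / of_nat 9) ?a'"
      unfolding E_def F_def G_def by ((rule refl | rule homogeneous_intros | simp add: w)+)
    have "0 * 0 + ?b * ?c + ?p * (?a' * ?a' + 0 * 0) = ?x ^ 3 + ?x * ?y ^ 3 - (G ^ 3 - F ^ 2) * ?p ^ 9 +
        (2 * E - 1 - G) * (?y ^ 3 * ?p ^ 3) + (E ^ 2 + 2 * F - 3 * G) * (?y ^ 2 * ?p ^ 5) +
        (2 * (E * F) - 3 * G ^ 2) * (?y * ?p ^ 7)"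
      by (simp add: algebra_simps eval_nat_numeral)
    also have "G ^ 3 - F ^ 2 = Cst c"
      unfolding c_def G_def F_def by (simp only: Cst_fold)
    finally show "0 * 0 + ?b * ?c + ?p * (?a' * ?a' + 0 * 0) = in_y W_E7 - Cst c * ?p ^ 9"
      unfolding F EF pot by (simp add: G)
    have "restr {Inl 0} ?T = 9 * G * (3 * F - 2 * E * G) * ?p ^ 8"
      unfolding seed_trace_m22 Let_def
      by (simp add: pdiff_Vr pdiff_power pn restr_Vr algebra_simps eval_nat_numeral)
    also have "9 * G * (3 * F - 2 * E * G) = Cst (9 * g * (3 * f - 2 * e * g))"
      unfolding E_def F_def G_def by (simp only: Cst_fold)
    finally have "lookup ?T (single (Inl 0) 8) = 9 * g * (3 * f - 2 * e * g)"
      by (rule lookup_restr_power)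
    then show "lookup ?T (single (Inl 0) (9 - 1)) \<noteq> 0"
      using g0 by simp
    let ?\<Delta> = "Cst (- 1 / 3) * Vr 0 ^ 2 + Cst (1 / 9) * Vr 1 ^ 3 :: nat mpol"
    show "residue_data W_E7 2 4 ?\<Delta>"
      by (rule residue_data_E7)
    let ?R = "rename Inr ?\<Delta> * ?T"
    have "restr {Inr 0, Inr 1} ?T = Cst 3 * ?y ^ 4"
      unfolding seed_trace_m22 Let_def
      by (simp add: pdiff_Vr pdiff_power pn restr_Vr algebra_simps eval_nat_numeral)
    then have "restr {Inr 0, Inr 1} ?R =
        Cst (- 1 / 3) * (Cst 3 * (?x ^ 2 * ?y ^ 4)) + Cst (1 / 9) * (Cst 3 * (?x ^ 0 * ?y ^ 7))"
      by (simp add: restr_Vr algebra_simps eval_nat_numeral)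
    then have "lookup ?R (res_mon Inr 2 4) = - 1"
      by (subst lookup_restr_res_mon, assumption)
        (simp only: lookup_add lookup_Cst_mult lookup_Inr_monomial, simp)
    then show "lookup ?R (res_mon Inr 2 4) \<noteq> 0"
      by simp
  qed simp_all
  then show ?thesis using c0 by blast
qed

section \<open>A 4 by 4 square root for E8\<close>

section \<open>The seed of type E8\<close>

text \<open>The sections of \<open>v\<^sup>2 = x\<^sup>3 + y\<^sup>5 - c u\<^sup>3\<^sup>0\<close> have \<open>x = y\<^sup>2 / u\<^sup>2 + \<dots>\<close>, with a pole at \<open>u = 0\<close>. The
  reflexive ideal of such a section has three generators, and its first syzygy module has rank two.
  In a suitable basis, multiplication by \<open>v\<close> on that module is \<open>syz_even + u syz_odd\<close>; the square
  of this matrix is scalar for arbitrary \<open>a\<close>, \<open>b\<close>, \<open>d\<close>.\<close>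

definition syz_even :: "'a::comm_ring_1 \<Rightarrow> 'a \<Rightarrow> 'a \<Rightarrow> 'a \<Rightarrow> 'a \<Rightarrow> nat \<Rightarrow> nat \<Rightarrow> 'a" where
  "syz_even x y a b d = blk 2 (m22 0 (- x) (x * d + y * a) 0) (m22 y 0 0 y)
     (m22 (y * b - x * a) 0 0 (y * b - x * a)) (m22 0 x (- (x * d + y * a)) 0)"

definition syz_odd :: "'a::comm_ring_1 \<Rightarrow> 'a \<Rightarrow> 'a \<Rightarrow> nat \<Rightarrow> nat \<Rightarrow> 'a" where
  "syz_odd a b d = blk 2 (m22 0 0 0 a) (m22 0 (- 1) d 0)
     (m22 0 b (- (a * a + d * b)) 0) (m22 (- a) 0 0 0)"

lemma fmul_blk_4: "fmul 4 (blk 2 A B C D) (blk 2 A' B' C' D') =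
    blk 2 (\<lambda>i j. fmul 2 A A' i j + fmul 2 B C' i j) (\<lambda>i j. fmul 2 A B' i j + fmul 2 B D' i j)
      (\<lambda>i j. fmul 2 C A' i j + fmul 2 D C' i j) (\<lambda>i j. fmul 2 C B' i j + fmul 2 D D' i j)"
  using fmul_blk[of 2] by simp

lemma ftr_blk_4: "ftr 4 (blk 2 A B C D) = ftr 2 A + ftr 2 D"
  using ftr_blk[of 2] by simp

lemma blk_lin:
  "(\<lambda>i j. blk n A B C D i j + blk n A' B' C' D' i j) =
    blk n (\<lambda>i j. A i j + A' i j) (\<lambda>i j. B i j + B' i j) (\<lambda>i j. C i j + C' i j) (\<lambda>i j. D i j + D' i j)"
  "(\<lambda>i j. blk n A B C D i j + x * blk n A' B' C' D' i j) =
    blk n (\<lambda>i j. A i j + x * A' i j) (\<lambda>i j. B i j + x * B' i j) (\<lambda>i j. C i j + x * C' i j) (\<lambda>i j. D i j + x * D' i j)"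
  "(\<lambda>i j. blk n A B C D i j + x * pdiff v (blk n A'' B'' C'' D'' i j)) =
    blk n (\<lambda>i j. A i j + x * pdiff v (A'' i j)) (\<lambda>i j. B i j + x * pdiff v (B'' i j))
      (\<lambda>i j. C i j + x * pdiff v (C'' i j)) (\<lambda>i j. D i j + x * pdiff v (D'' i j))"
  by (simp_all add: blk_def fun_eq_iff)

text \<open>The scalar \<open>h\<close> is minus the determinant of the symmetric 3 by 3 matrix with
  rows (b, a, x), (a, -d, y), (x, y, p). A seed for E8 thus amounts to writing W - c p^15 as such a
  determinant.\<close>

lemma syz_square:
  "fmul 4 (syz_even x y a b d) (syz_even x y a b d) i j + p * fmul 4 (syz_odd a b d) (syz_odd a b d) i j =
    blk 2 (m22 h 0 0 h) (m22 0 0 0 0) (m22 0 0 0 0) (m22 h 0 0 h) i j"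
  if "h = p * (a * a + b * d) - x * x * d - 2 * x * y * a + y * y * b"
  unfolding syz_even_def syz_odd_def fmul_blk_4 fmul_m22 m22_lin that
  by (simp add: blk_def m22_def algebra_simps)

lemma syz_anticommute:
  "fmul 4 (syz_even x y a b d) (syz_odd a b d) i j + fmul 4 (syz_odd a b d) (syz_even x y a b d) i j = 0"
  unfolding syz_even_def syz_odd_def fmul_blk_4 fmul_m22 m22_lin
  by (simp add: blk_def m22_def algebra_simps)

text \<open>Expanded for indeterminate \<open>a\<close>, \<open>b\<close>, \<open>d\<close>, so that
  the long explicit polynomials stay out of the 4 by 4 products.\<close>

lemma seed_trace_syz:
  fixes a b d :: "(nat + nat) mpol"
  defines "p \<equiv> Vr (Inl 0)" and "x \<equiv> Vr (Inr 0)" and "y \<equiv> Vr (Inr 1)"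
    and "D \<equiv> pdiff (Inl 0)" and "X \<equiv> pdiff (Inr 0)" and "Y \<equiv> pdiff (Inr 1)"
  shows "seed_trace 4 (syz_even x y a b d) (syz_odd a b d) =
    2 * p ^ 2 * (D a * (X d * Y b - Y d * X b) - X a * (D d * Y b - Y d * D b) + Y a * (D d * X b - X d * D b)) +
    p * (a * (X d * Y b - Y d * X b) - d * (X a * Y b - Y a * X b) + b * (X a * Y d - Y a * X d)) +
    4 * p * (2 * a * D a + d * D b + b * D d) +
    2 * p * x * (2 * D a * Y d - 2 * Y a * D d - D d * X b + X d * D b) +
    2 * p * y * (2 * X a * D b - 2 * D a * X b + D d * Y b - Y d * D b) +
    x ^ 2 * (X a * Y d - Y a * X d) + x * y * (X d * Y b - Y d * X b) + y ^ 2 * (X a * Y b - Y a * X b) +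
    2 * x * (a * X a + a * Y d - d * Y a + b * X d) + 2 * y * (a * Y a - a * X b + d * Y b + b * X a) +
    4 * (a ^ 2 + d * b)"
  unfolding seed_trace_def syz_even_def syz_odd_def fdiff_blk fdiff_m22 blk_lin fmul_blk_4 fmul_m22
    m22_lin ftr_blk_4 ftr_m22
  by (simp add: p_def x_def y_def D_def X_def Y_def pdiff_Vr algebra_simps power2_eq_square)

lemma less_4_cases:
  fixes i :: nat
  assumes "i < 4"
  obtains "i = 0" | "i = 1" | "i = 2" | "i = 3"
  using assms by linarith

lemma seed_E8: "\<exists>c \<delta> E F. c \<noteq> 0 \<and> seed W_E8 15 c 4 \<delta> E F"
proof -
  obtain s :: complex where s: "5 * s ^ 4 + 5 * s ^ 3 - 5 * s ^ 2 - 5 * s - 1 = 0"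
    by (rule complex_poly_root[of "[:- 1, - 5, - 5, 5, 5:]"])
      (auto simp: algebra_simps power2_eq_square power3_eq_cube power4_eq_xxxx)
  \<comment> \<open>Comparing coefficients in \<open>syz_square\<close> with \<open>x\<^sup>3 + y\<^sup>5 - c p\<^sup>1\<^sup>5\<close> expresses everything through \<open>a1\<close> and \<open>d2\<close>;
    the quartic is a factor of the resultant of the two remaining equations.\<close>
  define a1 a2 a3 d1 d2 b1 b2 b3 b4 where "a1 = s"
    and "a2 = - 1 - 10 / 3 * s - 10 / 3 * s ^ 2 - 5 / 3 * s ^ 3"
    and "a3 = - 1 / 6 + 8 / 3 * s + 10 * s ^ 2 + 20 / 3 * s ^ 3"
    and "d1 = - 1 - 2 * s"
    and "d2 = 8 / 3 * s + 23 / 3 * s ^ 2 + 10 / 3 * s ^ 3"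
    and "b1 = - 8 / 3 * s - 20 / 3 * s ^ 2 - 10 / 3 * s ^ 3"
    and "b2 = 1 + 2 * s"
    and "b3 = 1 + 4 / 3 * s - 11 / 3 * s ^ 2 - 10 / 3 * s ^ 3"
    and "b4 = - 6 - 113 / 3 * s - 212 / 3 * s ^ 2 - 36 * s ^ 3"
  note defs = a1_def a2_def a3_def d1_def d2_def b1_def b2_def b3_def b4_def
  let ?Q = "5 * s ^ 4 + 5 * s ^ 3 - 5 * s ^ 2 - 5 * s - 1"
  have eq1: "- 1 - d1 - 2 * a1 = 0" "a1 ^ 2 - b1 - d2 = 0" "d1 + b2 = 0" "d1 - b2 - 2 * a2 + b1 = 0"
    "d2 + d1 * b2 + b3 = 0"
    unfolding defs by (simp_all add: field_simps eval_nat_numeral)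
  \<comment> \<open>The equations \<open>eq1\<close> hold for every s. The other four need the
    quartic: each left-hand side is \<open>?Q\<close> times the displayed cofactor.\<close>
  have "2 * (a1 * a2) + d2 + d1 * b1 - b3 - 2 * a3 = ?Q * (2 / 3)"
    "2 * (a1 * a3) + d2 * b1 - b4 = ?Q * (- 6 - 22 / 3 * s - 20 / 9 * s ^ 2)"
    "a2 ^ 2 + d1 * b3 + d2 * b2 + b4 = ?Q * (6 + 5 / 3 * s + 5 / 9 * s ^ 2)"
    "2 * (a2 * a3) + d1 * b4 + d2 * b3 = ?Q * (- 19 / 3 - 148 / 9 * s - 20 / 3 * s ^ 2)"
    unfolding defs by (simp_all add: field_simps eval_nat_numeral)
  then have eq2: "2 * (a1 * a2) + d2 + d1 * b1 - b3 - 2 * a3 = 0" "2 * (a1 * a3) + d2 * b1 - b4 = 0"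
    "a2 ^ 2 + d1 * b3 + d2 * b2 + b4 = 0" "2 * (a2 * a3) + d1 * b4 + d2 * b3 = 0"
    unfolding s by simp_all
  define c where "c = - (a3 ^ 2 + d2 * b4)"
  \<comment> \<open>As for E7, the cofactors certify invertibility modulo the equation of \<open>s\<close>.\<close>
  have "c * (- 339018644100 - 902379074400 * s + 414904768800 * s ^ 2 + 724937492400 * s ^ 3) =
      1 + ?Q * (- 28251553672 / 3 + 17243004146560 / 3 * s + 104781331877360 / 3 * s ^ 2 +
        69571275938080 * s ^ 3 + 150457664805440 / 3 * s ^ 4 + 32863832988800 / 3 * s ^ 5)"
    unfolding c_def defs by (simp add: field_simps eval_nat_numeral)
  then have c0: "c \<noteq> 0" unfolding s by auto
  define g where "g = 19 * a1 * b4 * d1 - 11 * a1 * b3 * d2 + 11 * a2 * b1 * d2 + 19 * a2 * b4 +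
    60 * a3 * a3 - 15 * a3 * b1 * d1 - 15 * a3 * b3 + 60 * b4 * d2"
  have "g * (1160266044 + 3088325130 * s - 1419980650 * s ^ 2 - 2481044540 * s ^ 3) =
      1 + ?Q * (- 137104770865 + 127595849478 * s + 12152327763814 / 3 * s ^ 2 +
        89140102588270 / 9 * s ^ 3 + 64502338288120 / 9 * s ^ 4 + 16376156742440 / 27 * s ^ 5 -
        10567140341300 / 9 * s ^ 6 - 16026468383200 / 27 * s ^ 7 - 2729148994000 / 27 * s ^ 8)"
    unfolding g_def defs by (simp add: field_simps eval_nat_numeral)
  then have g0: "g \<noteq> 0" unfolding s by auto
  let ?p = "Vr (Inl 0) :: (nat + nat) mpol" and ?x = "Vr (Inr 0) :: (nat + nat) mpol" and ?y = "Vr (Inr 1) :: (nat + nat) mpol"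
  define A1 A2 A3 D1 D2 B1 B2 B3 B4 :: "(nat + nat) mpol" where "A1 = Cst a1" and "A2 = Cst a2"
    and "A3 = Cst a3" and "D1 = Cst d1" and "D2 = Cst d2" and "B1 = Cst b1" and "B2 = Cst b2"
    and "B3 = Cst b3" and "B4 = Cst b4"
  note Defs = A1_def A2_def A3_def D1_def D2_def B1_def B2_def B3_def B4_def
  have Eq: "- 1 - D1 - 2 * A1 = 0" "A1 ^ 2 - B1 - D2 = 0" "D1 + B2 = 0" "D1 - B2 - 2 * A2 + B1 = 0"
    "D2 + D1 * B2 + B3 = 0" "2 * (A1 * A2) + D2 + D1 * B1 - B3 - 2 * A3 = 0"
    "2 * (A1 * A3) + D2 * B1 - B4 = 0" "A2 ^ 2 + D1 * B3 + D2 * B2 + B4 = 0"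
    "2 * (A2 * A3) + D1 * B4 + D2 * B3 = 0"
    unfolding Defs by (simp_all only: Cst_fold eq1 eq2 Cst_0)
  \<comment> \<open>The weights 2/3, 2/5, 2/15 of x, y, p leave few monomials in the degrees 14/15,
    2/3 and 6/5 of \<open>a\<close>, \<open>d\<close> and \<open>b\<close>. The normalisation is: no
    y^2 p in \<open>a\<close>, coefficient -1 at x in \<open>d\<close>, coefficient 1 at y^3 and at
    x y p in \<open>b\<close>. The first and third yield x^3 and y^5 in the determinant through -x^2
    d and y^2 b.\<close>
  define a where "a = A1 * ?x * ?p ^ 2 + A2 * ?y * ?p ^ 4 + A3 * ?p ^ 7"
  define d where "d = D1 * ?y * ?p ^ 2 + D2 * ?p ^ 5 - ?x"
  define b where "b = ?y ^ 3 + ?x * ?y * ?p + B1 * ?x * ?p ^ 4 + B2 * ?y ^ 2 * ?p ^ 3 + B3 * ?y * ?p ^ 6 + B4 * ?p ^ 9"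
  let ?E = "syz_even ?x ?y a b d" and ?F = "syz_odd a b d"
  let ?T = "seed_trace 4 ?E ?F"
  have pn: "pdiff v A1 = 0" "pdiff v A2 = 0" "pdiff v A3 = 0" "pdiff v D1 = 0" "pdiff v D2 = 0"
    "pdiff v B1 = 0" "pdiff v B2 = 0" "pdiff v B3 = 0" "pdiff v B4 = 0"
    "restr S A1 = A1" "restr S A2 = A2" "restr S A3 = A3" "restr S D1 = D1" "restr S D2 = D2"
    "restr S B1 = B1" "restr S B2 = B2" "restr S B3 = B3" "restr S B4 = B4" for v S
    by (simp_all add: Defs)
  have pot: "in_y W_E8 = ?x ^ 3 + ?y ^ 5"
    by (simp add: in_y_def W_E8_def two_vars_def)
  have w: "vdeg W_E8 = (\<lambda>i. if i = 0 then 2 / 3 else 2 / 5)"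
    by (simp add: W_E8_def two_vars_def)
  \<comment> \<open>Read off from the entries -x and y of \<open>syz_even\<close>: an entry (i, j)
    has degree \<open>?\<delta> j + 1 - ?\<delta> i\<close>.\<close>
  let ?\<delta> = "\<lambda>i. [0, - 1 / 3, - 3 / 5, - 14 / 15] ! i :: rat"
  have "seed W_E8 15 c 4 ?\<delta> ?E ?F"
    unfolding seed_def
  proof (intro conjI allI impI exI)
    let ?w = "case_sum (\<lambda>_. 2 / of_nat 15) (vdeg W_E8)"
    have p3: "?x \<in> polys_in vars3" "?y \<in> polys_in vars3" "a \<in> polys_in vars3" "b \<in> polys_in vars3" "d \<in> polys_in vars3"
      by (auto simp: polys_in_Vr vars3_def a_def b_def d_def Defs intro!: polys_in_intros)
    show "?E i j \<in> polys_in vars3" "?F i j \<in> polys_in vars3" for i j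
      using p3 by (auto simp: syz_even_def syz_odd_def blk_def m22_def intro!: polys_in_intros)
    have hx: "homogeneous ?w (2 / 3) ?x" "homogeneous ?w (2 / 5) ?y"
      by (rule homogeneous_VrI; simp add: w)+
    have ha: "homogeneous ?w (14 / 15) a" "homogeneous ?w (6 / 5) b" "homogeneous ?w (2 / 3) d"
      unfolding a_def b_def d_def Defs by ((rule refl | rule homogeneous_intros | simp add: w)+)
    have hs: "homogeneous ?w (4 / 3) (?x * d + ?y * a)" "homogeneous ?w (8 / 5) (?y * b - ?x * a)"
      "homogeneous ?w (28 / 15) (a * a + d * b)"
      by (intro homogeneous_add homogeneous_diff homogeneous_mult[OF hx(1) ha(3)] homogeneous_mult[OF hx(2) ha(1)]
          homogeneous_mult[OF hx(2) ha(2)] homogeneous_mult[OF hx(1) ha(1)] homogeneous_mult[OF ha(1) ha(1)]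
          homogeneous_mult[OF ha(3) ha(2)]; simp)+
    fix i j :: nat assume ij: "i < 4" "j < 4"
    show "homogeneous ?w (?\<delta> j + 1 - ?\<delta> i) (?E i j)"
      using hx hs homogeneous_uminus[OF hs(1)] by (rule_tac less_4_cases[OF ij(1)]; rule_tac less_4_cases[OF ij(2)])
        (simp_all add: syz_even_def blk_def m22_def homogeneous_uminus)
    show "homogeneous ?w (?\<delta> j + 1 - ?\<delta> i - 1 / of_nat 15) (?F i j)"
      using ha hs homogeneous_uminus[OF hs(3)] homogeneous_uminus[OF homogeneous_1[of ?w]]
      by (rule_tac less_4_cases[OF ij(1)]; rule_tac less_4_cases[OF ij(2)])
        (simp_all add: syz_odd_def blk_def m22_def homogeneous_uminus)
    have "?p * (a * a + b * d) - ?x * ?x * d - 2 * ?x * ?y * a + ?y * ?y * b =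
        ?x ^ 3 + ?y ^ 5 - (- (A3 ^ 2 + D2 * B4)) * ?p ^ 15 +
        (- 1 - D1 - 2 * A1) * (?x ^ 2 * ?y * ?p ^ 2) + (A1 ^ 2 - B1 - D2) * (?x ^ 2 * ?p ^ 5) +
        (D1 + B2) * (?y ^ 4 * ?p ^ 3) + (D1 - B2 - 2 * A2 + B1) * (?x * ?y ^ 2 * ?p ^ 4) +
        (D2 + D1 * B2 + B3) * (?y ^ 3 * ?p ^ 6) +
        (2 * (A1 * A2) + D2 + D1 * B1 - B3 - 2 * A3) * (?x * ?y * ?p ^ 7) +
        (2 * (A1 * A3) + D2 * B1 - B4) * (?x * ?p ^ 10) +
        (A2 ^ 2 + D1 * B3 + D2 * B2 + B4) * (?y ^ 2 * ?p ^ 9) +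
        (2 * (A2 * A3) + D1 * B4 + D2 * B3) * (?y * ?p ^ 12)"
      unfolding a_def b_def d_def by (simp add: algebra_simps eval_nat_numeral)
    also have "- (A3 ^ 2 + D2 * B4) = Cst c"
      unfolding Defs c_def by (simp only: Cst_fold)
    finally have h: "in_y W_E8 - Cst c * ?p ^ 15 = ?p * (a * a + b * d) - ?x * ?x * d - 2 * ?x * ?y * a + ?y * ?y * b"
      unfolding Eq pot by simp
    show "fmul 4 ?E ?E i j + ?p * fmul 4 ?F ?F i j = (if i = j then in_y W_E8 - Cst c * ?p ^ 15 else 0)"
      unfolding syz_square[OF h]
      by (rule less_4_cases[OF ij(1)]; rule less_4_cases[OF ij(2)]) (simp_all add: blk_def m22_def)
    show "fmul 4 ?E ?F i j + fmul 4 ?F ?E i j = 0"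
      by (rule syz_anticommute)
  next
    have "restr {Inl 0} ?T = (19 * A1 * B4 * D1 - 11 * A1 * B3 * D2 + 11 * A2 * B1 * D2 + 19 * A2 * B4 +
        60 * A3 * A3 - 15 * A3 * B1 * D1 - 15 * A3 * B3 + 60 * B4 * D2) * ?p ^ 14"
      unfolding seed_trace_syz unfolding a_def b_def d_def
      by (simp add: pdiff_Vr pdiff_power pn restr_Vr algebra_simps eval_nat_numeral)
    also have "19 * A1 * B4 * D1 - 11 * A1 * B3 * D2 + 11 * A2 * B1 * D2 + 19 * A2 * B4 +
        60 * A3 * A3 - 15 * A3 * B1 * D1 - 15 * A3 * B3 + 60 * B4 * D2 = Cst g"
      unfolding Defs g_def by (simp only: Cst_fold)
    finally have "lookup ?T (single (Inl 0) 14) = g"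
      by (rule lookup_restr_power)
    then show "lookup ?T (single (Inl 0) (15 - 1)) \<noteq> 0"
      using g0 by simp
    show "residue_data W_E8 (3 - 2) (5 - 2) (Cst (1 / (of_nat 3 * of_nat 5)))"
      unfolding W_E8_eq_Fermat by (rule residue_data_Fermat) simp_all
    let ?R = "rename Inr (Cst (1 / (of_nat 3 * of_nat 5))) * ?T"
    have "restr {Inr 0, Inr 1} ?T = Cst (- 15) * (?x ^ 1 * ?y ^ 3)"
      unfolding seed_trace_syz unfolding a_def b_def d_def
      by (simp add: pdiff_Vr pdiff_power pn restr_Vr Cst_uminus algebra_simps eval_nat_numeral)
    then have "restr {Inr 0, Inr 1} ?R = Cst (1 / (of_nat 3 * of_nat 5)) * (Cst (- 15) * (?x ^ 1 * ?y ^ 3))"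
      by (simp only: restr_hom rename_hom)
    then have "lookup ?R (res_mon Inr (3 - 2) (5 - 2)) = - 1"
      by (subst lookup_restr_res_mon, assumption)
        (simp only: lookup_add lookup_Cst_mult lookup_Inr_monomial, simp)
    then show "lookup ?R (res_mon Inr (3 - 2) (5 - 2)) \<noteq> 0"
      by simp
  qed
  then show ?thesis using c0 by blast
qed

section \<open>Assembly of the classes by Coxeter number\<close>

section \<open>Classification\<close>

definition degree_sum :: "graded_poly \<Rightarrow> rat" where
  "degree_sum W = vdeg W 0 + vdeg W 1"

lemma degree_sum_simps:
  "degree_sum (W_A k) = 1 + 2 / of_nat (k + 1)" "degree_sum (W_D (k + 1)) = 1 + 2 / of_nat (2 * k)"
  "degree_sum W_E6 = 1 + 2 / of_nat 12" "degree_sum W_E7 = 1 + 2 / of_nat 18" "degree_sum W_E8 = 1 + 2 / of_nat 30"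
  by (simp_all add: degree_sum_def W_A_def W_D_def W_E6_def W_E7_def W_E8_def two_vars_def field_simps)

lemma strongly_equivalent_A:
  assumes "d \<ge> 2"
  shows "strongly_equivalent (W_A (d - 1)) (W_A (d - 1))"
  using assms by (simp only: W_A_eq_Fermat strongly_equivalent_refl_Fermat)

text \<open>When W is itself of type D, the type D half of the seed construction supplies
  reflexivity, so no Koszul factorization for D is required.\<close>

lemma strongly_equivalent_AD:
  assumes "k \<ge> 3"
  shows "strongly_equivalent (W_A (2 * k - 1)) (W_D (k + 1))" "strongly_equivalent (W_D (k + 1)) (W_D (k + 1))"
proof -
  obtain \<delta> E F where "seed (W_D (k + 1)) k 1 2 \<delta> E F" using seed_D[OF assms] by blast
  from seed_equivalent[OF this one_neq_zero assms]
  show "strongly_equivalent (W_A (2 * k - 1)) (W_D (k + 1))" "strongly_equivalent (W_D (k + 1)) (W_D (k + 1))" .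
qed

lemma strongly_equivalent_E6:
  "strongly_equivalent (W_A 11) W_E6" "strongly_equivalent (W_D 7) W_E6" "strongly_equivalent W_E6 W_E6"
proof -
  obtain c \<delta> E F where "c \<noteq> 0" "seed W_E6 6 c 2 \<delta> E F" using seed_E6 by blast
  from seed_equivalent[OF this(2,1)] show "strongly_equivalent (W_A 11) W_E6" "strongly_equivalent (W_D 7) W_E6"
    by simp_all
  show "strongly_equivalent W_E6 W_E6"
    unfolding W_E6_eq_Fermat by (rule strongly_equivalent_refl_Fermat) simp_all
qed

lemma strongly_equivalent_E7:
  "strongly_equivalent (W_A 17) W_E7" "strongly_equivalent (W_D 10) W_E7"
proof -
  obtain c \<delta> E F where "c \<noteq> 0" "seed W_E7 9 c 2 \<delta> E F" using seed_E7 by blast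
  from seed_equivalent[OF this(2,1)] show "strongly_equivalent (W_A 17) W_E7" "strongly_equivalent (W_D 10) W_E7"
    by simp_all
qed

lemma strongly_equivalent_E8:
  "strongly_equivalent (W_A 29) W_E8" "strongly_equivalent (W_D 16) W_E8" "strongly_equivalent W_E8 W_E8"
proof -
  obtain c \<delta> E F where "c \<noteq> 0" "seed W_E8 15 c 4 \<delta> E F" using seed_E8 by blast
  from seed_equivalent[OF this(2,1)] show "strongly_equivalent (W_A 29) W_E8" "strongly_equivalent (W_D 16) W_E8"
    by simp_all
  show "strongly_equivalent W_E8 W_E8"
    unfolding W_E8_eq_Fermat by (rule strongly_equivalent_refl_Fermat) simp_all
qed

text \<open>The index is the common Coxeter number: it is d for \<open>W_A (d - 1)\<close> and
  \<open>W_D (d div 2 + 1)\<close>, and 12, 18, 30 for E6, E7, E8.\<close>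

definition coxeter_class :: "nat \<Rightarrow> graded_poly set" where
  "coxeter_class d = {W_A (d - 1)} \<union> (if even d \<and> d div 2 \<ge> 3 then {W_D (d div 2 + 1)} else {}) \<union>
     (if d = 12 then {W_E6} else {}) \<union> (if d = 18 then {W_E7} else {}) \<union> (if d = 30 then {W_E8} else {})"

lemma coxeter_class_cases [consumes 1, case_names A D E6 E7 E8]:
  assumes "W \<in> coxeter_class d"
  obtains (A) "W = W_A (d - 1)" | (D) k where "k \<ge> 3" "d = 2 * k" "W = W_D (k + 1)"
    | (E6) "d = 12" "W = W_E6" | (E7) "d = 18" "W = W_E7" | (E8) "d = 30" "W = W_E8"
  using assms by (auto simp: coxeter_class_def split: if_splits elim!: evenE)

lemma ADE_coxeter_class:
  assumes "W \<in> ADE"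
  obtains d where "d \<ge> 2" "W \<in> coxeter_class d"
  using assms
proof (cases rule: ADE_cases)
  case (A d)
  then show ?thesis by (intro that[of d]) (auto simp: coxeter_class_def)
next
  case (D k)
  then show ?thesis by (intro that[of "2 * k"]) (auto simp: coxeter_class_def)
next
  case E6
  then show ?thesis by (intro that[of 12]) (auto simp: coxeter_class_def)
next
  case E7
  then show ?thesis by (intro that[of 18]) (auto simp: coxeter_class_def)
next
  case E8
  then show ?thesis by (intro that[of 30]) (auto simp: coxeter_class_def)
qed

lemma coxeter_class_subset: "d \<ge> 2 \<Longrightarrow> coxeter_class d \<subseteq> ADE"
  by (rule subsetI, erule coxeter_class_cases) (auto simp: ADE_def)

lemma degree_sum_coxeter_class:
  assumes "d \<ge> 2" "W \<in> coxeter_class d"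
  shows "degree_sum W = 1 + 2 / of_nat d"
  using assms(2)
proof (cases rule: coxeter_class_cases)
  case A
  have "d - 1 + 1 = d" using assms(1) by simp
  then show ?thesis unfolding A degree_sum_simps by metis
next
  case (D k)
  then show ?thesis by (simp only: degree_sum_simps)
qed (simp_all only: degree_sum_simps)

text \<open>Every ordered pair is served directly: seeds give A-D, D-D, A-E and D-E, Koszul
  factorizations give A-A and E-E, and symmetry gives the reversed pairs.\<close>

lemma coxeter_class_equivalent:
  assumes "d \<ge> 2" "V \<in> coxeter_class d" "W \<in> coxeter_class d"
  shows "strongly_equivalent V W"
proof -
  note st = strongly_equivalent_A[OF assms(1)] strongly_equivalent_AD strongly_equivalent_E6
    strongly_equivalent_E7 strongly_equivalent_E8 strongly_equivalent_refl_E7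
  have e: "(2::nat) * k = 12 \<longleftrightarrow> k = 6" "(2::nat) * k = 18 \<longleftrightarrow> k = 9" "(2::nat) * k = 30 \<longleftrightarrow> k = 15" for k
    by auto
  show ?thesis
    using assms(2)
  proof (cases rule: coxeter_class_cases)
    case A
    show ?thesis
      using assms(3) by (cases rule: coxeter_class_cases) (use A st in auto)
  next
    case (D k)
    show ?thesis
      using assms(3) by (cases rule: coxeter_class_cases)
        (use D st e st(2)[THEN strongly_equivalent_sym] in auto)
  next
    case E6
    show ?thesis
      using assms(3) by (cases rule: coxeter_class_cases)
        (use E6 st e st(4,5)[THEN strongly_equivalent_sym] in auto)
  next
    case E7
    show ?thesis
      using assms(3) by (cases rule: coxeter_class_cases)
        (use E7 st e st(7,8)[THEN strongly_equivalent_sym] in auto)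
  next
    case E8
    show ?thesis
      using assms(3) by (cases rule: coxeter_class_cases)
        (use E8 st e st(9,10)[THEN strongly_equivalent_sym] in auto)
  qed
qed

text \<open>The degree sum 1 + 2/d determines d, which forces equivalent potentials into one class;
  the converse is the list of constructed factorizations.\<close>

lemma orbifold_rel_iff:
  "(V, W) \<in> orbifold_rel \<longleftrightarrow> (\<exists>d\<ge>2. V \<in> coxeter_class d \<and> W \<in> coxeter_class d)"
proof
  assume "(V, W) \<in> orbifold_rel"
  then have VW: "V \<in> ADE" "W \<in> ADE" "orbifold_equivalent V W"
    by (auto simp: orbifold_rel_def)
  obtain d where d: "d \<ge> 2" "V \<in> coxeter_class d" using VW(1) by (rule ADE_coxeter_class)
  obtain d' where d': "d' \<ge> 2" "W \<in> coxeter_class d'" using VW(2) by (rule ADE_coxeter_class)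
  have "degree_sum V = degree_sum W"
    unfolding degree_sum_def using VW by (intro orbifold_equivalent_vdeg two_var_potential_ADE)
  then have "2 / of_nat d = (2 / of_nat d' :: rat)"
    using degree_sum_coxeter_class[OF d] degree_sum_coxeter_class[OF d'] by simp
  then have "d = d'"
    using d(1) d'(1) by (simp add: field_simps)
  then show "\<exists>d\<ge>2. V \<in> coxeter_class d \<and> W \<in> coxeter_class d"
    using d d' by blast
next
  assume "\<exists>d\<ge>2. V \<in> coxeter_class d \<and> W \<in> coxeter_class d"
  then obtain d where d: "d \<ge> 2" "V \<in> coxeter_class d" "W \<in> coxeter_class d" by blast
  then have "V \<in> ADE" "W \<in> ADE" using coxeter_class_subset by blast+
  then show "(V, W) \<in> orbifold_rel"
    using coxeter_class_equivalent[OF d] strongly_equivalent_orbifold two_var_potential_ADE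
    by (simp add: orbifold_rel_def)
qed

lemma coxeter_class_unique:
  "d \<ge> 2 \<Longrightarrow> d' \<ge> 2 \<Longrightarrow> W \<in> coxeter_class d \<Longrightarrow> W \<in> coxeter_class d' \<Longrightarrow> d = d'"
  using degree_sum_coxeter_class[of d W] degree_sum_coxeter_class[of d' W] by (simp add: field_simps)

lemma orbifold_rel_Image: "d \<ge> 2 \<Longrightarrow> V \<in> coxeter_class d \<Longrightarrow> orbifold_rel `` {V} = coxeter_class d"
  by (auto simp: orbifold_rel_iff) (metis coxeter_class_unique)

lemma coxeter_class_eq:
  "odd d \<Longrightarrow> coxeter_class d = {W_A (d - 1)}"
  "even d \<Longrightarrow> d \<notin> {12, 18, 30} \<Longrightarrow>
    coxeter_class d = {W_A (d - 1)} \<union> (if d div 2 \<ge> 3 then {W_D (d div 2 + 1)} else {})"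
  "coxeter_class 12 = {W_A 11, W_D 7, W_E6}" "coxeter_class 18 = {W_A 17, W_D 10, W_E7}"
  "coxeter_class 30 = {W_A 29, W_D 16, W_E8}"
  by (auto simp: coxeter_class_def)

theorem theorem5p2p6:
  shows "equiv ADE orbifold_rel \<and>
    ADE // orbifold_rel =
      {{W_A (d - 1)} | d. d \<ge> 2 \<and> odd d}
      \<union> {{W_A (d - 1)} \<union> (if d div 2 \<ge> 3 then {W_D (d div 2 + 1)} else {}) | d.
           d \<ge> 2 \<and> even d \<and> d \<notin> {12, 18, 30}}
      \<union> {{W_A 11, W_D 7, W_E6}, {W_A 17, W_D 10, W_E7}, {W_A 29, W_D 16, W_E8}}"
    (is "_ \<and> _ = ?O \<union> ?N \<union> ?X")
proof
  show "equiv ADE orbifold_rel"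
  proof (rule equivI)
    show "orbifold_rel \<subseteq> ADE \<times> ADE" by (auto simp: orbifold_rel_def)
    show "refl_on ADE orbifold_rel"
      by (auto simp: refl_on_def orbifold_rel_iff elim!: ADE_coxeter_class)
    show "sym orbifold_rel" by (auto simp: sym_def orbifold_rel_iff)
    \<comment> \<open>Transitivity amounts to disjointness of the classes: the middle potential
      determines d.\<close>
    show "trans orbifold_rel"
      using coxeter_class_unique by (auto simp: trans_def orbifold_rel_iff)
  qed
  have "ADE // orbifold_rel = coxeter_class ` {2..}"
  proof (intro equalityI subsetI)
    fix X assume "X \<in> ADE // orbifold_rel"
    then obtain V where "V \<in> ADE" "X = orbifold_rel `` {V}" by (auto simp: quotient_def)
    then show "X \<in> coxeter_class ` {2..}"
      by (auto elim!: ADE_coxeter_class simp: orbifold_rel_Image)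
  next
    fix X assume "X \<in> coxeter_class ` {2..}"
    then obtain d where d: "d \<ge> 2" "X = coxeter_class d" by auto
    have "W_A (d - 1) \<in> coxeter_class d" by (simp add: coxeter_class_def)
    then show "X \<in> ADE // orbifold_rel"
      using d coxeter_class_subset[OF d(1)] orbifold_rel_Image[OF d(1)] by (auto simp: quotient_def)
  qed
  also have "\<dots> = ?O \<union> ?N \<union> ?X"
  proof (intro equalityI subsetI)
    fix X assume "X \<in> coxeter_class ` {2..}"
    then obtain d where d: "d \<ge> 2" "X = coxeter_class d" by auto
    show "X \<in> ?O \<union> ?N \<union> ?X"
    proof (cases "odd d")
      case True
      then have "X \<in> ?O" using d coxeter_class_eq(1) by blast
      then show ?thesis by blast
    next
      case False
      show ?thesis
      proof (cases "d \<in> {12, 18, 30}")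
        case True
        then have "X \<in> ?X" using d coxeter_class_eq(3-5) by auto
        then show ?thesis by blast
      next
        case ne: False
        then have "X \<in> ?N" using d False coxeter_class_eq(2)[OF _ ne] by blast
        then show ?thesis by blast
      qed
    qed
  next
    have *: "\<exists>d\<ge>2. X = coxeter_class d \<Longrightarrow> X \<in> coxeter_class ` {2..}" for X by auto
    fix X assume "X \<in> ?O \<union> ?N \<union> ?X"
    then consider "X \<in> ?O" | "X \<in> ?N" | "X = coxeter_class 12" | "X = coxeter_class 18" | "X = coxeter_class 30"
      unfolding coxeter_class_eq(3-5) by blast
    then show "X \<in> coxeter_class ` {2..}"
    proof cases
      case 1
      then obtain d where "d \<ge> 2" "odd d" "X = {W_A (d - 1)}" by blast
      then show ?thesis by (intro * exI[of _ d]) (simp only: coxeter_class_eq(1) simp_thms)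
    next
      case 2
      then obtain d where "d \<ge> 2" "even d" "d \<notin> {12, 18, 30}"
        "X = {W_A (d - 1)} \<union> (if d div 2 \<ge> 3 then {W_D (d div 2 + 1)} else {})" by blast
      then show ?thesis by (intro * exI[of _ d]) (simp only: coxeter_class_eq(2) simp_thms)
    qed auto
  qed
  finally show "ADE // orbifold_rel = ?O \<union> ?N \<union> ?X" .
qed

end
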